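(* Let $0<n\le d$ be integers and $0<C_1<\infty$. Let $A:\mathbb{R}^n\to\mathbb{R}^{d-n}$ be a Lipschitz map with $\|\nabla A\|_\infty\le C_1$, let $\Gamma=\{(x,y)\in\mathbb{R}^n\times\mathbb{R}^{d-n}: y=A(x)\}$ be its graph, and let $d\mu(z)=\rho(z)\,d\mathcal{H}^n_{|\Gamma}(z)$, where $\rho$ is a (Borel) function with $0\le\rho(z)\le C_1$ for all $z\in\Gamma$. Then there is a constant $C_2$ depending only on $n$, $d$ and $C_1$ such that $$\sum_{Q\in\mathcal{D}_{\mathbb{R}^d}(R)}\alpha(Q)^2\,\mu(Q)\le C_2\,\ell(R)^n$$ for every cube $R\subset\mathbb{R}^d$ with sides parallel to the axes which intersects $\operatorname{supp}(\mu)$.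
   Context: $\mathcal{H}^n$ is $n$-dimensional Hausdorff measure; $\mathcal{H}^n_{|F}$ is its restriction to $F$. For a cube $Q\subset\mathbb{R}^d$, $\ell(Q)$ is its side length, $z_Q$ its center, $\operatorname{diam}(Q)$ its diameter. $\mathcal{D}_{\mathbb{R}^d}(R)$ is the collection of all cubes contained in $R$ obtained by splitting $R$ dyadically ($R$ itself, its $2^d$ subcubes of side length $\ell(R)/2$, and so on). For a closed ball $B\subset\mathbb{R}^d$ and Borel measures $\sigma,\nu$ (finite on $B$), $$\operatorname{dist}_B(\sigma,\nu)=\sup\Bigl\{\Bigl|\int f\,d\sigma-\int f\,d\nu\Bigr|:\ \operatorname{Lip}(f)\le1,\ \operatorname{supp}(f)\subset B\Bigr\},$$ where $\operatorname{Lip}(f)$ is the Lipschitz constant of $f:\mathbb{R}^d\to\mathbb{R}$. For a cube $Q$ which intersects $\operatorname{supp}(\mu)$, let $B_Q=B(z_Q,3\operatorname{diam}(Q))$ (closed ball) and $$\alpha(Q)=\frac1{\ell(Q)^{n+1}}\inf_{c\ge0,\,L}\operatorname{dist}_{B_Q}(\mu,\,c\,\mathcal{H}^n_{|L}),$$ the infimum being over all constants $c\ge0$ and all affine $n$-planes $L\subset\mathbb{R}^d$. If $Q\cap\operatorname{supp}(\mu)=\varnothing$, set $\alpha(Q)=0$. *)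

theory Defs
  imports "HOL-Analysis.Analysis"
begin

section \<open>Hausdorff measure\<close>

text \<open>The constant makes the \<open>n\<close>-dimensional Hausdorff measure of \<open>\<real>\<^sup>n\<close> agree with Lebesgue measure.
  The empty set is treated separately because \<open>0 ^ 0 = 1\<close>.\<close>

definition hausdorff_gauge :: "nat \<Rightarrow> 'a::metric_space set \<Rightarrow> ennreal" where
  "hausdorff_gauge n U =
     (if U = {} then 0 else ennreal (unit_ball_vol (real n) * (diameter U / 2) ^ n))"

text \<open>The boundedness condition is needed since \<^const>\<open>diameter\<close> is unspecified on unbounded sets.\<close>

definition hausdorff_pre :: "nat \<Rightarrow> real \<Rightarrow> 'a::metric_space set \<Rightarrow> ennreal" where
  "hausdorff_pre n \<delta> X =
     (INF U \<in> {U :: nat \<Rightarrow> 'a set. X \<subseteq> (\<Union>i. U i) \<and> (\<forall>i. bounded (U i) \<and> diameter (U i) \<le> \<delta>)}.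
        \<Sum>i. hausdorff_gauge n (U i))"

definition hausdorff_outer :: "nat \<Rightarrow> 'a::metric_space set \<Rightarrow> ennreal" where
  "hausdorff_outer n X = (SUP \<delta>\<in>{0<..}. hausdorff_pre n \<delta> X)"

definition hausdorff_measure :: "nat \<Rightarrow> 'a::metric_space measure" where
  "hausdorff_measure n = measure_of UNIV (sets borel) (hausdorff_outer n)"

text \<open>The restriction of Hausdorff measure to a Borel set, as a measure on the whole space.\<close>

definition hausdorff_on :: "nat \<Rightarrow> 'a::metric_space set \<Rightarrow> 'a measure" where
  "hausdorff_on n F = density (hausdorff_measure n) (indicator F)"

text \<open>The following lemmas show that \<^const>\<open>hausdorff_measure\<close> takes the values of
  \<^const>\<open>hausdorff_outer\<close> on Borel sets (\<^const>\<open>measure_of\<close> would otherwise default to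
  the zero measure).\<close>

lemma hausdorff_gauge_empty [simp]: "hausdorff_gauge n {} = 0"
  by (simp add: hausdorff_gauge_def)

lemma hausdorff_pre_antimono:
  assumes "\<delta> \<le> \<epsilon>"
  shows "hausdorff_pre n \<epsilon> X \<le> hausdorff_pre n \<delta> X"
  unfolding hausdorff_pre_def using assms
  by (intro INF_superset_mono) (auto intro: order_trans)

lemma hausdorff_pre_mono:
  assumes "X \<subseteq> Y"
  shows "hausdorff_pre n \<delta> X \<le> hausdorff_pre n \<delta> Y"
  unfolding hausdorff_pre_def using assms
  by (intro INF_superset_mono) auto

lemma hausdorff_pre_le_outer: "0 < \<delta> \<Longrightarrow> hausdorff_pre n \<delta> X \<le> hausdorff_outer n X"
  unfolding hausdorff_outer_def by (rule SUP_upper) auto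

lemma hausdorff_outer_mono:
  assumes "X \<subseteq> Y"
  shows "hausdorff_outer n X \<le> hausdorff_outer n Y"
  unfolding hausdorff_outer_def by (intro SUP_mono') (rule hausdorff_pre_mono[OF assms])

lemma hausdorff_outer_empty [simp]: "hausdorff_outer n {} = 0"
proof -
  have "hausdorff_pre n \<delta> ({}::'a set) \<le> 0" if "0 < \<delta>" for \<delta>
    unfolding hausdorff_pre_def using that by (intro INF_lower2[of "\<lambda>i. {}"]) auto
  then show ?thesis
    unfolding hausdorff_outer_def by (metis SUP_least greaterThan_iff le_zero_eq)
qed

lemma hausdorff_pre_countable_subadditive:
  fixes A :: "nat \<Rightarrow> 'a::metric_space set"
  shows "hausdorff_pre n \<delta> (\<Union>i. A i) \<le> (\<Sum>i. hausdorff_pre n \<delta> (A i))"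
proof (rule ennreal_le_epsilon)
  fix e :: real assume fin: "(\<Sum>i. hausdorff_pre n \<delta> (A i)) < top" and e: "0 < e"
  let ?C = "\<lambda>X. {U :: nat \<Rightarrow> 'a set. X \<subseteq> (\<Union>i. U i) \<and> (\<forall>i. bounded (U i) \<and> diameter (U i) \<le> \<delta>)}"
  have pos: "0 < e * (1/2) ^ Suc i" for i using e by simp
  have "\<exists>U\<in>?C (A i). (\<Sum>j. hausdorff_gauge n (U j)) \<le> hausdorff_pre n \<delta> (A i) + ennreal (e * (1/2) ^ Suc i)" for i
  proof -
    have "hausdorff_pre n \<delta> (A i) \<noteq> top"
      using fin ennreal_suminf_lessD[OF fin, of i] by auto
    then have "hausdorff_pre n \<delta> (A i) < hausdorff_pre n \<delta> (A i) + ennreal (e * (1/2) ^ Suc i)"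
      using pos[of i]
      by (cases "hausdorff_pre n \<delta> (A i)") (auto simp: ennreal_plus[symmetric] ennreal_less_iff simp del: ennreal_plus)
    then obtain U where "U \<in> ?C (A i)"
      "(\<Sum>j. hausdorff_gauge n (U j)) < hausdorff_pre n \<delta> (A i) + ennreal (e * (1/2) ^ Suc i)"
      unfolding hausdorff_pre_def by (auto simp: INF_less_iff)
    then show ?thesis by (meson less_imp_le)
  qed
  then have "\<forall>i. \<exists>U. U \<in> ?C (A i) \<and>
      (\<Sum>j. hausdorff_gauge n (U j)) \<le> hausdorff_pre n \<delta> (A i) + ennreal (e * (1/2) ^ Suc i)"
    by (simp only: Bex_def) blast
  from choice[OF this] obtain U where U: "\<And>i. U i \<in> ?C (A i)"
    and le: "\<And>i. (\<Sum>j. hausdorff_gauge n (U i j)) \<le> hausdorff_pre n \<delta> (A i) + ennreal (e * (1/2) ^ Suc i)"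
    by (simp only: all_conj_distrib) blast
  define V where "V k = (case prod_decode k of (i, j) \<Rightarrow> U i j)" for k
  have "x \<in> (\<Union>k. V k)" if x: "x \<in> A i" for x i
  proof -
    obtain j where "x \<in> U i j" using U[of i] x by blast
    then have "x \<in> V (prod_encode (i, j))" by (simp add: V_def)
    then show ?thesis by blast
  qed
  moreover have "bounded (V k) \<and> diameter (V k) \<le> \<delta>" for k
    using U by (auto simp: V_def split: prod.split)
  ultimately have "V \<in> ?C (\<Union>i. A i)" by blast
  then have "hausdorff_pre n \<delta> (\<Union>i. A i) \<le> (\<Sum>k. hausdorff_gauge n (V k))"
    unfolding hausdorff_pre_def by (rule INF_lower)
  also have "\<dots> = (\<Sum>k. (\<lambda>(i, j). hausdorff_gauge n (U i j)) (prod_decode k))"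
    by (simp add: V_def split_def)
  also have "\<dots> = (\<Sum>i. \<Sum>j. hausdorff_gauge n (U i j))"
    by (rule suminf_ennreal_2dimen) simp
  also have "\<dots> \<le> (\<Sum>i. hausdorff_pre n \<delta> (A i) + ennreal (e * (1/2) ^ Suc i))"
    by (intro suminf_le le) auto
  also have "\<dots> = (\<Sum>i. hausdorff_pre n \<delta> (A i)) + (\<Sum>i. ennreal (e * (1/2) ^ Suc i))"
    by (rule suminf_add[symmetric]) auto
  also have "(\<Sum>i. ennreal (e * (1/2) ^ Suc i)) = ennreal e"
    using sums_mult[OF power_half_series, of e] e
    by (intro suminf_ennreal_eq) auto
  finally show "hausdorff_pre n \<delta> (\<Union>i. A i) \<le> (\<Sum>i. hausdorff_pre n \<delta> (A i)) + ennreal e" .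
qed

lemma hausdorff_outer_countable_subadditive:
  "hausdorff_outer n (\<Union>i::nat. A i) \<le> (\<Sum>i. hausdorff_outer n (A i))"
proof -
  have "hausdorff_pre n \<delta> (\<Union>i. A i) \<le> (\<Sum>i. hausdorff_outer n (A i))" if "0 < \<delta>" for \<delta>
    by (rule order_trans[OF hausdorff_pre_countable_subadditive])
       (intro suminf_le hausdorff_pre_le_outer that, auto)
  then show ?thesis
    by (subst hausdorff_outer_def) (auto intro!: SUP_least)
qed

lemma outer_measure_space_hausdorff: "outer_measure_space (Pow UNIV) (hausdorff_outer n)"
  by (auto simp: outer_measure_space_def positive_def increasing_def countably_subadditive_def
        intro: hausdorff_outer_mono hausdorff_outer_countable_subadditive)

lemma hausdorff_outer_Un_le: "hausdorff_outer n (X \<union> Y) \<le> hausdorff_outer n X + hausdorff_outer n Y"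
proof -
  have "subadditive (Pow UNIV) (hausdorff_outer n :: 'a set \<Rightarrow> _)"
  proof (rule ring_of_sets.countably_subadditive_subadditive)
    show "ring_of_sets UNIV (Pow (UNIV::'a set))" by (rule ring_of_sets_Pow)
  qed (use outer_measure_space_hausdorff in \<open>auto simp: outer_measure_space_def\<close>)
  then have "hausdorff_outer n (X \<union> (Y - X)) \<le> hausdorff_outer n X + hausdorff_outer n (Y - X)"
    by (rule subadditiveD) auto
  also have "\<dots> \<le> hausdorff_outer n X + hausdorff_outer n Y"
    by (intro add_left_mono hausdorff_outer_mono) auto
  finally show ?thesis by simp
qed

lemma hausdorff_pre_separated:
  fixes X Y :: "'a::metric_space set"
  assumes r: "\<And>x y. x \<in> X \<Longrightarrow> y \<in> Y \<Longrightarrow> r \<le> dist x y" and "\<delta> < r"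
  shows "hausdorff_pre n \<delta> X + hausdorff_pre n \<delta> Y \<le> hausdorff_pre n \<delta> (X \<union> Y)"
  unfolding hausdorff_pre_def[of n \<delta> "X \<union> Y"]
proof (rule INF_greatest)
  fix U :: "nat \<Rightarrow> 'a set"
  assume "U \<in> {U. X \<union> Y \<subseteq> (\<Union>i. U i) \<and> (\<forall>i. bounded (U i) \<and> diameter (U i) \<le> \<delta>)}"
  then have U: "X \<union> Y \<subseteq> (\<Union>i. U i)" "\<And>i. bounded (U i)" "\<And>i. diameter (U i) \<le> \<delta>" by auto
  have d: "0 \<le> \<delta>" using diameter_ge_0[OF U(2)[of 0]] U(3)[of 0] by linarith
  define V where "V Z i = (if U i \<inter> Z = {} then {} else U i)" for Z i
  have V: "hausdorff_pre n \<delta> Z \<le> (\<Sum>i. hausdorff_gauge n (V Z i))" if Z: "Z \<subseteq> X \<union> Y" for Z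
    unfolding hausdorff_pre_def
  proof (rule INF_lower, safe)
    fix x assume "x \<in> Z"
    then obtain i where "x \<in> U i" using U(1) Z by blast
    with \<open>x \<in> Z\<close> have "x \<in> V Z i" by (auto simp: V_def)
    then show "x \<in> (\<Union>i. V Z i)" by blast
  qed (use U d in \<open>auto simp: V_def\<close>)
  have disj: "U i \<inter> X = {} \<or> U i \<inter> Y = {}" for i
  proof (rule ccontr)
    assume "\<not> ?thesis"
    then obtain x y where "x \<in> U i" "x \<in> X" "y \<in> U i" "y \<in> Y" by blast
    then show False
      using diameter_bounded_bound[OF U(2), of x i y] U(3)[of i] r[of x y] \<open>\<delta> < r\<close> by linarith
  qed
  have "hausdorff_pre n \<delta> X + hausdorff_pre n \<delta> Y
      \<le> (\<Sum>i. hausdorff_gauge n (V X i)) + (\<Sum>i. hausdorff_gauge n (V Y i))"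
    by (intro add_mono V) auto
  also have "\<dots> = (\<Sum>i. hausdorff_gauge n (V X i) + hausdorff_gauge n (V Y i))"
    by (rule suminf_add) auto
  also have "\<dots> \<le> (\<Sum>i. hausdorff_gauge n (U i))"
    using disj by (intro suminf_le) (auto simp: V_def)
  finally show "hausdorff_pre n \<delta> X + hausdorff_pre n \<delta> Y \<le> (\<Sum>i. hausdorff_gauge n (U i))" .
qed

lemma hausdorff_outer_eq_SUP_nat:
  "hausdorff_outer n X = (SUP k. hausdorff_pre n (1 / Suc k) X)"
proof (rule antisym)
  show "hausdorff_outer n X \<le> (SUP k. hausdorff_pre n (1 / Suc k) X)"
    unfolding hausdorff_outer_def
  proof (rule SUP_least)
    fix \<delta> :: real assume "\<delta> \<in> {0<..}"
    then obtain k where "1 / Suc k < \<delta>" using nat_approx_posE by auto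
    then show "hausdorff_pre n \<delta> X \<le> (SUP k. hausdorff_pre n (1 / Suc k) X)"
      by (intro SUP_upper2[of k] hausdorff_pre_antimono) auto
  qed
  show "(SUP k. hausdorff_pre n (1 / Suc k) X) \<le> hausdorff_outer n X"
    by (intro SUP_least hausdorff_pre_le_outer) auto
qed

lemma hausdorff_outer_separated:
  fixes X Y :: "'a::metric_space set"
  assumes r: "\<And>x y. x \<in> X \<Longrightarrow> y \<in> Y \<Longrightarrow> r \<le> dist x y" and "0 < r"
  shows "hausdorff_outer n X + hausdorff_outer n Y \<le> hausdorff_outer n (X \<union> Y)"
proof -
  have inc: "incseq (\<lambda>k. hausdorff_pre n (1 / Suc k) Z)" for Z :: "'a set"
    by (intro incseq_SucI hausdorff_pre_antimono) (simp add: frac_le)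
  have "hausdorff_outer n X + hausdorff_outer n Y
      = (SUP k. hausdorff_pre n (1 / Suc k) X + hausdorff_pre n (1 / Suc k) Y)"
    unfolding hausdorff_outer_eq_SUP_nat by (rule ennreal_SUP_add[symmetric]) (rule inc)+
  also have "\<dots> \<le> hausdorff_outer n (X \<union> Y)"
  proof (rule SUP_least)
    fix k :: nat
    define \<delta> where "\<delta> = min (1 / Suc k) (r / 2)"
    have \<delta>: "\<delta> \<le> 1 / Suc k" "\<delta> < r" "0 < \<delta>" using \<open>0 < r\<close> by (auto simp: \<delta>_def)
    have "hausdorff_pre n (1 / Suc k) X + hausdorff_pre n (1 / Suc k) Y
        \<le> hausdorff_pre n \<delta> X + hausdorff_pre n \<delta> Y"
      by (intro add_mono hausdorff_pre_antimono \<delta>)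
    also have "\<dots> \<le> hausdorff_pre n \<delta> (X \<union> Y)"
      by (rule hausdorff_pre_separated[OF r \<delta>(2)])
    also have "\<dots> \<le> hausdorff_outer n (X \<union> Y)"
      by (rule hausdorff_pre_le_outer[OF \<delta>(3)])
    finally show "hausdorff_pre n (1 / Suc k) X + hausdorff_pre n (1 / Suc k) Y
        \<le> hausdorff_outer n (X \<union> Y)" .
  qed
  finally show ?thesis .
qed

lemma hausdorff_outer_closed_split:
  fixes C X :: "'a::metric_space set"
  assumes C: "closed C"
  shows "hausdorff_outer n (X \<inter> C) + hausdorff_outer n (X - C) \<le> hausdorff_outer n X"
proof (cases "C = {} \<or> hausdorff_outer n X = top")
  case True
  then show ?thesis by auto
next
  case False
  let ?H = "hausdorff_outer n :: 'a set \<Rightarrow> ennreal"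
  from False have ne: "C \<noteq> {}" and fin: "?H X \<noteq> top" by auto
  define E where "E k = {x\<in>X. 1 / Suc k \<le> infdist x C}" for k :: nat
  define D where "D k = {x\<in>X. 1 / Suc (Suc k) \<le> infdist x C \<and> infdist x C < 1 / Suc k}" for k :: nat
  have lip: "\<bar>infdist x C - infdist y C\<bar> \<le> dist x y" for x y
    by (meson infdist_triangle_abs)
  have sep: "1 / Suc (Suc k) - 1 / Suc (Suc (Suc k)) \<le> dist x y"
    if "x \<in> D k" "y \<in> D m" "k + 2 \<le> m" for x y k m
  proof -
    have "1 / real (Suc m) \<le> 1 / real (Suc (Suc (Suc k)))" using that by (intro divide_left_mono) auto
    then show ?thesis using that lip[of x y] by (auto simp: D_def)
  qed
  have gap: "0 < 1 / real (Suc (Suc k)) - 1 / real (Suc (Suc (Suc k)))" for k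
    by (simp add: frac_less2)
  have bnd: "(\<Sum>j<N. ?H (D (2 * j + p))) \<le> ?H (\<Union>j<N. D (2 * j + p))" for N p
  proof (induction N)
    case 0 then show ?case by simp
  next
    case (Suc N)
    note IH = Suc.IH
    show ?case
    proof (cases N)
      case 0 then show ?thesis by (simp add: lessThan_Suc)
    next
      case (Suc M)
      define r where "r = 1 / real (Suc (Suc (2 * M + p))) - 1 / real (Suc (Suc (Suc (2 * M + p))))"
      have r: "0 < r" unfolding r_def by (rule gap)
      have "r \<le> dist x y" if "x \<in> (\<Union>j<N. D (2 * j + p))" "y \<in> D (2 * N + p)" for x y
      proof -
        from that obtain j where j: "j < N" "x \<in> D (2 * j + p)" by auto
        have a: "1 / real (Suc (Suc (2 * M + p))) \<le> infdist x C"
        proof -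
          have "1 / real (Suc (Suc (2 * M + p))) \<le> 1 / real (Suc (Suc (2 * j + p)))"
            using j Suc by (intro divide_left_mono) auto
          then show ?thesis using j by (auto simp: D_def)
        qed
        have b: "infdist y C < 1 / real (Suc (Suc (Suc (2 * M + p))))"
          using that Suc by (auto simp: D_def)
        show ?thesis using lip[of x y] a b by (simp add: r_def)
      qed
      then have "?H (\<Union>j<N. D (2 * j + p)) + ?H (D (2 * N + p))
          \<le> ?H ((\<Union>j<N. D (2 * j + p)) \<union> D (2 * N + p))"
        by (rule hausdorff_outer_separated) (use r in auto)
      also have "(\<Union>j<N. D (2 * j + p)) \<union> D (2 * N + p) = (\<Union>j<Suc N. D (2 * j + p))"
        by (auto simp: lessThan_Suc)
      finally have "?H (\<Union>j<N. D (2 * j + p)) + ?H (D (2 * N + p)) \<le> ?H (\<Union>j<Suc N. D (2 * j + p))" .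
      with add_right_mono[OF IH] show ?thesis by (simp only: sum.lessThan_Suc) (rule order_trans)
    qed
  qed
  have half: "(\<Sum>j. ?H (D (2 * j + p))) \<le> ?H X" for p
  proof (intro suminf_le_const summableI)
    fix N show "(\<Sum>j<N. ?H (D (2 * j + p))) \<le> ?H X"
      by (rule order_trans[OF bnd hausdorff_outer_mono]) (auto simp: D_def)
  qed
  have tot: "(\<Sum>j. ?H (D j)) \<le> ?H X + ?H X"
  proof (intro suminf_le_const summableI)
    fix N
    have "(\<Sum>j<N. ?H (D j)) \<le> (\<Sum>j<2 * N. ?H (D j))" by (rule sum_mono2) auto
    also have "\<dots> = (\<Sum>j<N. ?H (D (2 * j + 0))) + (\<Sum>j<N. ?H (D (2 * j + 1)))"
      by (induction N) (simp_all add: algebra_simps)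
    also have "\<dots> \<le> (\<Sum>j. ?H (D (2 * j + 0))) + (\<Sum>j. ?H (D (2 * j + 1)))"
      by (intro add_mono sum_le_suminf) auto
    also have "\<dots> \<le> ?H X + ?H X" by (intro add_mono half)
    finally show "(\<Sum>j<N. ?H (D j)) \<le> ?H X + ?H X" .
  qed
  then have totfin: "(\<Sum>j. ?H (D j)) \<noteq> top" using fin by (auto simp: top_unique)
  have cover: "X - C \<subseteq> E k \<union> (\<Union>j. D (j + k))" for k
  proof
    fix x assume x: "x \<in> X - C"
    then have "0 < infdist x C" using C ne
      by (metis DiffD2 in_closed_iff_infdist_zero infdist_nonneg less_eq_real_def)
    then obtain m where m: "1 / real (Suc m) < infdist x C" using nat_approx_posE by blast
    define q where "q = (LEAST q. 1 / real (Suc q) \<le> infdist x C)"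
    have q: "1 / real (Suc q) \<le> infdist x C" unfolding q_def by (rule LeastI[of _ m]) (use m in simp)
    have q': "\<not> 1 / real (Suc i) \<le> infdist x C" if "i < q" for i
      using not_less_Least that unfolding q_def by blast
    show "x \<in> E k \<union> (\<Union>j. D (j + k))"
    proof (cases "q \<le> k")
      case True
      have "1 / real (Suc k) \<le> 1 / real (Suc q)" using True by (intro divide_left_mono) auto
      then show ?thesis using q x by (auto simp: E_def)
    next
      case False
      define i where "i = q - 1 - k"
      have i: "q = Suc (i + k)" using False by (simp add: i_def)
      have "x \<in> D (i + k)" using q q'[of "i + k"] x by (simp add: i D_def)
      then show ?thesis by blast
    qed
  qed
  have main: "?H (X \<inter> C) + ?H (X - C) \<le> ?H X + (\<Sum>j. ?H (D (j + k)))" for k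
  proof -
    have "?H (X \<inter> C) + ?H (X - C) \<le> ?H (X \<inter> C) + (?H (E k) + ?H (\<Union>j. D (j + k)))"
      by (intro add_left_mono) (rule order_trans[OF hausdorff_outer_mono[OF cover[of k]] hausdorff_outer_Un_le])
    also have "\<dots> \<le> (?H (X \<inter> C) + ?H (E k)) + (\<Sum>j. ?H (D (j + k)))"
      unfolding add.assoc by (intro add_left_mono hausdorff_outer_countable_subadditive)
    also have "?H (X \<inter> C) + ?H (E k) \<le> ?H ((X \<inter> C) \<union> E k)"
    proof (rule hausdorff_outer_separated[of _ _ "1 / real (Suc k)"])
      fix x y assume "x \<in> X \<inter> C" "y \<in> E k"
      then show "1 / real (Suc k) \<le> dist x y"
        using lip[of x y] infdist_zero[of x C] by (auto simp: E_def)
    qed simp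
    also have "?H ((X \<inter> C) \<union> E k) \<le> ?H X" by (rule hausdorff_outer_mono) (auto simp: E_def)
    finally show ?thesis by (simp add: add_right_mono)
  qed
  define a where "a = ?H (X \<inter> C) + ?H (X - C)"
  define S where "S = (\<Sum>j. ?H (D j))"
  have "a + (\<Sum>j<k. ?H (D j)) \<le> ?H X + S" for k
  proof -
    have "a + (\<Sum>j<k. ?H (D j)) \<le> (?H X + (\<Sum>j. ?H (D (j + k)))) + (\<Sum>j<k. ?H (D j))"
      unfolding a_def by (intro add_right_mono main)
    also have "\<dots> = ?H X + S"
      unfolding S_def by (subst (2) suminf_offset[of _ k]) (auto simp: ac_simps)
    finally show ?thesis .
  qed
  moreover have "(\<lambda>k. a + (\<Sum>j<k. ?H (D j))) \<longlonglongrightarrow> a + S"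
    unfolding S_def by (intro tendsto_add tendsto_const summable_LIMSEQ) auto
  ultimately have "a + S \<le> ?H X + S"
    by (intro LIMSEQ_le_const2) auto
  then have "a \<le> ?H X"
    using totfin by (simp add: S_def add.commute[of _ "suminf _"] ennreal_add_left_cancel_le)
  then show ?thesis by (simp add: a_def)
qed

lemma measure_space_hausdorff:
  "measure_space UNIV (sets borel) (hausdorff_outer n :: 'a::metric_space set \<Rightarrow> ennreal)"
proof -
  interpret P: sigma_algebra "UNIV :: 'a set" "Pow UNIV" by (rule sigma_algebra_Pow)
  let ?L = "lambda_system UNIV (Pow UNIV) (hausdorff_outer n :: 'a set \<Rightarrow> ennreal)"
  have L: "measure_space UNIV ?L (hausdorff_outer n)"
    by (rule P.caratheodory_lemma[OF outer_measure_space_hausdorff])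
  then have sa: "sigma_algebra UNIV ?L" by (simp add: measure_space_def)
  have "C \<in> ?L" if "closed C" for C
    unfolding P.lambda_system_eq
  proof (safe)
    fix X :: "'a set"
    have "hausdorff_outer n ((X \<inter> C) \<union> (X - C))
        \<le> hausdorff_outer n (X \<inter> C) + hausdorff_outer n (X - C)"
      by (rule hausdorff_outer_Un_le)
    then show "hausdorff_outer n (X \<inter> C) + hausdorff_outer n (X - C) = hausdorff_outer n X"
      using hausdorff_outer_closed_split[OF that, of n X] by (simp add: Int_Diff_Un antisym)
  qed auto
  then have "sigma_sets UNIV {C :: 'a set. closed C} \<subseteq> ?L"
    by (intro sigma_algebra.sigma_sets_subset[OF sa]) auto
  then have "sets borel \<subseteq> ?L" by (simp add: borel_eq_closed)
  moreover have "sigma_algebra UNIV (sets (borel :: 'a measure))"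
    using sets.sigma_algebra_axioms[of "borel :: 'a measure"] by simp
  ultimately show ?thesis using measure_down[OF L] by blast
qed

lemma sets_hausdorff_measure [simp]: "sets (hausdorff_measure n :: 'a::metric_space measure) = sets borel"
  using sets.sigma_sets_eq[of "borel :: 'a measure"] by (simp add: hausdorff_measure_def)

lemma emeasure_hausdorff_measure:
  "X \<in> sets borel \<Longrightarrow> emeasure (hausdorff_measure n) X = hausdorff_outer n X"
  unfolding hausdorff_measure_def using measure_space_hausdorff[of n, where 'a = 'a]
  by (intro emeasure_measure_of_sigma) (auto simp: measure_space_def)

section \<open>The coefficients alpha\<close>

text \<open>A cube is a closed cube with sides parallel to the axes; it is represented by its
  center \<open>z\<close> and its side length \<open>l\<close>.\<close>

definition cube :: "real ^ 'd \<Rightarrow> real \<Rightarrow> (real ^ 'd) set" where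
  "cube z l = {x. \<forall>i. \<bar>x $ i - z $ i\<bar> \<le> l / 2}"

text \<open>The pairs (center, side length) of all cubes obtained by splitting the cube \<open>(z, l)\<close>
  dyadically; the inductive rule produces the \<open>2\<^sup>d\<close> halves of a cube already obtained.\<close>

inductive_set dyadic_cubes :: "real ^ 'd \<Rightarrow> real \<Rightarrow> ((real ^ 'd) \<times> real) set" for z l where
  "(z, l) \<in> dyadic_cubes z l"
| "(w, s) \<in> dyadic_cubes z l \<Longrightarrow> (\<And>i. \<bar>w' $ i - w $ i\<bar> = s / 4)
    \<Longrightarrow> (w', s / 2) \<in> dyadic_cubes z l"

definition msupport :: "'a::metric_space measure \<Rightarrow> 'a set" where
  "msupport M = {x. \<forall>r>0. 0 < emeasure M (ball x r)}"

definition lip_dist :: "'a::metric_space set \<Rightarrow> 'a measure \<Rightarrow> 'a measure \<Rightarrow> ennreal" where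
  "lip_dist B \<sigma> \<nu> =
     (SUP f \<in> {f. 1-lipschitz_on UNIV f \<and> closure {x. f x \<noteq> 0} \<subseteq> B}.
        ennreal \<bar>(\<integral>x. f x \<partial>\<sigma>) - (\<integral>x. f x \<partial>\<nu>)\<bar>)"

definition alpha :: "nat \<Rightarrow> (real ^ 'd) measure \<Rightarrow> real ^ 'd \<Rightarrow> real \<Rightarrow> ennreal" where
  "alpha n \<mu> z l =
     (if cube z l \<inter> msupport \<mu> = {} then 0
      else (INF (c, L) \<in> {(c :: real, L). 0 \<le> c \<and> affine L \<and> aff_dim L = int n}.
              lip_dist (cball z (3 * diameter (cube z l))) \<mu>
                (scale_measure (ennreal c) (hausdorff_on n L))) / ennreal (l ^ (n + 1)))"

section \<open>Lipschitz graphs\<close>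

text \<open>The decomposition \<open>\<real>\<^sup>d = \<real>\<^sup>n \<times> \<real>\<^sup>d\<^sup>-\<^sup>n\<close> is given by an injection \<open>e\<close> of the \<open>n\<close> indices
  into the \<open>d\<close> indices: the coordinates in the range of \<open>e\<close> form the factor \<open>\<real>\<^sup>n\<close>, the
  remaining ones the factor \<open>\<real>\<^sup>d\<^sup>-\<^sup>n\<close>. Since there is no type of dimension \<open>0\<close>, which
  is needed for \<open>n = d\<close>, the factor \<open>\<real>\<^sup>d\<^sup>-\<^sup>n\<close> is represented by the coordinate subspace
  \<open>vertical_space e\<close>.\<close>

definition vertical_space :: "('n \<Rightarrow> 'd) \<Rightarrow> (real ^ 'd) set" where
  "vertical_space e = {y. \<forall>i. y $ e i = 0}"

definition horizontal_part :: "('n \<Rightarrow> 'd) \<Rightarrow> real ^ 'd \<Rightarrow> real ^ 'n" where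
  "horizontal_part e z = (\<chi> i. z $ e i)"

definition vertical_part :: "('n \<Rightarrow> 'd) \<Rightarrow> real ^ 'd \<Rightarrow> real ^ 'd" where
  "vertical_part e z = (\<chi> j. if j \<in> range e then 0 else z $ j)"

definition graph_of :: "('n \<Rightarrow> 'd) \<Rightarrow> (real ^ 'n \<Rightarrow> real ^ 'd) \<Rightarrow> (real ^ 'd) set" where
  "graph_of e A = {z. vertical_part e z = A (horizontal_part e z)}"

text \<open>\<open>grad_bound A C\<close> expresses that the sup norm of the gradient of \<open>A\<close> is at most \<open>C\<close>, for the
  operator norm of the derivative. A Lipschitz map is differentiable almost everywhere
  by Rademacher's theorem.\<close>

definition grad_bound :: "('a::euclidean_space \<Rightarrow> 'b::real_normed_vector) \<Rightarrow> real \<Rightarrow> bool" where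
  "grad_bound A C \<longleftrightarrow>
     (AE x in lborel. A differentiable (at x) \<and> onorm (frechet_derivative A (at x)) \<le> C)"

text \<open>\<open>\<rho>\<close> times the restriction of \<open>n\<close>-dimensional Hausdorff measure to \<open>F\<close>; the values of \<open>\<rho>\<close>
  off \<open>F\<close> do not matter.\<close>

definition weighted_hausdorff :: "nat \<Rightarrow> 'a::metric_space set \<Rightarrow> ('a \<Rightarrow> real) \<Rightarrow> 'a measure" where
  "weighted_hausdorff n F \<rho> = density (hausdorff_measure n) (\<lambda>z. ennreal (\<rho> z) * indicator F z)"

end

theory Submission
  imports Defs
begin

text \<open>Everything is discretised on the grid of mesh \<open>\<delta> = l / 2 ^ K\<close>, where \<open>K\<close> is the number of
  generations considered: \<open>\<mu>\<close> is replaced by its masses on the vertical cylinders over the cells of the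
  grid of \<open>\<real>\<^sup>n\<close>, at the cost of an error \<open>O(2 ^ - k)\<close> in the coefficient of a cube of side
  \<open>\<delta> * 2 ^ k\<close>. Only the bound \<open>\<mu> (cylinder) \<le> D * \<delta> ^ n\<close> and the fact that \<open>n\<close>-planes give the same
  mass to all cylinders are needed, so neither the area formula nor densities enter.

  For a function \<open>f\<close> on \<open>\<int>\<^sup>n\<close> the parallelogram law, applied to the averages of \<open>f\<close> over \<open>2 ^ k\<close>
  consecutive points in a coordinate direction, gives a square function estimate for the Haar
  differences of \<open>f\<close>. Smoothing with the symmetrised averages \<open>tents\<close> writes \<open>f - tents k is f\<close> as a
  sum over the scales \<open>2 ^ j < 2 ^ k\<close> of terms that contain two differences at scale \<open>2 ^ j\<close>. Moving one of
  them to a Lipschitz test function bounds the distance of the density to a constant, and applying the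
  expansion to \<open>A\<close> and the differences of \<open>A\<close> bounds the distance of \<open>A\<close> to an affine map; what remains,
  the smooth part, is handled by a discrete Poincare inequality. The coefficient of a cube of scale
  \<open>k\<close> is thus controlled by the Haar differences at all scales \<open>j \<le> k\<close>, damped by \<open>2 ^ (j - k)\<close>,
  and squares of these are summable over all cubes.\<close>

section \<open>Averages over lattice windows\<close>

text \<open>The infinite sum is a supremum of finite ones, and a finite family of cubes has a
  smallest side, which becomes the mesh; all constants must therefore be independent of
  \<open>K\<close>. The discretisation error is of order 1 for cubes at the mesh itself. It decays
  like 2^-k for side \<open>\<delta> * 2 ^ k\<close>, while all cubes of one side together have mass
  O(l^n), so its squares still sum to O(l^n). Haar differences are taken at every lattice point, not
  only at multiples of 2^k. The parallelogram law then needs no orthogonality, all operators commute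
  with translations, and windows may have arbitrary centers. The obstacle is the size of a test
  function: on a window of radius 2^k it may reach 2^k, which is too much for a term of scale 2^j.
  Its variation over a distance 2^j is only 2^j, and this gap is the damping; a second difference is
  needed because the first one has to stay with the density. Moreover constant and plane must be
  chosen before the test function, so the estimates are uniform over all \<open>h\<close> or are L1
  bounds on windows.\<close>

definition window :: "int ^ 'n \<Rightarrow> int \<Rightarrow> (int ^ 'n) set" where
  "window q r = {p. \<forall>i. \<bar>p $ i - q $ i\<bar> \<le> r}"

text \<open>The shifts form a list rather than a set because they count with multiplicity: only then
  is a composition of two averages again an average, over all sums of shifts.\<close>

definition average :: "(int ^ 'n) list \<Rightarrow> (int ^ 'n \<Rightarrow> 'b::real_vector) \<Rightarrow> int ^ 'n \<Rightarrow> 'b" where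
  "average ws f x = (\<Sum>w\<leftarrow>ws. f (x + w)) /\<^sub>R real (length ws)"

lemma window_eq_image:
  "window q r = vec_lambda ` (PiE UNIV (\<lambda>i. {q $ i - r..q $ i + r}))"
proof -
  have "p \<in> vec_lambda ` (PiE UNIV (\<lambda>i. {q $ i - r..q $ i + r}))" if "p \<in> window q r" for p
  proof
    show "p = vec_lambda (\<lambda>i. p $ i)" by simp
    have "q $ i - r \<le> p $ i \<and> p $ i \<le> q $ i + r" for i
    proof -
      have "\<bar>p $ i - q $ i\<bar> \<le> r" using that by (simp add: window_def)
      then show ?thesis by linarith
    qed
    then show "(\<lambda>i. p $ i) \<in> PiE UNIV (\<lambda>i. {q $ i - r..q $ i + r})" by auto
  qed
  moreover have "vec_lambda f \<in> window q r" if f: "f \<in> PiE UNIV (\<lambda>i. {q $ i - r..q $ i + r})" for f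
  proof -
    have "\<bar>f i - q $ i\<bar> \<le> r" for i
    proof -
      have "f i \<in> {q $ i - r..q $ i + r}" using f by auto
      then show ?thesis by (simp add: abs_le_iff)
    qed
    then show ?thesis by (simp add: window_def)
  qed
  ultimately show ?thesis by (intro equalityI subsetI) (simp, elim imageE, simp)
qed

lemma finite_window [simp]: "finite (window q r)"
  unfolding window_eq_image by (intro finite_imageI finite_PiE) auto

lemma card_window:
  assumes "0 \<le> r"
  shows "card (window (q :: int ^ 'n) r) = nat (2 * r + 1) ^ CARD('n)"
proof -
  have "inj_on vec_lambda (PiE UNIV (\<lambda>i. {q $ i - r..q $ i + r}))"
    by (auto simp: inj_on_def vec_lambda_inject)
  then have "card (window q r) = (\<Prod>i::'n\<in>UNIV. nat (2 * r + 1))"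
    unfolding window_eq_image by (simp add: card_image card_PiE algebra_simps)
  then show ?thesis by simp
qed

lemma real_card_window:
  assumes "0 \<le> r"
  shows "real (card (window (q :: int ^ 'n) r)) = (2 * real_of_int r + 1) ^ CARD('n)"
  unfolding card_window[OF assms] using assms by (simp add: of_nat_nat)

lemma card_window_scale_le:
  assumes "1 \<le> N"
  shows "real (card (window (q :: int ^ 'n) (int N * 2 ^ k))) \<le> (3 * real N) ^ CARD('n) * 2 ^ (k * CARD('n))"
proof -
  have "1 * 1 \<le> real N * 2 ^ k" using assms by (intro mult_mono) auto
  then have "(2 * (real N * 2 ^ k) + 1) ^ CARD('n) \<le> (3 * (real N * 2 ^ k)) ^ CARD('n)"
    by (intro power_mono) auto
  moreover have "real (card (window q (int N * 2 ^ k))) = (2 * (real N * 2 ^ k) + 1) ^ CARD('n)"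
    by (subst real_card_window) auto
  ultimately have "real (card (window q (int N * 2 ^ k))) \<le> (3 * (real N * 2 ^ k)) ^ CARD('n)" by simp
  then show ?thesis by (simp add: power_mult_distrib power_mult mult.assoc)
qed

lemma window_nonempty: "0 \<le> r \<Longrightarrow> q \<in> window q r"
  by (simp add: window_def)

lemma window_mono: "r \<le> s \<Longrightarrow> window q r \<subseteq> window q s"
  unfolding window_def by (safe, erule allE, erule order_trans)

lemma window_add:
  assumes "x \<in> window q r" "w \<in> window 0 t"
  shows "x + w \<in> window q (r + t)"
  unfolding window_def mem_Collect_eq
proof
  fix i
  have "\<bar>x $ i - q $ i\<bar> \<le> r" "\<bar>w $ i\<bar> \<le> t" using assms by (auto simp: window_def)
  then show "\<bar>(x + w) $ i - q $ i\<bar> \<le> r + t" by simp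
qed

lemma window_minus: "w \<in> window 0 t \<Longrightarrow> - w \<in> window 0 t"
  by (simp add: window_def)

lemma axis_in_window: "\<bar>m\<bar> \<le> t \<Longrightarrow> axis i m \<in> window 0 t"
  by (auto simp: window_def axis_def)

lemma axis_plus: "axis i ((a :: int) + b) = axis i a + axis i b"
  by (simp add: vec_eq_iff axis_def)

lemma axis_uminus: "axis i (- (a :: int)) = - axis i a"
  by (simp add: vec_eq_iff axis_def)

text \<open>Every translation of a nonnegative sum is paid for by a larger window. This is the
  source of all the growing radii below.\<close>

lemma sum_window_shift_le:
  fixes \<phi> :: "int ^ 'n \<Rightarrow> real"
  assumes "w \<in> window 0 t" "r + t \<le> s" "\<And>x. 0 \<le> \<phi> x"
  shows "(\<Sum>x\<in>window q r. \<phi> (x + w)) \<le> (\<Sum>x\<in>window q s. \<phi> x)"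
proof -
  have "(\<Sum>x\<in>window q r. \<phi> (x + w)) = (\<Sum>x\<in>(\<lambda>x. x + w) ` window q r. \<phi> x)"
    by (subst sum.reindex) (auto simp: inj_on_def)
  also have "\<dots> \<le> (\<Sum>x\<in>window q s. \<phi> x)"
  proof (rule sum_mono2[OF finite_window _ assms(3)])
    show "(\<lambda>x. x + w) ` window q r \<subseteq> window q s"
      using window_add[OF _ assms(1), of _ q r] window_mono[OF assms(2), of q] by blast
  qed
  finally show ?thesis .
qed

lemma sum_window_mono:
  fixes \<phi> :: "int ^ 'n \<Rightarrow> real"
  assumes "r \<le> s" "\<And>x. 0 \<le> \<phi> x"
  shows "(\<Sum>x\<in>window q r. \<phi> x) \<le> (\<Sum>x\<in>window q s. \<phi> x)"
  by (rule sum_mono2[OF finite_window window_mono[OF assms(1)] assms(2)])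

lemma norm_average_le: "norm (average ws f x) \<le> average ws (\<lambda>y. norm (f y)) x"
proof -
  have "norm (\<Sum>w\<leftarrow>ws. f (x + w)) \<le> (\<Sum>w\<leftarrow>ws. norm (f (x + w)))"
    by (induction ws) (auto intro: norm_triangle_le)
  then show ?thesis by (simp add: average_def mult_left_mono)
qed

lemma average_le_const:
  assumes "\<And>x. norm (f x) \<le> C" "ws \<noteq> []"
  shows "norm (average ws f x) \<le> C"
proof -
  have "(\<Sum>w\<leftarrow>ws. norm (f (x + w))) \<le> (\<Sum>w\<leftarrow>ws. C)"
    by (intro sum_list_mono) (auto simp: assms)
  then have "average ws (\<lambda>y. norm (f y)) x \<le> C"
    using assms(2) by (simp add: average_def sum_list_triv field_simps)
  then show ?thesis using norm_average_le order_trans by blast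
qed

lemma average_nonneg:
  assumes "\<And>x. 0 \<le> f x"
  shows "0 \<le> (average ws f x :: real)"
proof -
  have "0 \<le> (\<Sum>w\<leftarrow>ws. f (x + w))" by (rule sum_list_nonneg) (auto simp: assms)
  then show ?thesis by (simp add: average_def)
qed

lemma sum_window_average_le:
  fixes f :: "int ^ 'n \<Rightarrow> 'b::real_normed_vector"
  assumes "set ws \<subseteq> window 0 t" "ws \<noteq> []" "r + t \<le> s"
  shows "(\<Sum>x\<in>window q r. norm (average ws f x)) \<le> (\<Sum>x\<in>window q s. norm (f x))"
proof -
  let ?S = "\<Sum>x\<in>window q s. norm (f x)"
  have "(\<Sum>w\<leftarrow>ws. \<Sum>x\<in>window q r. norm (f (x + w))) \<le> (\<Sum>w\<leftarrow>ws. ?S)"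
    using assms by (intro sum_list_mono sum_window_shift_le[where t = t]) auto
  moreover have "(\<Sum>x\<in>window q r. \<Sum>w\<leftarrow>ws. norm (f (x + w))) = (\<Sum>w\<leftarrow>ws. \<Sum>x\<in>window q r. norm (f (x + w)))"
    by (induction ws) (auto simp: sum.distrib)
  ultimately have "(\<Sum>x\<in>window q r. average ws (\<lambda>y. norm (f y)) x) \<le> ?S"
    using assms(2) by (simp add: average_def sum_list_triv field_simps flip: sum_divide_distrib)
  moreover have "(\<Sum>x\<in>window q r. norm (average ws f x)) \<le> (\<Sum>x\<in>window q r. average ws (\<lambda>y. norm (f y)) x)"
    by (intro sum_mono norm_average_le)
  ultimately show ?thesis by linarith
qed

text \<open>Translations of the lattice commute, so both sides are the mean over all pairs of
  shifts.\<close>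

lemma average_commute: "average us (average ws f) = average ws (average us f)"
proof -
  have s: "(\<Sum>u\<leftarrow>us. \<Sum>w\<leftarrow>ws. g u w) = (\<Sum>w\<leftarrow>ws. \<Sum>u\<leftarrow>us. (g u w :: 'b))" for g
    by (induction us) (auto simp: sum_list_addf)
  have *: "average us (average ws f) x
      = (\<Sum>u\<leftarrow>us. \<Sum>w\<leftarrow>ws. f (x + u + w)) /\<^sub>R (real (length us) * real (length ws))" for us ws x
  proof -
    have "(\<Sum>u\<leftarrow>us. (\<Sum>w\<leftarrow>ws. f (x + u + w)) /\<^sub>R c) = (\<Sum>u\<leftarrow>us. (\<Sum>w\<leftarrow>ws. f (x + u + w))) /\<^sub>R c" for c
      by (induction us) (auto simp: scaleR_right_distrib)
    then show ?thesis by (simp add: average_def mult.commute)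
  qed
  have "average us (average ws f) x = average ws (average us f) x" for x
  proof -
    have c: "f (x + u + w) = f (x + w + u)" for u w by (simp add: add.assoc add.commute[of u])
    show ?thesis unfolding * by (subst s) (simp only: c mult.commute)
  qed
  then show ?thesis by blast
qed

lemma average_shift: "average ws (\<lambda>x. f (x + v)) = (\<lambda>x. average ws f (x + v))"
proof -
  have "f (x + w + v) = f (x + v + w)" for x w by (simp add: add.assoc add.commute[of w])
  then show ?thesis by (simp add: average_def fun_eq_iff)
qed

lemma average_diff: "average ws (\<lambda>x. f x - g x) = (\<lambda>x. average ws f x - average ws g x)"
proof -
  have "(\<Sum>w\<leftarrow>ws. f (x + w) - g (x + w)) = (\<Sum>w\<leftarrow>ws. f (x + w)) - (\<Sum>w\<leftarrow>ws. g (x + w))" for x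
    by (induction ws) auto
  then show ?thesis by (auto simp: average_def scaleR_right_diff_distrib)
qed

lemma average_scaleR: "average ws (\<lambda>x. c *\<^sub>R f x) = (\<lambda>x. c *\<^sub>R average ws f x)"
proof -
  have "(\<Sum>w\<leftarrow>ws. c *\<^sub>R f (x + w)) = c *\<^sub>R (\<Sum>w\<leftarrow>ws. f (x + w))" for x
    by (induction ws) (auto simp: scaleR_right_distrib)
  then show ?thesis by (auto simp: average_def scaleR_left_commute)
qed

section \<open>Haar differences and their square function\<close>

text \<open>A mean along one coordinate line, forward from the base point. Operators acting in all
  directions arise by composition.\<close>

definition box :: "'n \<Rightarrow> nat \<Rightarrow> (int ^ 'n \<Rightarrow> 'b::real_vector) \<Rightarrow> int ^ 'n \<Rightarrow> 'b" where
  "box i k = average (map (\<lambda>r. axis i (int r)) [0..<2 ^ k])"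

definition back_box :: "'n \<Rightarrow> nat \<Rightarrow> (int ^ 'n \<Rightarrow> 'b::real_vector) \<Rightarrow> int ^ 'n \<Rightarrow> 'b" where
  "back_box i k = average (map (\<lambda>r. axis i (- int r)) [0..<2 ^ k])"

text \<open>With the factor 1/2 the squares of half difference and half sum add up to the mean of
  the two squares, without loss.\<close>

definition half_diff :: "'n \<Rightarrow> nat \<Rightarrow> (int ^ 'n \<Rightarrow> 'b::real_vector) \<Rightarrow> int ^ 'n \<Rightarrow> 'b" where
  "half_diff i k f x = (f x - f (x + axis i (2 ^ k))) /\<^sub>R 2"

text \<open>The undecimated Haar coefficient: half the difference of the means over two adjacent
  blocks of length 2^k, for every base point.\<close>

definition haar :: "'n \<Rightarrow> nat \<Rightarrow> (int ^ 'n \<Rightarrow> 'b::real_vector) \<Rightarrow> int ^ 'n \<Rightarrow> 'b" where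
  "haar i k f = half_diff i k (box i k f)"

definition unit_diff :: "'n \<Rightarrow> (int ^ 'n \<Rightarrow> 'b::real_vector) \<Rightarrow> int ^ 'n \<Rightarrow> 'b" where
  "unit_diff i f x = f (x + axis i 1) - f x"

text \<open>A box convolved with its reflection, hence a triangular weight symmetric about 0. The
  symmetry is what turns increments in \<open>k\<close> into second differences.\<close>

definition tent :: "'n \<Rightarrow> nat \<Rightarrow> (int ^ 'n \<Rightarrow> 'b::real_vector) \<Rightarrow> int ^ 'n \<Rightarrow> 'b" where
  "tent i k f = back_box i k (box i k f)"

definition tents :: "nat \<Rightarrow> 'n list \<Rightarrow> (int ^ 'n \<Rightarrow> 'b::real_vector) \<Rightarrow> int ^ 'n \<Rightarrow> 'b" where
  "tents k is = foldr (\<lambda>i. tent i k) is"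

text \<open>Keeps only the range of the shifts. This suffices: the range tells how far a window has
  to grow, and operators of this kind commute with each other and with differences.\<close>

definition averaging :: "int \<Rightarrow> ((int ^ 'n \<Rightarrow> 'b::real_vector) \<Rightarrow> int ^ 'n \<Rightarrow> 'b) \<Rightarrow> bool" where
  "averaging t P \<longleftrightarrow> (\<exists>ws. ws \<noteq> [] \<and> set ws \<subseteq> window 0 t \<and> P = average ws)"

section \<open>Calculus of averaging operators\<close>

lemma averaging_mono: "averaging s P \<Longrightarrow> s \<le> t \<Longrightarrow> averaging t P"
  unfolding averaging_def using window_mono[of s t 0] by blast

lemma averaging_id: "averaging 0 (\<lambda>f. f)"
  unfolding averaging_def by (rule exI[of _ "[0]"]) (auto simp: average_def window_def fun_eq_iff)

lemma averaging_box: "averaging (2 ^ k) (box i k)"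
proof -
  have "set (map (\<lambda>r. axis i (int r)) [0..<2 ^ k]) \<subseteq> window 0 (2 ^ k)"
    by (auto intro!: axis_in_window simp: less_imp_le)
  then show ?thesis unfolding averaging_def box_def by (intro exI conjI refl) auto
qed

lemma averaging_back_box: "averaging (2 ^ k) (back_box i k)"
proof -
  have "set (map (\<lambda>r. axis i (- int r)) [0..<2 ^ k]) \<subseteq> window 0 (2 ^ k)"
    by (auto intro!: axis_in_window simp: less_imp_le)
  then show ?thesis unfolding averaging_def back_box_def by (intro exI conjI refl) auto
qed

lemma averaging_compose:
  assumes "averaging s P" "averaging t Q"
  shows "averaging (s + t) (\<lambda>f. P (Q f))"
proof -
  obtain us ws where us: "us \<noteq> []" "set us \<subseteq> window 0 s" "P = average us"
    and ws: "ws \<noteq> []" "set ws \<subseteq> window 0 t" "Q = average ws"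
    using assms unfolding averaging_def by blast
  let ?vs = "concat (map (\<lambda>u. map (\<lambda>w. u + w) ws) us)"
  have len: "length ?vs = length us * length ws"
    by (simp add: length_concat comp_def sum_list_triv)
  have "P (Q f) x = average ?vs f x" for f x
  proof -
    have "(\<Sum>u\<leftarrow>us. (\<Sum>w\<leftarrow>ws. f (x + u + w)) /\<^sub>R c) = (\<Sum>u\<leftarrow>us. (\<Sum>w\<leftarrow>ws. f (x + u + w))) /\<^sub>R c" for c
      by (induction us) (auto simp: scaleR_right_distrib)
    moreover have "(\<Sum>v\<leftarrow>?vs. f (x + v)) = (\<Sum>u\<leftarrow>us. (\<Sum>w\<leftarrow>ws. f (x + u + w)))"
      by (induction us) (auto simp: comp_def add.assoc)
    ultimately show ?thesis
      unfolding us(3) ws(3) average_def len by (simp add: mult.commute)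
  qed
  moreover have "?vs \<noteq> []" using len us(1) ws(1) by (metis length_0_conv mult_eq_0_iff)
  moreover have "set ?vs \<subseteq> window 0 (s + t)"
    using us(2) ws(2) by (auto intro!: window_add)
  ultimately show ?thesis unfolding averaging_def by (intro exI[of _ ?vs]) auto
qed

lemma averaging_tent: "averaging (2 * 2 ^ k) (tent i k)"
  using averaging_compose[OF averaging_back_box[of k i] averaging_box[of k i]]
  by (simp add: tent_def[abs_def])

lemma averaging_tents: "averaging (2 * int (length is) * 2 ^ k) (tents k is)"
proof (induction "is")
  case Nil
  then show ?case using averaging_id by (simp add: tents_def id_def)
next
  case (Cons i "is")
  from averaging_compose[OF averaging_tent[of k i] this]
  show ?case by (simp add: tents_def algebra_simps)
qed

lemma averaging_commute: "averaging s P \<Longrightarrow> averaging t Q \<Longrightarrow> P (Q f) = Q (P f)"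
  unfolding averaging_def using average_commute by blast

lemma averaging_shift: "averaging t P \<Longrightarrow> P (\<lambda>x. f (x + v)) = (\<lambda>x. P f (x + v))"
  unfolding averaging_def using average_shift by blast

lemma averaging_diff: "averaging t P \<Longrightarrow> P (\<lambda>x. f x - g x) = (\<lambda>x. P f x - P g x)"
  unfolding averaging_def using average_diff by blast

lemma averaging_scaleR: "averaging t P \<Longrightarrow> P (\<lambda>x. c *\<^sub>R f x) = (\<lambda>x. c *\<^sub>R P f x)"
  unfolding averaging_def using average_scaleR by blast

lemma averaging_half_diff:
  assumes "averaging t P"
  shows "P (half_diff i k f) = half_diff i k (P f)"
  unfolding half_diff_def[abs_def] averaging_scaleR[OF assms] averaging_diff[OF assms]
    averaging_shift[OF assms, of f "axis i (2 ^ k)"] ..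

lemma averaging_unit_diff:
  assumes "averaging t P"
  shows "P (unit_diff i f) = unit_diff i (P f)"
  unfolding unit_diff_def[abs_def] averaging_diff[OF assms]
    averaging_shift[OF assms, of f "axis i 1"] ..

lemma averaging_haar:
  assumes "averaging t P"
  shows "P (haar i k f) = haar i k (P f)"
  unfolding haar_def averaging_half_diff[OF assms] averaging_commute[OF assms averaging_box] ..

lemma sum_window_averaging_le:
  fixes f :: "int ^ 'n \<Rightarrow> 'b::real_normed_vector"
  assumes "averaging t P" "r + t \<le> s"
  shows "(\<Sum>x\<in>window q r. norm (P f x)) \<le> (\<Sum>x\<in>window q s. norm (f x))"
  using assms sum_window_average_le unfolding averaging_def by blast

lemma averaging_le_const:
  fixes f :: "int ^ 'n \<Rightarrow> 'b::real_normed_vector"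
  assumes "averaging t P" "\<And>x. norm (f x) \<le> C"
  shows "norm (P f x) \<le> C"
  using assms average_le_const unfolding averaging_def by blast

lemma sum_lessThan_double:
  fixes m :: nat
  shows "(\<Sum>r<2 * m. f r) = (\<Sum>r<m. f r) + (\<Sum>r<m. f (m + r))"
proof -
  have "(\<Sum>r<m + n. f r) = (\<Sum>r<m. f r) + (\<Sum>r<n. f (m + r))" for n
    by (induction n) (auto simp: add.assoc)
  from this[of m] show ?thesis by (simp add: mult_2)
qed

lemma box_eq: "box i k f x = (\<Sum>r<2 ^ k. f (x + axis i (int r))) /\<^sub>R 2 ^ k"
  by (simp add: box_def average_def interv_sum_list_conv_sum_set_nat comp_def lessThan_atLeast0)

lemma back_box_eq: "back_box i k f x = (\<Sum>r<2 ^ k. f (x - axis i (int r))) /\<^sub>R 2 ^ k"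
  by (simp add: back_box_def average_def interv_sum_list_conv_sum_set_nat comp_def lessThan_atLeast0 axis_uminus)

lemma box_0 [simp]: "box i 0 f = f"
  by (rule ext) (simp add: box_eq axis_def flip: zero_vec_def)

lemma back_box_0 [simp]: "back_box i 0 f = f"
  by (rule ext) (simp add: back_box_eq axis_def flip: zero_vec_def)

lemma box_Suc: "box i (Suc k) f x = (box i k f x + box i k f (x + axis i (2 ^ k))) /\<^sub>R 2"
  unfolding box_eq power_Suc sum_lessThan_double
  by (simp add: axis_plus add.assoc scaleR_right_distrib)

lemma back_box_Suc: "back_box i (Suc k) f x = (back_box i k f x + back_box i k f (x - axis i (2 ^ k))) /\<^sub>R 2"
  unfolding back_box_eq power_Suc sum_lessThan_double
  by (simp add: axis_plus scaleR_right_distrib diff_diff_eq)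

lemma parallelogram_half:
  fixes a b :: "'b::real_inner"
  shows "(norm ((a + b) /\<^sub>R 2))\<^sup>2 + (norm ((a - b) /\<^sub>R 2))\<^sup>2 = ((norm a)\<^sup>2 + (norm b)\<^sup>2) / 2"
  by (simp add: power2_norm_eq_inner inner_simps inner_commute field_simps)

text \<open>One step of the parallelogram law splits the energy of \<open>box i K f\<close> at two
  points into the energy of the next box and that of the Haar difference. Iterating it removes the
  energy of one scale after the other from that of \<open>f\<close>; only the windows grow.\<close>

lemma haar_square_function:
  fixes f :: "int ^ 'n \<Rightarrow> 'b::real_inner"
  shows "(\<Sum>x\<in>window q r. (norm (box i K f x))\<^sup>2) + (\<Sum>k<K. \<Sum>x\<in>window q r. (norm (haar i k f x))\<^sup>2)
      \<le> (\<Sum>x\<in>window q (r + 2 ^ K). (norm (f x))\<^sup>2)"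
proof (induction K arbitrary: r)
  case 0
  show ?case by (simp add: sum_window_mono)
next
  case (Suc K)
  define b where "b = box i K f"
  define w where "w = axis i (2 ^ K :: int)"
  have w: "w \<in> window 0 (2 ^ K)" unfolding w_def by (rule axis_in_window) simp
  have "(\<Sum>x\<in>window q r. (norm (box i (Suc K) f x))\<^sup>2) + (\<Sum>x\<in>window q r. (norm (haar i K f x))\<^sup>2)
      = ((\<Sum>x\<in>window q r. (norm (b x))\<^sup>2) + (\<Sum>x\<in>window q r. (norm (b (x + w)))\<^sup>2)) / 2"
    unfolding box_Suc haar_def half_diff_def b_def w_def
    by (simp only: parallelogram_half sum.distrib[symmetric] sum_divide_distrib)
  also have "\<dots> \<le> (\<Sum>x\<in>window q (r + 2 ^ K). (norm (b x))\<^sup>2)"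
    using sum_window_mono[of r "r + 2 ^ K" "\<lambda>x. (norm (b x))\<^sup>2" q]
      sum_window_shift_le[OF w order_refl, of "\<lambda>x. (norm (b x))\<^sup>2" q r] by simp
  finally have 1: "(\<Sum>x\<in>window q r. (norm (box i (Suc K) f x))\<^sup>2) + (\<Sum>x\<in>window q r. (norm (haar i K f x))\<^sup>2)
      \<le> (\<Sum>x\<in>window q (r + 2 ^ K). (norm (b x))\<^sup>2)" .
  have 2: "(\<Sum>k<K. \<Sum>x\<in>window q r. (norm (haar i k f x))\<^sup>2)
      \<le> (\<Sum>k<K. \<Sum>x\<in>window q (r + 2 ^ K). (norm (haar i k f x))\<^sup>2)"
    by (intro sum_mono sum_window_mono) auto
  \<comment> \<open>The hypothesis is taken at radius r + 2^K, so that the two enlargements by 2^K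
    give 2^(K+1).\<close>
  show ?case using 1 2 Suc.IH[of "r + 2 ^ K"] by (simp add: b_def algebra_simps)
qed

lemma sum_telescope_axis:
  "f (x + axis i (int m)) - f x = (\<Sum>r<m. unit_diff i f (x + axis i (int r)))"
proof (induction m)
  case 0
  show ?case by (simp add: axis_def flip: zero_vec_def)
next
  case (Suc m)
  have "x + axis i (int (Suc m)) = x + axis i (int m) + axis i 1"
    by (simp add: add.commute[of 1] axis_plus add.assoc)
  then show ?case unfolding sum.lessThan_Suc Suc.IH[symmetric] by (simp add: unit_diff_def add.assoc)
qed

lemma diff_axis_eq_box: "f (x + axis i (2 ^ k)) - f x = 2 ^ k *\<^sub>R box i k (unit_diff i f) x"
  using sum_telescope_axis[of f x i "2 ^ k"] by (simp add: box_eq)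

text \<open>Trades a difference at scale 2^k for a factor of order 2^k and a mean of unit
  differences. This is how estimates for \<open>A\<close> are expressed by its slopes.\<close>

lemma half_diff_eq_box: "half_diff i k f x = - (2 ^ k / 2) *\<^sub>R box i k (unit_diff i f) x"
  unfolding half_diff_def
proof -
  have "(f x - f (x + axis i (2 ^ k))) /\<^sub>R 2 = - ((f (x + axis i (2 ^ k)) - f x) /\<^sub>R 2)"
    by (simp flip: scaleR_minus_right)
  then show "(f x - f (x + axis i (2 ^ k))) /\<^sub>R 2 = - (2 ^ k / 2) *\<^sub>R box i k (unit_diff i f) x"
    unfolding diff_axis_eq_box by simp
qed

section \<open>Smoothing at dyadic scales\<close>

text \<open>With t = \<open>tent i j f\<close> and w the step 2^j, doubling the scale gives (t(x-w)
  + 2 t(x) + t(x+w)) / 4, so the increment is a second difference of t. One of its two factors is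
  absorbed into \<open>haar\<close>.\<close>

lemma tent_step:
  fixes f :: "int ^ 'n \<Rightarrow> 'b::real_vector"
  shows "tent i j f x - tent i (Suc j) f x
    = (back_box i j (haar i j f) x - back_box i j (haar i j f) (x - axis i (2 ^ j))) /\<^sub>R 2"
proof -
  define t where "t = tent i j f"
  define w where "w = axis i (2 ^ j :: int)"
  have P: "back_box i j (haar i j f) y = (t y - t (y + w)) /\<^sub>R 2" for y
    unfolding haar_def averaging_half_diff[OF averaging_back_box]
    by (simp add: half_diff_def t_def tent_def w_def)
  have b: "box i (Suc j) f = (\<lambda>x. (box i j f x - (- box i j f (x + w))) /\<^sub>R 2)"
    by (rule ext) (simp add: box_Suc w_def)
  have m: "back_box i j (\<lambda>x. - g x) = (\<lambda>x. - back_box i j g x)" for g :: "int ^ 'n \<Rightarrow> 'b"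
    using averaging_scaleR[OF averaging_back_box, where c = "-1" and f = g] by simp
  have "back_box i j (box i (Suc j) f) y = (t y + t (y + w)) /\<^sub>R 2" for y
    unfolding b averaging_scaleR[OF averaging_back_box] averaging_diff[OF averaging_back_box]
      m averaging_shift[OF averaging_back_box, where f = "box i j f" and v = w]
    by (simp add: t_def tent_def)
  then have "tent i (Suc j) f x = ((t x + t (x + w)) /\<^sub>R 2 + (t (x - w) + t x) /\<^sub>R 2) /\<^sub>R 2"
    by (simp add: tent_def back_box_Suc w_def)
  then show ?thesis
    unfolding P t_def[symmetric] w_def[symmetric]
    by (simp add: algebra_simps scaleR_left_distrib[symmetric])
qed

lemma tent_telescope:
  "f x - tent i k f x
    = (\<Sum>j<k. (back_box i j (haar i j f) x - back_box i j (haar i j f) (x - axis i (2 ^ j))) /\<^sub>R 2)"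
proof -
  have "(\<Sum>j<k. tent i j f x - tent i (Suc j) f x) = tent i 0 f x - tent i k f x"
    by (rule sum_lessThan_telescope')
  then show ?thesis unfolding tent_step by (simp add: tent_def)
qed

text \<open>Each increment carries two differences at scale \<open>2 ^ j\<close>. One is the Haar difference, which is
  controlled by the square function; the other one can be moved to a test function.\<close>

lemma tents_telescope:
  fixes "is" :: "'n::finite list"
  assumes "distinct is"
  shows "\<exists>Q :: 'n \<Rightarrow> nat \<Rightarrow> (int ^ 'n \<Rightarrow> 'b::real_vector) \<Rightarrow> int ^ 'n \<Rightarrow> 'b.
    (\<forall>i. \<forall>j\<le>k. averaging ((2 * int (length is) + 1) * 2 ^ k) (Q i j)) \<and>
    (\<forall>f x. f x - tents k is f x
      = (\<Sum>i\<in>set is. \<Sum>j<k. (Q i j (haar i j f) x - Q i j (haar i j f) (x - axis i (2 ^ j))) /\<^sub>R 2))"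
  using assms
proof (induction "is")
  case Nil
  show ?case
    by (intro exI[of _ "\<lambda>i j. (\<lambda>f. f)"])
      (auto simp: tents_def intro!: averaging_mono[OF averaging_id])
next
  case (Cons i "is")
  then obtain Q :: "'n \<Rightarrow> nat \<Rightarrow> (int ^ 'n \<Rightarrow> 'b) \<Rightarrow> int ^ 'n \<Rightarrow> 'b"
    where Q: "\<And>i j. j \<le> k \<Longrightarrow> averaging ((2 * int (length is) + 1) * 2 ^ k) (Q i j)"
    and eq: "\<And>f x. f x - tents k is f x
      = (\<Sum>i\<in>set is. \<Sum>j<k. (Q i j (haar i j f) x - Q i j (haar i j f) (x - axis i (2 ^ j))) /\<^sub>R 2)"
    by auto
  \<comment> \<open>The new direction is telescoped after the remaining ones have been smoothed at
    the final scale, so its operator contains \<open>tents k is\<close>. The old entries survive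
    because \<open>i\<close> does not occur in \<open>is\<close>.\<close>
  define Q' where "Q' = Q(i := \<lambda>j f. back_box i j (tents k is f))"
  have "averaging ((2 * int (length (i # is)) + 1) * 2 ^ k) (Q' i' j)" if "j \<le> k" for i' j
  proof (cases "i' = i")
    case True
    have "(2 :: int) ^ j \<le> 2 ^ k" using that by simp
    then have "2 ^ j + 2 * int (length is) * 2 ^ k \<le> (2 * int (length (i # is)) + 1) * 2 ^ k"
      using zero_le_power[of "2::int" k]
      by (simp only: length_Cons of_nat_Suc distrib_right distrib_left mult_1_left mult_1_right) linarith
    then show ?thesis
      using averaging_mono[OF averaging_compose[OF averaging_back_box averaging_tents]] True
      by (simp add: Q'_def)
  next
    case False
    have "(2 * int (length is) + 1) * 2 ^ k \<le> (2 * int (length (i # is)) + 1) * 2 ^ k" by simp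
    then show ?thesis using averaging_mono[OF Q[OF that]] False by (simp add: Q'_def)
  qed
  moreover have "f x - tents k (i # is) f x
      = (\<Sum>i\<in>set (i # is). \<Sum>j<k. (Q' i j (haar i j f) x - Q' i j (haar i j f) (x - axis i (2 ^ j))) /\<^sub>R 2)" for f x
  proof -
    define g where "g = tents k is f"
    have "f x - tents k (i # is) f x = (f x - g x) + (g x - tent i k g x)"
      by (simp add: tents_def g_def)
    also have "g x - tent i k g x = (\<Sum>j<k. (Q' i j (haar i j f) x - Q' i j (haar i j f) (x - axis i (2 ^ j))) /\<^sub>R 2)"
      unfolding tent_telescope by (simp add: Q'_def g_def averaging_haar[OF averaging_tents])
    also have "f x - g x = (\<Sum>i\<in>set is. \<Sum>j<k. (Q' i j (haar i j f) x - Q' i j (haar i j f) (x - axis i (2 ^ j))) /\<^sub>R 2)"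
      unfolding g_def eq using Cons.prems by (intro sum.cong refl) (auto simp: Q'_def)
    finally show ?thesis using Cons.prems by (simp add: add.commute)
  qed
  ultimately show ?case by blast
qed

text \<open>Tents in different directions commute, so the one in a prescribed direction can be made
  the innermost factor.\<close>

lemma tents_factor:
  fixes "is" :: "'n::finite list"
  assumes "i \<in> set is"
  shows "\<exists>P :: (int ^ 'n \<Rightarrow> 'b::real_vector) \<Rightarrow> int ^ 'n \<Rightarrow> 'b. averaging (2 * int (length is) * 2 ^ k) P \<and> (\<forall>f. tents k is f = P (tent i k f))"
  using assms
proof (induction "is")
  case (Cons i' "is")
  show ?case
  proof (cases "i \<in> set is")
    case True
    then obtain P :: "(int ^ 'n \<Rightarrow> 'b) \<Rightarrow> int ^ 'n \<Rightarrow> 'b"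
      where P: "averaging (2 * int (length is) * 2 ^ k) P" "\<And>f. tents k is f = P (tent i k f)"
      using Cons.IH by blast
    have "averaging (2 * 2 ^ k + 2 * int (length is) * 2 ^ k) (\<lambda>f. tent i' k (P f))"
      by (rule averaging_compose[OF averaging_tent P(1)])
    then show ?thesis
      using P(2) by (intro exI[of _ "\<lambda>f. tent i' k (P f)"]) (simp add: tents_def algebra_simps)
  next
    case False
    then have "i = i'" using Cons.prems by simp
    have "averaging (2 * int (length (i' # is)) * 2 ^ k) (tents k is)"
      by (rule averaging_mono[OF averaging_tents]) simp
    moreover have "tents k (i' # is) f = tents k is (tent i k f)" for f
      using averaging_commute[OF averaging_tent averaging_tents] \<open>i = i'\<close>
      by (simp add: tents_def)
    ultimately show ?thesis by blast
  qed
qed simp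

text \<open>The difference of two neighbouring means over 2^k points telescopes to its two end
  terms.\<close>

lemma unit_diff_back_box:
  "2 ^ k *\<^sub>R unit_diff i (back_box i k f) x = - 2 *\<^sub>R half_diff i k f (x + axis i 1 - axis i (2 ^ k))"
proof -
  have "(\<Sum>r<m. f (x + axis i 1 - axis i (int r)) - f (x - axis i (int r)))
      = f (x + axis i 1) - f (x + axis i 1 - axis i (int m))" for m
  proof (induction m)
    case 0
    show ?case by (simp add: axis_def flip: zero_vec_def)
  next
    case (Suc m)
    have "x + axis i 1 - axis i (int (Suc m)) = x - axis i (int m)"
      by (simp add: axis_plus)
    then show ?case unfolding sum.lessThan_Suc Suc.IH by (simp only:) simp
  qed
  from this[of "2 ^ k"] show ?thesis
    by (simp add: unit_diff_def back_box_eq half_diff_def scaleR_right_diff_distrib sum_subtractf)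
qed

text \<open>The unit difference falls on the \<open>back_box\<close> of the tent in direction
  \<open>i\<close> and becomes a difference at scale 2^k. Together with the remaining
  \<open>box\<close> this is a Haar difference, so the slopes of the smoothed function are Haar
  coefficients divided by 2^k.\<close>

lemma sum_window_unit_diff_tents:
  fixes f :: "int ^ 'n \<Rightarrow> 'b::real_normed_vector"
  assumes "i \<in> set is" "r + (2 * int (length is) + 2) * 2 ^ k \<le> s"
  shows "2 ^ k * (\<Sum>x\<in>window q r. norm (unit_diff i (tents k is f) x))
    \<le> 2 * (\<Sum>x\<in>window q s. norm (haar i k f x))"
proof -
  obtain P :: "(int ^ 'n \<Rightarrow> 'b) \<Rightarrow> int ^ 'n \<Rightarrow> 'b"
    where P: "averaging (2 * int (length is) * 2 ^ k) P" "\<And>f. tents k is f = P (tent i k f)"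
    using tents_factor[OF assms(1)] by blast
  define v where "v = axis i 1 - axis i (2 ^ k :: int)"
  have v: "v \<in> window 0 (2 * 2 ^ k)"
  proof -
    have "axis i 1 \<in> window 0 (2 ^ k)" "- axis i (2 ^ k) \<in> window 0 (2 ^ k)"
      by (auto intro!: axis_in_window window_minus)
    then have "axis i 1 + - axis i (2 ^ k) \<in> window 0 (2 ^ k + 2 ^ k)" by (rule window_add)
    then show ?thesis by (simp add: v_def)
  qed
  have "2 ^ k *\<^sub>R unit_diff i (tents k is f) x = - 2 *\<^sub>R P (haar i k f) (x + v)" for x
  proof -
    have "(\<lambda>x. 2 ^ k *\<^sub>R unit_diff i (tent i k f) x) = (\<lambda>x. (- 2) *\<^sub>R haar i k f (x + v))"
      by (simp add: tent_def unit_diff_back_box haar_def v_def add_diff_eq)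
    from arg_cong[OF this, of P] show ?thesis
      unfolding averaging_scaleR[OF P(1)] averaging_shift[OF P(1), of "haar i k f" v] P(2)
        averaging_unit_diff[OF P(1)] by (rule fun_cong)
  qed
  then have "2 ^ k * norm (unit_diff i (tents k is f) x) = 2 * norm (P (haar i k f) (x + v))" for x
    by (metis abs_minus_cancel abs_numeral abs_power2 norm_scaleR power_abs)
  then have "2 ^ k * (\<Sum>x\<in>window q r. norm (unit_diff i (tents k is f) x))
      = 2 * (\<Sum>x\<in>window q r. norm (P (haar i k f) (x + v)))"
    by (simp add: sum_distrib_left)
  also have "(\<Sum>x\<in>window q r. norm (P (haar i k f) (x + v)))
      \<le> (\<Sum>x\<in>window q (r + 2 * 2 ^ k). norm (P (haar i k f) x))"
    by (rule sum_window_shift_le[OF v order_refl]) simp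
  also have "\<dots> \<le> (\<Sum>x\<in>window q s. norm (haar i k f x))"
    using assms(2) by (intro sum_window_averaging_le[OF P(1)]) (simp add: algebra_simps)
  finally show ?thesis by simp
qed

lemma abs_shift_diff_le:
  fixes h :: "int ^ 'n \<Rightarrow> real"
  assumes "\<And>x. \<bar>h (x + axis i 1) - h x\<bar> \<le> \<kappa>"
  shows "\<bar>h (x + axis i (int m)) - h x\<bar> \<le> real m * \<kappa>"
proof -
  have "\<bar>\<Sum>r<m. unit_diff i h (x + axis i (int r))\<bar> \<le> (\<Sum>r<m. \<kappa>)"
    by (rule order_trans[OF sum_abs sum_mono]) (simp add: unit_diff_def assms)
  then show ?thesis by (simp add: sum_telescope_axis)
qed

text \<open>Summation by parts: the outer difference of each increment moves to \<open>h\<close>,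
  whose variation over 2^j steps is at most \<kappa> 2^j. The Haar difference stays with
  \<open>g\<close> and is bounded in L1.\<close>

lemma tents_pairing:
  fixes g h :: "int ^ 'n \<Rightarrow> real"
  assumes supp: "\<And>x. x \<notin> window q r \<Longrightarrow> h x = 0"
    and lip: "\<And>i x. \<bar>h (x + axis i 1) - h x\<bar> \<le> \<kappa>"
    and "distinct is" and s: "r + (2 * int (length is) + 2) * 2 ^ k \<le> s"
  shows "\<bar>\<Sum>x\<in>window q r. h x * (g x - tents k is g x)\<bar>
    \<le> \<kappa> * (\<Sum>i\<in>set is. \<Sum>j<k. 2 ^ j * (\<Sum>x\<in>window q s. \<bar>haar i j g x\<bar>))"
proof -
  obtain Q where Q: "\<And>i j. j \<le> k \<Longrightarrow> averaging ((2 * int (length is) + 1) * 2 ^ k) (Q i j)"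
    and eq: "\<And>f :: int ^ 'n \<Rightarrow> real. \<And>x. f x - tents k is f x
      = (\<Sum>i\<in>set is. \<Sum>j<k. (Q i j (haar i j f) x - Q i j (haar i j f) (x - axis i (2 ^ j))) /\<^sub>R 2)"
    using tents_telescope[OF assms(3), where 'b = real] by blast
  have \<kappa>: "0 \<le> \<kappa>" using lip[of 0 undefined] by linarith
  have single: "\<bar>\<Sum>x\<in>window q r. h x * ((P x - P (x - axis i (2 ^ j))) / 2)\<bar>
      \<le> \<kappa> * 2 ^ j * (\<Sum>x\<in>window q s. \<bar>haar i j g x\<bar>)"
    if "j < k" and P: "P = Q i j (haar i j g)" for i j P
  proof -
    define w where "w = axis i (2 ^ j :: int)"
    have w: "w \<in> window 0 (2 ^ j)" unfolding w_def by (rule axis_in_window) simp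
    let ?V = "window q (r + 2 ^ j)"
    have sub: "window q r \<subseteq> ?V" by (rule window_mono) simp
    have 1: "(\<Sum>x\<in>window q r. h x * P x) = (\<Sum>x\<in>?V. h x * P x)"
      using sub by (intro sum.mono_neutral_left) (auto simp: supp)
    \<comment> \<open>The translated window does not match \<open>?V\<close>; points where
      \<open>h\<close> vanishes are dropped on both sides to make the substitution a
      bijection.\<close>
    have 2: "(\<Sum>x\<in>window q r. h x * P (x - w)) = (\<Sum>x\<in>?V. h (x + w) * P x)"
    proof (rule sum.reindex_bij_witness_not_neutral[where S' = "{x \<in> window q r. h x = 0}"
          and T' = "{x \<in> ?V. h (x + w) = 0}" and i = "\<lambda>x. x + w" and j = "\<lambda>x. x - w"])
      fix a assume "a \<in> window q r - {x \<in> window q r. h x = 0}"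
      then show "a - w \<in> ?V - {x \<in> ?V. h (x + w) = 0}"
        using window_add[OF _ window_minus[OF w], of a q r] by auto
    next
      fix b assume "b \<in> ?V - {x \<in> ?V. h (x + w) = 0}"
      then have "h (b + w) \<noteq> 0" by simp
      then show "b + w \<in> window q r - {x \<in> window q r. h x = 0}" using supp by blast
    qed auto
    have "(\<Sum>x\<in>window q r. h x * ((P x - P (x - w)) / 2)) = (\<Sum>x\<in>?V. (h x - h (x + w)) / 2 * P x)"
      using 1 2 by (simp add: right_diff_distrib left_diff_distrib diff_divide_distrib sum_subtractf
          flip: sum_divide_distrib)
    also have "\<bar>\<dots>\<bar> \<le> (\<Sum>x\<in>?V. (\<kappa> * 2 ^ j) * \<bar>P x\<bar>)"
    proof (rule order_trans[OF sum_abs sum_mono])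
      fix x
      have "\<bar>h (x + w) - h x\<bar> \<le> 2 ^ j * \<kappa>"
        using abs_shift_diff_le[of h i \<kappa> x "2 ^ j", OF lip] by (simp add: w_def)
      then have "\<bar>(h x - h (x + w)) / 2\<bar> \<le> \<kappa> * 2 ^ j"
        using \<kappa> by (simp add: abs_minus_commute mult.commute)
      then show "\<bar>(h x - h (x + w)) / 2 * P x\<bar> \<le> \<kappa> * 2 ^ j * \<bar>P x\<bar>"
        unfolding abs_mult by (rule mult_right_mono) simp
    qed
    also have "\<dots> = \<kappa> * 2 ^ j * (\<Sum>x\<in>?V. norm (P x))" by (simp add: sum_distrib_left)
    also have "\<dots> \<le> \<kappa> * 2 ^ j * (\<Sum>x\<in>window q s. norm (haar i j g x))"
    proof (intro mult_left_mono)
      have "(2::int) ^ j \<le> 2 ^ k" using \<open>j < k\<close> by simp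
      then have "r + 2 ^ j + (2 * int (length is) + 1) * 2 ^ k \<le> s"
        using s by (simp add: algebra_simps del: power_increasing_iff)
      then show "(\<Sum>x\<in>?V. norm (P x)) \<le> (\<Sum>x\<in>window q s. norm (haar i j g x))"
        unfolding P using \<open>j < k\<close> by (intro sum_window_averaging_le[OF Q]) auto
    qed (use \<kappa> in simp)
    finally show ?thesis by (simp add: w_def)
  qed
  have "(\<Sum>x\<in>window q r. h x * (g x - tents k is g x))
      = (\<Sum>i\<in>set is. \<Sum>j<k. \<Sum>x\<in>window q r. h x * ((Q i j (haar i j g) x - Q i j (haar i j g) (x - axis i (2 ^ j))) / 2))"
    unfolding eq sum_distrib_left
    by (subst sum.swap, rule sum.cong[OF refl], subst sum.swap, intro sum.cong refl) simp
  also have "\<bar>\<dots>\<bar> \<le> (\<Sum>i\<in>set is. \<Sum>j<k. \<kappa> * 2 ^ j * (\<Sum>x\<in>window q s. \<bar>haar i j g x\<bar>))"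
    by (intro order_trans[OF sum_abs sum_mono] single refl) auto
  also have "\<dots> = \<kappa> * (\<Sum>i\<in>set is. \<Sum>j<k. 2 ^ j * (\<Sum>x\<in>window q s. \<bar>haar i j g x\<bar>))"
    by (simp add: sum_distrib_left mult.assoc)
  finally show ?thesis .
qed

text \<open>There is no test function here to take the second difference. Instead one difference is
  traded for a factor 2^j and the slopes of \<open>A\<close>, and the other one turns these slopes
  into their Haar differences.\<close>

lemma tents_approx:
  fixes A :: "int ^ 'n \<Rightarrow> 'b::real_normed_vector"
  assumes "distinct is" and s: "r + (2 * int (length is) + 3) * 2 ^ k \<le> s"
  shows "(\<Sum>x\<in>window q r. norm (A x - tents k is A x))
    \<le> (\<Sum>i\<in>set is. \<Sum>j<k. 2 ^ j * (\<Sum>x\<in>window q s. norm (haar i j (unit_diff i A) x)))"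
proof -
  obtain Q where Q: "\<And>i j. j \<le> k \<Longrightarrow> averaging ((2 * int (length is) + 1) * 2 ^ k) (Q i j)"
    and eq: "\<And>f :: int ^ 'n \<Rightarrow> 'b. \<And>x. f x - tents k is f x
      = (\<Sum>i\<in>set is. \<Sum>j<k. (Q i j (haar i j f) x - Q i j (haar i j f) (x - axis i (2 ^ j))) /\<^sub>R 2)"
    using tents_telescope[OF assms(1), where 'b = 'b] by blast
  let ?T = "\<lambda>i j x. (Q i j (haar i j A) x - Q i j (haar i j A) (x - axis i (2 ^ j))) /\<^sub>R 2"
  have single: "(\<Sum>x\<in>window q r. norm (?T i j x))
      \<le> 2 ^ j * (\<Sum>x\<in>window q s. norm (haar i j (unit_diff i A) x))" if j: "j < k" for i j
  proof -
    define w where "w = axis i (2 ^ j :: int)"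
    define b where "b = unit_diff i A"
    have w: "- w \<in> window 0 (2 ^ j)" unfolding w_def by (intro window_minus axis_in_window) simp
    note av = Q[OF less_imp_le[OF j], of i]
    \<comment> \<open>This uses up the first difference: what remains is a mean of the slopes
      \<open>b\<close>. The outer difference by \<open>w\<close> will act on that mean in
      \<open>hy\<close>.\<close>
    have h: "haar i j A = (\<lambda>x. - (2 ^ j / 2) *\<^sub>R box i j (box i j b) x)"
      by (rule ext) (simp add: haar_def half_diff_eq_box b_def averaging_unit_diff[OF averaging_box])
    define y where "y = Q i j (box i j (box i j b))"
    have P: "Q i j (haar i j A) x = - (2 ^ j / 2) *\<^sub>R y x" for x
      unfolding h averaging_scaleR[OF av] y_def ..
    have hy: "half_diff i j y = Q i j (box i j (haar i j b))"
      unfolding y_def haar_def averaging_half_diff[OF averaging_box] averaging_half_diff[OF av] ..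
    have "(Q i j (haar i j A) x - Q i j (haar i j A) (x - w)) /\<^sub>R 2 = (2 ^ j / 2) *\<^sub>R half_diff i j y (x + - w)" for x
      unfolding P half_diff_def w_def[symmetric] by (simp add: algebra_simps)
    then have "norm ((Q i j (haar i j A) x - Q i j (haar i j A) (x - w)) /\<^sub>R 2)
        \<le> 2 ^ j * norm (Q i j (box i j (haar i j b)) (x + - w))" for x
      unfolding hy by simp
    then have "(\<Sum>x\<in>window q r. norm ((Q i j (haar i j A) x - Q i j (haar i j A) (x - w)) /\<^sub>R 2))
        \<le> 2 ^ j * (\<Sum>x\<in>window q r. norm (Q i j (box i j (haar i j b)) (x + - w)))"
      unfolding sum_distrib_left by (rule sum_mono)
    also have "(\<Sum>x\<in>window q r. norm (Q i j (box i j (haar i j b)) (x + - w)))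
        \<le> (\<Sum>x\<in>window q (r + 2 ^ j). norm (Q i j (box i j (haar i j b)) x))"
      by (rule sum_window_shift_le[OF w order_refl]) simp
    also have "\<dots> \<le> (\<Sum>x\<in>window q s. norm (haar i j b x))"
    proof (rule sum_window_averaging_le[OF averaging_compose[OF av averaging_box]])
      have "(2::int) ^ j \<le> 2 ^ k" using j by simp
      then show "r + 2 ^ j + ((2 * int (length is) + 1) * 2 ^ k + 2 ^ j) \<le> s"
        using s by (simp add: algebra_simps del: power_increasing_iff)
    qed
    finally show ?thesis by (simp add: w_def b_def)
  qed
  have "(\<Sum>x\<in>window q r. norm (A x - tents k is A x))
    \<le> (\<Sum>x\<in>window q r. \<Sum>i\<in>set is. \<Sum>j<k. norm (?T i j x))"
    unfolding eq by (intro sum_mono order_trans[OF norm_sum]) auto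
  also have "\<dots> = (\<Sum>i\<in>set is. \<Sum>j<k. \<Sum>x\<in>window q r. norm (?T i j x))"
    by (subst sum.swap, rule sum.cong[OF refl], subst sum.swap, rule refl)
  also have "\<dots> \<le> (\<Sum>i\<in>set is. \<Sum>j<k. 2 ^ j * (\<Sum>x\<in>window q s. norm (haar i j (unit_diff i A) x)))"
    by (intro sum_mono single) auto
  finally show ?thesis .
qed

section \<open>Discrete approximation by constants and affine maps\<close>

text \<open>A translation is a lattice path of as many unit steps as the l1 norm of
  \<open>w\<close>, and each step costs one sum of unit differences.\<close>

lemma sum_window_translate_le:
  fixes f :: "int ^ 'n \<Rightarrow> 'b::real_normed_vector"
  assumes "w \<in> window 0 t"
  shows "(\<Sum>x\<in>window q r. norm (f (x + w) - f x))
    \<le> real_of_int (\<Sum>i\<in>UNIV. \<bar>w $ i\<bar>) * (\<Sum>i\<in>UNIV. \<Sum>x\<in>window q (r + t). norm (unit_diff i f x))"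
  using assms
proof (induction "nat (\<Sum>i\<in>UNIV. \<bar>w $ i\<bar>)" arbitrary: w)
  case 0
  have "(\<Sum>i\<in>UNIV. \<bar>w $ i\<bar>) = 0"
    by (rule antisym) (use 0 in \<open>auto intro: sum_nonneg\<close>)
  then have "w = 0" by (simp add: vec_eq_iff sum_nonneg_eq_0_iff)
  then show ?case by simp
next
  case (Suc m)
  let ?S = "\<Sum>i\<in>UNIV. \<Sum>x\<in>window q (r + t). norm (unit_diff i f x)"
  have "(\<Sum>i\<in>UNIV. \<bar>w $ i\<bar>) \<noteq> 0" using Suc.hyps(2) by linarith
  then obtain i where i: "w $ i \<noteq> 0" by (metis abs_zero sum.neutral)
  \<comment> \<open>One step towards the origin in a nonzero coordinate: the l1 norm drops by 1 and
    the path stays inside the window of radius \<open>t\<close>.\<close>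
  define w' where "w' = w - axis i (sgn (w $ i))"
  have w'j: "\<bar>w' $ j\<bar> = \<bar>w $ j\<bar> - (if j = i then 1 else 0)" for j
    using i by (auto simp: w'_def axis_def sgn_if abs_if)
  have sum': "(\<Sum>j\<in>UNIV. \<bar>w' $ j\<bar>) = (\<Sum>j\<in>UNIV. \<bar>w $ j\<bar>) - 1"
    by (simp add: w'j sum_subtractf)
  have wt: "\<bar>w $ j\<bar> \<le> t" for j using Suc.prems by (simp add: window_def)
  have w': "w' \<in> window 0 t"
  proof -
    have "\<bar>w' $ j\<bar> \<le> t" for j
      unfolding w'j using wt[of j] by (cases "j = i") (simp_all only: if_True if_False refl)
    then show ?thesis by (simp add: window_def)
  qed
  have IH: "(\<Sum>x\<in>window q r. norm (f (x + w') - f x)) \<le> real_of_int (\<Sum>i\<in>UNIV. \<bar>w' $ i\<bar>) * ?S"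
    by (rule Suc.hyps(1)[OF _ w']) (use Suc.hyps(2) sum' in linarith)
  obtain u where u: "u \<in> window 0 t" "\<And>x. norm (f (x + w) - f (x + w')) = norm (unit_diff i f (x + u))"
  proof (cases "w $ i > 0")
    case True
    then have "w = w' + axis i 1" by (simp add: w'_def)
    then show ?thesis using that[OF w'] by (simp add: unit_diff_def add.assoc)
  next
    case False
    then have "w' = w + axis i 1" using i by (simp add: w'_def axis_uminus)
    then show ?thesis using that[OF Suc.prems] by (simp add: unit_diff_def add.assoc norm_minus_commute)
  qed
  have "(\<Sum>x\<in>window q r. norm (f (x + w) - f (x + w'))) \<le> (\<Sum>x\<in>window q (r + t). norm (unit_diff i f x))"
    unfolding u(2) by (rule sum_window_shift_le[OF u(1) order_refl]) simp
  also have "\<dots> \<le> ?S"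
    by (rule member_le_sum) (auto intro: sum_nonneg)
  finally have step: "(\<Sum>x\<in>window q r. norm (f (x + w) - f (x + w'))) \<le> ?S" .
  have "(\<Sum>x\<in>window q r. norm (f (x + w) - f x))
      \<le> (\<Sum>x\<in>window q r. norm (f (x + w) - f (x + w')) + norm (f (x + w') - f x))"
    by (rule sum_mono) (metis add.commute diff_add_cancel add_diff_eq norm_triangle_ineq)
  also have "\<dots> \<le> ?S + real_of_int (\<Sum>i\<in>UNIV. \<bar>w' $ i\<bar>) * ?S"
    unfolding sum.distrib using step IH by linarith
  also have "\<dots> = real_of_int (\<Sum>i\<in>UNIV. \<bar>w $ i\<bar>) * ?S" by (simp add: sum' left_diff_distrib)
  finally show ?case .
qed

definition window_mean :: "int ^ 'n \<Rightarrow> int \<Rightarrow> (int ^ 'n \<Rightarrow> 'b::real_vector) \<Rightarrow> 'b" where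
  "window_mean q r f = (\<Sum>x\<in>window q r. f x) /\<^sub>R real (card (window q r))"

lemma norm_window_mean_le:
  fixes f :: "int ^ 'n \<Rightarrow> 'b::real_normed_vector"
  assumes "0 \<le> r" "\<And>x. norm (f x) \<le> C"
  shows "norm (window_mean q r f) \<le> C"
proof -
  have c: "0 < card (window q r)" using window_nonempty[OF assms(1), of q] by (auto simp: card_gt_0_iff)
  have "norm (\<Sum>x\<in>window q r. f x) \<le> real (card (window q r)) * C"
    by (rule sum_norm_bound) (rule assms)
  then show ?thesis using c by (simp add: window_mean_def field_simps)
qed

lemma window_mean_nonneg: "(\<And>x. 0 \<le> f x) \<Longrightarrow> 0 \<le> (window_mean q r f :: real)"
  by (simp add: window_mean_def sum_nonneg)

text \<open>The deviation from the mean is at most the mean of f(x) - f(y) over y. Writing y = x + w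
  reduces it to translations with w in the window of radius 2r, which explains the window of radius
  3r on the right.\<close>

lemma discrete_poincare:
  fixes f :: "int ^ 'n \<Rightarrow> 'b::real_normed_vector"
  assumes r: "0 \<le> r"
  shows "(\<Sum>x\<in>window q r. norm (f x - window_mean q r f))
    \<le> 2 ^ CARD('n) * (2 * real_of_int r * real CARD('n)) * (\<Sum>i\<in>UNIV. \<Sum>x\<in>window q (3 * r). norm (unit_diff i f x))"
proof -
  let ?N = "real (card (window q r))" and ?S = "\<Sum>i\<in>UNIV. \<Sum>x\<in>window q (3 * r). norm (unit_diff i f x)"
  have N: "0 < ?N" using window_nonempty[OF r, of q] by (auto simp: card_gt_0_iff)
  then have N_inv: "inverse ?N * ?N = 1" by (intro left_inverse) linarith
  have S: "0 \<le> ?S" by (intro sum_nonneg) auto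
  have pt: "norm (f x - window_mean q r f) \<le> (\<Sum>w\<in>window 0 (2 * r). norm (f (x + w) - f x)) / ?N"
    if x: "x \<in> window q r" for x
  proof -
    have "f x - window_mean q r f = (\<Sum>y\<in>window q r. f x - f y) /\<^sub>R ?N"
      using N_inv by (simp add: window_mean_def sum_subtractf scaleR_right_diff_distrib sum_constant_scaleR)
    then have "norm (f x - window_mean q r f) \<le> (\<Sum>y\<in>window q r. norm (f x - f y)) / ?N"
      using N norm_sum[of "\<lambda>y. f x - f y" "window q r"] by (simp add: divide_inverse mult.commute mult_left_mono)
    also have "(\<Sum>y\<in>window q r. norm (f x - f y)) = (\<Sum>w\<in>(\<lambda>y. y - x) ` window q r. norm (f (x + w) - f x))"
      by (subst sum.reindex) (auto simp: inj_on_def norm_minus_commute)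
    also have "\<dots> \<le> (\<Sum>w\<in>window 0 (2 * r). norm (f (x + w) - f x))"
    proof (rule sum_mono2)
      show "(\<lambda>y. y - x) ` window q r \<subseteq> window 0 (2 * r)"
      proof
        fix w assume "w \<in> (\<lambda>y. y - x) ` window q r"
        then obtain y where y: "y \<in> window q r" "w = y - x" by blast
        have "\<bar>w $ i\<bar> \<le> 2 * r" for i
        proof -
          have "\<bar>y $ i - q $ i\<bar> \<le> r" "\<bar>x $ i - q $ i\<bar> \<le> r" using x y(1) by (auto simp: window_def)
          then show ?thesis by (simp add: y(2))
        qed
        then show "w \<in> window 0 (2 * r)" by (simp add: window_def)
      qed
    qed auto
    finally show ?thesis using N by (simp add: divide_right_mono)
  qed
  have "(\<Sum>x\<in>window q r. norm (f x - window_mean q r f))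
      \<le> (\<Sum>x\<in>window q r. (\<Sum>w\<in>window 0 (2 * r). norm (f (x + w) - f x)) / ?N)"
    by (rule sum_mono) (rule pt)
  also have "\<dots> = (\<Sum>w\<in>window 0 (2 * r). \<Sum>x\<in>window q r. norm (f (x + w) - f x)) / ?N"
    unfolding sum_divide_distrib[symmetric] by (subst sum.swap) (rule refl)
  also have "\<dots> \<le> (\<Sum>w\<in>(window 0 (2 * r) :: (int ^ 'n) set). (2 * real_of_int r * real CARD('n)) * ?S) / ?N"
  proof (intro divide_right_mono sum_mono)
    fix w :: "int ^ 'n" assume w: "w \<in> window 0 (2 * r)"
    have "(\<Sum>i\<in>UNIV. \<bar>w $ i\<bar>) \<le> (\<Sum>i::'n\<in>UNIV. 2 * r)"
      using w by (intro sum_mono) (simp add: window_def)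
    then have "(\<Sum>i\<in>UNIV. \<bar>w $ i\<bar>) \<le> 2 * r * int CARD('n)" by (simp add: mult.commute)
    then have "real_of_int (\<Sum>i\<in>UNIV. \<bar>w $ i\<bar>) \<le> real_of_int (2 * r * int CARD('n))"
      by (simp only: of_int_le_iff)
    then have "real_of_int (\<Sum>i\<in>UNIV. \<bar>w $ i\<bar>) * ?S \<le> (2 * real_of_int r * real CARD('n)) * ?S"
      using S by (intro mult_right_mono) auto
    moreover have "r + 2 * r = 3 * r" by simp
    ultimately show "(\<Sum>x\<in>window q r. norm (f (x + w) - f x)) \<le> (2 * real_of_int r * real CARD('n)) * ?S"
      using sum_window_translate_le[OF w, where f = f and q = q and r = r] by (simp only:)
  qed (use N in auto)
  also have "\<dots> = real (card (window 0 (2 * r) :: (int ^ 'n) set)) / ?N * ((2 * real_of_int r * real CARD('n)) * ?S)"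
    by simp
  also have "\<dots> \<le> 2 ^ CARD('n) * ((2 * real_of_int r * real CARD('n)) * ?S)"
  \<comment> \<open>The factor 2^n compares the numbers of admissible w and of y, by 4r + 1 \<le> 2
    (2r + 1).\<close>
  proof (rule mult_right_mono)
    have "real (card (window 0 (2 * r) :: (int ^ 'n) set)) = (2 * real_of_int (2 * r) + 1) ^ CARD('n)"
      using r by (intro real_card_window) simp
    also have "\<dots> \<le> (2 * (2 * real_of_int r + 1)) ^ CARD('n)" using r by (intro power_mono) auto
    also have "\<dots> = 2 ^ CARD('n) * ?N" by (simp only: power_mult_distrib real_card_window[OF r])
    finally show "real (card (window 0 (2 * r) :: (int ^ 'n) set)) / ?N \<le> 2 ^ CARD('n)"
      using N by (simp add: divide_le_eq)
  qed (use r S in auto)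
  finally show ?thesis by (simp add: mult.assoc)
qed

text \<open>The weight 2^j is the variation of a test function at scale 2^j. After division by
  2^(k(n+1)) this is a sum of mean Haar coefficients over a window of radius about 2^k, damped by
  2^(j-k).\<close>

definition haar_mass :: "nat \<Rightarrow> int ^ 'n \<Rightarrow> int \<Rightarrow> (int ^ 'n \<Rightarrow> 'b::real_normed_vector) \<Rightarrow> real" where
  "haar_mass k q s f = (\<Sum>i\<in>UNIV. \<Sum>j\<le>k. 2 ^ j * (\<Sum>x\<in>window q s. norm (haar i j f x)))"

lemma haar_mass_nonneg: "0 \<le> haar_mass k q s f"
  unfolding haar_mass_def by (intro sum_nonneg mult_nonneg_nonneg) auto

lemma haar_mass_ge_lower:
  "(\<Sum>i\<in>UNIV. \<Sum>j<k. 2 ^ j * (\<Sum>x\<in>window q s. norm (haar i j f x))) \<le> haar_mass k q s f"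
  unfolding haar_mass_def by (intro sum_mono sum_mono2) (auto intro!: sum_nonneg mult_nonneg_nonneg)

lemma haar_mass_ge_top:
  "(\<Sum>i\<in>UNIV. 2 ^ k * (\<Sum>x\<in>window q s. norm (haar i k f x))) \<le> haar_mass k q s f"
  unfolding haar_mass_def
  by (intro sum_mono member_le_sum[of k "{..k}" "\<lambda>j. 2 ^ j * (\<Sum>x\<in>window q s. norm (haar _ j f x))"])
    (auto intro!: sum_nonneg mult_nonneg_nonneg)

lemma obtain_directions:
  obtains "is" :: "'n::finite list" where "distinct is" "set is = UNIV" "length is = CARD('n)"
proof -
  obtain xs :: "'n list" where "set xs = UNIV" "distinct xs"
    using finite_distinct_list[of "UNIV :: 'n set"] by auto
  then show thesis using that[of xs] distinct_card[of xs] by simp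
qed

text \<open>Of the two powers of 2 on the left, one compensates the slopes of the smoothed function,
  which are Haar coefficients over 2^k, and the other produces the weight 2^k of the top scale in
  \<open>haar_mass\<close>. The factor \<open>r\<close> from the Poincare inequality will cancel one
  of them.\<close>

lemma poincare_tents:
  fixes f :: "int ^ 'n \<Rightarrow> 'b::real_normed_vector"
  assumes dirs: "set is = UNIV" and len: "length is = CARD('n)" and r: "0 \<le> r"
    and s: "3 * r + (2 * int CARD('n) + 2) * 2 ^ k \<le> s"
  shows "2 ^ k * (2 ^ k * (\<Sum>x\<in>window q r. norm (tents k is f x - window_mean q r (tents k is f))))
    \<le> 2 ^ CARD('n) * (4 * real_of_int r * real CARD('n)) * haar_mass k q s f"
proof -
  have "2 ^ k * (\<Sum>i\<in>UNIV. \<Sum>x\<in>window q (3 * r). norm (unit_diff i (tents k is f) x))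
      \<le> (\<Sum>i\<in>UNIV. 2 * (\<Sum>x\<in>window q s. norm (haar i k f x)))"
    unfolding sum_distrib_left[of _ _ UNIV]
    by (intro sum_mono sum_window_unit_diff_tents) (use dirs len s in auto)
  then have "2 ^ k * (2 ^ k * (\<Sum>i\<in>UNIV. \<Sum>x\<in>window q (3 * r). norm (unit_diff i (tents k is f) x)))
      \<le> 2 ^ k * (\<Sum>i\<in>UNIV. 2 * (\<Sum>x\<in>window q s. norm (haar i k f x)))"
    by (rule mult_left_mono) simp
  also have "\<dots> = 2 * (\<Sum>i\<in>UNIV. 2 ^ k * (\<Sum>x\<in>window q s. norm (haar i k f x)))"
    by (simp add: sum_distrib_left mult_ac)
  also have "\<dots> \<le> 2 * haar_mass k q s f" using haar_mass_ge_top[where f = f and k = k and q = q and s = s] by simp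
  finally have D: "2 ^ k * (2 ^ k * (\<Sum>i\<in>UNIV. \<Sum>x\<in>window q (3 * r). norm (unit_diff i (tents k is f) x)))
      \<le> 2 * haar_mass k q s f" .
  have "2 ^ k * (2 ^ k * (\<Sum>x\<in>window q r. norm (tents k is f x - window_mean q r (tents k is f))))
      \<le> 2 ^ k * (2 ^ k * (2 ^ CARD('n) * (2 * real_of_int r * real CARD('n)) *
          (\<Sum>i\<in>UNIV. \<Sum>x\<in>window q (3 * r). norm (unit_diff i (tents k is f) x))))"
    by (intro mult_left_mono discrete_poincare r) auto
  also have "\<dots> = (2 ^ CARD('n) * (2 * real_of_int r * real CARD('n))) *
      (2 ^ k * (2 ^ k * (\<Sum>i\<in>UNIV. \<Sum>x\<in>window q (3 * r). norm (unit_diff i (tents k is f) x))))"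
    by (simp only: mult_ac)
  also have "\<dots> \<le> (2 ^ CARD('n) * (2 * real_of_int r * real CARD('n))) * (2 * haar_mass k q s f)"
    by (rule mult_left_mono[OF D]) (use r in auto)
  finally show ?thesis by (simp add: mult_ac)
qed

text \<open>Splits g - c into g - T, handled by summation by parts, and T - c, handled by the sup
  norm of \<open>h\<close> and the Poincare inequality. The mean of T depends on neither
  \<open>h\<close> nor \<kappa>, so one constant serves all test functions, and it inherits the
  bounds of \<open>g\<close>.\<close>

lemma discrete_alpha:
  fixes g :: "int ^ 'n \<Rightarrow> real" and M :: nat
  assumes g: "\<And>x. 0 \<le> g x" "\<And>x. g x \<le> C"
    and r: "r = int M * 2 ^ k" and s: "(3 * int M + 2 * int CARD('n) + 3) * 2 ^ k \<le> s"
  shows "\<exists>c. 0 \<le> c \<and> c \<le> C \<and> (\<forall>h \<kappa>. (\<forall>x. x \<notin> window q r \<longrightarrow> h x = 0) \<longrightarrow>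
      (\<forall>i x. \<bar>h (x + axis i 1) - h x\<bar> \<le> \<kappa>) \<longrightarrow>
      \<bar>\<Sum>x\<in>window q r. h x * (g x - c)\<bar>
        \<le> \<kappa> * ((1 + real (2 * M + 1) * 2 ^ CARD('n) * (4 * M * CARD('n))) * haar_mass k q s g))"
proof -
  obtain "is" :: "'n list" where dirs: "distinct is" "set is = UNIV" "length is = CARD('n)"
    by (rule obtain_directions)
  define T where "T = tents k is g"
  define c where "c = window_mean q r T"
  have r0: "0 \<le> r" by (simp add: r)
  have Tn: "0 \<le> T x" for x
  proof -
    obtain ws where "(tents k is :: (int ^ 'n \<Rightarrow> real) \<Rightarrow> _) = average ws"
      using averaging_tents[of "is" k, where 'b = real] unfolding averaging_def by metis
    then show ?thesis unfolding T_def using average_nonneg[of g, OF g(1)] by simp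
  qed
  have "norm (g x) \<le> C" for x using g[of x] by simp
  then have TC: "norm (T x) \<le> C" for x unfolding T_def by (rule averaging_le_const[OF averaging_tents])
  have c: "0 \<le> c" "c \<le> C"
    using window_mean_nonneg[of T q r] norm_window_mean_le[OF r0, of T C q] Tn TC
    by (auto simp: c_def)
  have main: "\<bar>\<Sum>x\<in>window q r. h x * (g x - c)\<bar>
        \<le> \<kappa> * ((1 + real (2 * M + 1) * 2 ^ CARD('n) * (4 * M * CARD('n))) * haar_mass k q s g)"
    if supp: "\<And>x. x \<notin> window q r \<Longrightarrow> h x = 0"
      and lip: "\<And>i x. \<bar>h (x + axis i 1) - h x\<bar> \<le> \<kappa>" for h \<kappa>
  proof -
    have \<kappa>: "0 \<le> \<kappa>" using lip[of 0 undefined] by linarith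
    have hb: "\<bar>h x\<bar> \<le> real (2 * M + 1) * 2 ^ k * \<kappa>" for x
    proof (cases "x \<in> window q r")
      case True
      \<comment> \<open>This equals 2r + 2^k, so that many steps in one direction leave the window
        and reach a zero of \<open>h\<close>; the Lipschitz bound then controls the sup
        norm.\<close>
      define m where "m = (2 * M + 1) * 2 ^ k"
      have "x + axis (undefined::'n) (int m) \<notin> window q r"
      proof
        assume "x + axis (undefined::'n) (int m) \<in> window q r"
        then have 1: "\<bar>(x + axis (undefined::'n) (int m)) $ undefined - q $ undefined\<bar> \<le> r"
          unfolding window_def by blast
        have 2: "\<bar>x $ undefined - q $ undefined\<bar> \<le> r" using True unfolding window_def by blast
        have "int m = 2 * r + 2 ^ k" by (simp add: m_def r algebra_simps)
        moreover have "(0::int) < 2 ^ k" by simp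
        moreover have "(x + axis (undefined::'n) (int m)) $ undefined = x $ undefined + int m"
          by (simp add: axis_def)
        ultimately show False using 1 2 by linarith
      qed
      then have "\<bar>h x\<bar> \<le> real m * \<kappa>"
        using abs_shift_diff_le[of h undefined \<kappa> x m, OF lip] supp by fastforce
      then show ?thesis by (simp add: m_def algebra_simps)
    next
      case False
      then show ?thesis using \<kappa> supp by simp
    qed
    have "\<bar>\<Sum>x\<in>window q r. h x * (g x - T x)\<bar>
        \<le> \<kappa> * (\<Sum>i\<in>set is. \<Sum>j<k. 2 ^ j * (\<Sum>x\<in>window q s. \<bar>haar i j g x\<bar>))"
      unfolding T_def
    proof (rule tents_pairing[OF supp lip dirs(1)])
      have "0 \<le> (2::int) ^ k" by simp
      moreover have "0 \<le> int M * (2::int) ^ k" by simp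
      ultimately show "r + (2 * int (length is) + 2) * 2 ^ k \<le> s"
        using s unfolding dirs(3) r distrib_right mult.assoc by linarith
    qed
    also have "\<dots> \<le> \<kappa> * haar_mass k q s g"
      using mult_left_mono[OF haar_mass_ge_lower[where f = g and k = k and q = q and s = s] \<kappa>] by (simp add: dirs)
    finally have 1: "\<bar>\<Sum>x\<in>window q r. h x * (g x - T x)\<bar> \<le> \<kappa> * haar_mass k q s g" .
    have "\<bar>\<Sum>x\<in>window q r. h x * (T x - c)\<bar> \<le> (\<Sum>x\<in>window q r. (real (2 * M + 1) * 2 ^ k * \<kappa>) * \<bar>T x - c\<bar>)"
      by (rule order_trans[OF sum_abs sum_mono]) (simp only: abs_mult, rule mult_right_mono[OF hb abs_ge_zero])
    also have "\<dots> = real (2 * M + 1) * \<kappa> * (2 ^ k * (\<Sum>x\<in>window q r. norm (T x - c)))"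
      by (simp add: sum_distrib_left mult_ac)
    also have "\<dots> \<le> real (2 * M + 1) * \<kappa> * (2 ^ CARD('n) * (4 * M * real CARD('n)) * haar_mass k q s g)"
    proof (rule mult_left_mono)
      have "3 * r + (2 * int CARD('n) + 2) * 2 ^ k \<le> s"
        using s zero_le_power[of "2::int" k] unfolding r distrib_right mult.assoc by linarith
      from poincare_tents[OF dirs(2,3) r0 this]
      have "2 ^ k * (2 ^ k * (\<Sum>x\<in>window q r. norm (T x - c)))
          \<le> 2 ^ CARD('n) * (4 * real_of_int r * real CARD('n)) * haar_mass k q s g"
        unfolding T_def c_def .
      also have "\<dots> = 2 ^ k * (2 ^ CARD('n) * (4 * M * real CARD('n)) * haar_mass k q s g)"
        by (simp add: r)
      finally show "2 ^ k * (\<Sum>x\<in>window q r. norm (T x - c))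
          \<le> 2 ^ CARD('n) * (4 * M * real CARD('n)) * haar_mass k q s g" by simp
    qed (use \<kappa> in simp)
    finally have 2: "\<bar>\<Sum>x\<in>window q r. h x * (T x - c)\<bar>
        \<le> real (2 * M + 1) * \<kappa> * (2 ^ CARD('n) * (4 * M * real CARD('n)) * haar_mass k q s g)" .
    have "(\<Sum>x\<in>window q r. h x * (g x - c))
        = (\<Sum>x\<in>window q r. h x * (g x - T x)) + (\<Sum>x\<in>window q r. h x * (T x - c))"
      unfolding sum.distrib[symmetric] by (intro sum.cong refl) (simp add: algebra_simps)
    then have "\<bar>\<Sum>x\<in>window q r. h x * (g x - c)\<bar> \<le> \<kappa> * haar_mass k q s g
        + real (2 * M + 1) * \<kappa> * (2 ^ CARD('n) * (4 * M * real CARD('n)) * haar_mass k q s g)"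
      using 1 2 by linarith
    then show ?thesis by (simp add: algebra_simps)
  qed
  show ?thesis using c main by blast
qed

text \<open>The Poincare inequality is used twice on the smoothed function: applied to its unit
  differences it yields the slopes \<open>v\<close>, and applied after subtraction of the linear
  part it yields \<open>a\<close>. The slopes are means of unit differences of \<open>A\<close>, so
  they obey the same bound and the plane cannot become steep.\<close>

lemma discrete_beta:
  fixes A :: "int ^ 'n \<Rightarrow> 'b::real_normed_vector" and M :: nat
  assumes lip: "\<And>i x. norm (unit_diff i A x) \<le> C"
    and r: "r = int M * 2 ^ k" and s: "(9 * int M + 2 * int CARD('n) + 3) * 2 ^ k \<le> s"
  shows "\<exists>a v. (\<forall>i. norm (v i) \<le> C) \<and>
    (\<Sum>x\<in>window q r. norm (A x - (a + (\<Sum>i\<in>UNIV. of_int (x $ i) *\<^sub>R v i))))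
      \<le> (1 + 2 ^ CARD('n) * (2 * M * CARD('n)) * (2 ^ CARD('n) * (12 * M * CARD('n))))
          * (\<Sum>i\<in>UNIV. haar_mass k q s (unit_diff i A))"
proof -
  obtain "is" :: "'n list" where dirs: "distinct is" "set is = UNIV" "length is = CARD('n)"
    by (rule obtain_directions)
  define T where "T = tents k is A"
  define H where "H = (\<Sum>i\<in>UNIV. haar_mass k q s (unit_diff i A))"
  have r0: "0 \<le> r" by (simp add: r)
  \<comment> \<open>The mean is over the tripled window because the second Poincare inequality needs
    the deviation of the slopes there. Tripling once more accounts for the 9 in the radius.\<close>
  define v where "v i = window_mean q (3 * r) (unit_diff i T)" for i
  have uT: "unit_diff i T = tents k is (unit_diff i A)" for i
    unfolding T_def by (rule averaging_unit_diff[OF averaging_tents, symmetric])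
  have v: "norm (v i) \<le> C" for i
    unfolding v_def uT
    by (intro norm_window_mean_le averaging_le_const[OF averaging_tents] lip) (use r0 in auto)
  define F where "F x = T x - (\<Sum>i\<in>UNIV. of_int (x $ i) *\<^sub>R v i)" for x
  define a where "a = window_mean q r F"
  have uF: "unit_diff i F x = unit_diff i T x - v i" for i x
  proof -
    have "(\<Sum>j\<in>UNIV. of_int ((x + axis i 1) $ j) *\<^sub>R v j)
        = (\<Sum>j\<in>UNIV. of_int (x $ j) *\<^sub>R v j + (if j = i then v j else 0))"
      by (intro sum.cong refl) (simp add: axis_def scaleR_left_distrib)
    then show ?thesis by (simp add: unit_diff_def F_def sum.distrib)
  qed
  have "(\<Sum>x\<in>window q r. norm (A x - T x))
      \<le> (\<Sum>i\<in>set is. \<Sum>j<k. 2 ^ j * (\<Sum>x\<in>window q s. norm (haar i j (unit_diff i A) x)))"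
    unfolding T_def
  proof (rule tents_approx[OF dirs(1)])
    have "0 \<le> (2::int) ^ k" by simp
    moreover have "0 \<le> int M * (2::int) ^ k" by simp
    ultimately show "r + (2 * int (length is) + 3) * 2 ^ k \<le> s"
      using s unfolding dirs(3) r distrib_right mult.assoc by linarith
  qed
  also have "\<dots> \<le> (\<Sum>i\<in>UNIV. \<Sum>i'\<in>UNIV. \<Sum>j<k. 2 ^ j * (\<Sum>x\<in>window q s. norm (haar i' j (unit_diff i A) x)))"
    unfolding dirs(2)
    by (intro sum_mono member_le_sum[of _ UNIV "\<lambda>i'. \<Sum>j<k. 2 ^ j * (\<Sum>x\<in>window q s. norm (haar i' j (unit_diff _ A) x))"])
      (auto intro!: sum_nonneg mult_nonneg_nonneg)
  also have "\<dots> \<le> H" unfolding H_def by (intro sum_mono haar_mass_ge_lower)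
  finally have 1: "(\<Sum>x\<in>window q r. norm (A x - T x)) \<le> H" .
  define K where "K = 2 ^ CARD('n) * (2 * M * CARD('n))"
  define K' where "K' = 2 ^ CARD('n) * (12 * M * CARD('n))"
  have P: "2 ^ k * (\<Sum>x\<in>window q (3 * r). norm (unit_diff i T x - v i)) \<le> real K' * haar_mass k q s (unit_diff i A)" for i
  proof -
    have "0 \<le> 3 * r" using r0 by simp
    moreover have "3 * (3 * r) + (2 * int CARD('n) + 2) * 2 ^ k \<le> s"
      using s zero_le_power[of "2::int" k] unfolding r distrib_right mult.assoc by linarith
    ultimately have "2 ^ k * (2 ^ k * (\<Sum>x\<in>window q (3 * r). norm (unit_diff i T x - v i)))
        \<le> 2 ^ CARD('n) * (4 * real_of_int (3 * r) * real CARD('n)) * haar_mass k q s (unit_diff i A)"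
      unfolding v_def uT by (rule poincare_tents[OF dirs(2,3)])
    also have "\<dots> = 2 ^ k * (real K' * haar_mass k q s (unit_diff i A))"
      by (simp add: r K'_def)
    finally show ?thesis by simp
  qed
  have "(\<Sum>x\<in>window q r. norm (F x - a))
      \<le> 2 ^ CARD('n) * (2 * real_of_int r * real CARD('n)) * (\<Sum>i\<in>UNIV. \<Sum>x\<in>window q (3 * r). norm (unit_diff i F x))"
    unfolding a_def by (rule discrete_poincare[OF r0])
  also have "\<dots> = real K * (\<Sum>i\<in>UNIV. 2 ^ k * (\<Sum>x\<in>window q (3 * r). norm (unit_diff i T x - v i)))"
    unfolding uF by (simp add: r K_def sum_distrib_left mult_ac)
  also have "\<dots> \<le> real K * (\<Sum>i\<in>UNIV. real K' * haar_mass k q s (unit_diff i A))"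
    by (intro mult_left_mono sum_mono P) auto
  also have "\<dots> = real K * (real K' * H)" by (simp add: H_def sum_distrib_left)
  finally have 2: "(\<Sum>x\<in>window q r. norm (F x - a)) \<le> real K * (real K' * H)" .
  have "(\<Sum>x\<in>window q r. norm (A x - (a + (\<Sum>i\<in>UNIV. of_int (x $ i) *\<^sub>R v i))))
      \<le> (\<Sum>x\<in>window q r. norm (A x - T x) + norm (F x - a))"
  proof (rule sum_mono)
    fix x
    have "A x - (a + (\<Sum>i\<in>UNIV. of_int (x $ i) *\<^sub>R v i)) = (A x - T x) + (F x - a)"
      by (simp add: F_def algebra_simps)
    then show "norm (A x - (a + (\<Sum>i\<in>UNIV. of_int (x $ i) *\<^sub>R v i))) \<le> norm (A x - T x) + norm (F x - a)"
      using norm_triangle_ineq[of "A x - T x" "F x - a"] by (simp only:)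
  qed
  also have "\<dots> \<le> H + real K * (real K' * H)" unfolding sum.distrib using 1 2 by linarith
  also have "\<dots> = (1 + real K * real K') * H" by (simp add: algebra_simps)
  finally show ?thesis using v unfolding K_def K'_def H_def
    by (intro exI[of _ a] exI[of _ v]) (simp add: mult_ac)
qed

section \<open>Summation over scales\<close>

lemma weighted_cauchy_schwarz:
  fixes w y :: "'a \<Rightarrow> real"
  assumes "\<And>j. j \<in> I \<Longrightarrow> 0 \<le> w j"
  shows "(\<Sum>j\<in>I. w j * y j)\<^sup>2 \<le> (\<Sum>j\<in>I. w j) * (\<Sum>j\<in>I. w j * (y j)\<^sup>2)"
proof -
  have "(\<Sum>j\<in>I. sqrt (w j) * (sqrt (w j) * y j))\<^sup>2
      \<le> (\<Sum>j\<in>I. (sqrt (w j))\<^sup>2) * (\<Sum>j\<in>I. (sqrt (w j) * y j)\<^sup>2)"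
    by (rule Cauchy_Schwarz_ineq_sum)
  moreover have "(\<Sum>j\<in>I. sqrt (w j) * (sqrt (w j) * y j)) = (\<Sum>j\<in>I. w j * y j)"
    using assms by (intro sum.cong refl) (simp add: mult.assoc[symmetric])
  moreover have "(\<Sum>j\<in>I. (sqrt (w j))\<^sup>2) = (\<Sum>j\<in>I. w j)"
    using assms by (intro sum.cong refl) simp
  moreover have "(\<Sum>j\<in>I. (sqrt (w j) * y j)\<^sup>2) = (\<Sum>j\<in>I. w j * (y j)\<^sup>2)"
    using assms by (intro sum.cong refl) (simp add: power_mult_distrib)
  ultimately show ?thesis by simp
qed

lemma sum_power2_le: "(a + b)\<^sup>2 \<le> 2 * (a\<^sup>2 + b\<^sup>2)" for a b :: real
  using zero_le_power2[of "a - b"] by (simp add: power2_sum power2_diff)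

lemma sum_square_le_card:
  fixes y :: "'a \<Rightarrow> real"
  shows "(\<Sum>j\<in>I. y j)\<^sup>2 \<le> real (card I) * (\<Sum>j\<in>I. (y j)\<^sup>2)"
  using sum_squared_le_sum_of_squares[of y I] by (simp add: mult.commute)

text \<open>Two applications of Cauchy-Schwarz: over the scales with weights 2^j, of total at most 2
  * 2^k, and over the window, whose size is at most (3N)^n 2^(kn). One factor 2^j / 2^k survives and
  makes the sum over larger scales converge.\<close>

lemma scale_sum_square_le:
  fixes Y :: "nat \<Rightarrow> int ^ 'n \<Rightarrow> real"
  assumes N: "1 \<le> N"
  shows "((\<Sum>j\<le>k. 2 ^ j * (\<Sum>x\<in>window q (int N * 2 ^ k). Y j x)) / 2 ^ (k * (CARD('n) + 1)))\<^sup>2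
    \<le> 2 * (3 * real N) ^ CARD('n) / 2 ^ (k * CARD('n)) *
      (\<Sum>j\<le>k. 2 ^ j / 2 ^ k * (\<Sum>x\<in>window q (int N * 2 ^ k). (Y j x)\<^sup>2))"
proof -
  let ?W = "window q (int N * 2 ^ k)" and ?n = "CARD('n)"
  have card: "real (card ?W) \<le> (3 * real N) ^ ?n * 2 ^ (k * ?n)"
    by (rule card_window_scale_le[OF N])
  have geo: "(\<Sum>j\<le>k. (2::real) ^ j) \<le> 2 * 2 ^ k"
    using sum_gp[of "2::real" 0 k] by (simp add: atMost_atLeast0)
  let ?S = "\<Sum>j\<le>k. 2 ^ j * (\<Sum>x\<in>?W. (Y j x)\<^sup>2)"
  have S: "0 \<le> ?S" by (intro sum_nonneg mult_nonneg_nonneg) auto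
  have "(\<Sum>j\<le>k. 2 ^ j * (\<Sum>x\<in>?W. Y j x))\<^sup>2
      \<le> (\<Sum>j\<le>k. 2 ^ j) * (\<Sum>j\<le>k. 2 ^ j * (\<Sum>x\<in>?W. Y j x)\<^sup>2)"
    by (rule weighted_cauchy_schwarz) simp
  also have "\<dots> \<le> (2 * 2 ^ k) * (\<Sum>j\<le>k. 2 ^ j * (real (card ?W) * (\<Sum>x\<in>?W. (Y j x)\<^sup>2)))"
    by (intro mult_mono geo sum_mono sum_square_le_card sum_nonneg) auto
  also have "\<dots> = (2 * 2 ^ k) * (real (card ?W) * ?S)" by (simp add: sum_distrib_left mult_ac)
  also have "\<dots> \<le> (2 * 2 ^ k) * ((3 * real N) ^ ?n * 2 ^ (k * ?n) * ?S)"
    by (intro mult_left_mono mult_right_mono card S) auto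
  finally have "(\<Sum>j\<le>k. 2 ^ j * (\<Sum>x\<in>?W. Y j x))\<^sup>2 / (2 ^ (k * (?n + 1)))\<^sup>2
      \<le> (2 * 2 ^ k) * ((3 * real N) ^ ?n * 2 ^ (k * ?n) * ?S) / (2 ^ (k * (?n + 1)))\<^sup>2"
    by (rule divide_right_mono) simp
  also have "\<dots> = 2 * (3 * real N) ^ ?n / 2 ^ (k * ?n) * (?S / 2 ^ k)"
    by (simp add: power_add power2_eq_square field_simps)
  also have "?S / 2 ^ k = (\<Sum>j\<le>k. 2 ^ j / 2 ^ k * (\<Sum>x\<in>?W. (Y j x)\<^sup>2))"
    by (simp add: sum_divide_distrib)
  finally show ?thesis by (simp add: power_divide)
qed

lemma sum_scales_le:
  fixes S :: "nat \<Rightarrow> real"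
  assumes "\<And>j. 0 \<le> S j"
  shows "(\<Sum>k\<le>K. \<Sum>j\<le>k. 2 ^ j / 2 ^ k * S j) \<le> 2 * (\<Sum>j\<le>K. S j)"
proof -
  \<comment> \<open>The inductive claim carries the term of the last scale a second time. Passing to
    the next scale halves that term, so old and new copies balance exactly.\<close>
  have "(\<Sum>k\<le>K. \<Sum>j\<le>k. 2 ^ j / 2 ^ k * S j) + (\<Sum>j\<le>K. 2 ^ j / 2 ^ K * S j) \<le> 2 * (\<Sum>j\<le>K. S j)"
  proof (induction K)
    case (Suc K)
    have "(\<Sum>j\<le>Suc K. 2 ^ j / 2 ^ Suc K * S j) = (\<Sum>j\<le>K. 2 ^ j / 2 ^ K * S j) / 2 + S (Suc K)"
      by (simp add: sum_divide_distrib mult.commute)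
    then show ?case using Suc by simp
  qed simp
  moreover have "0 \<le> (\<Sum>j\<le>K. 2 ^ j / 2 ^ K * S j)" by (intro sum_nonneg) (simp add: assms)
  ultimately show ?thesis by linarith
qed

text \<open>The packing condition \<open>mult\<close> bounds the mass of all cubes of one scale that
  see a given lattice point. Exchanging the sums over cubes and points turns the weighted sum into
  an unweighted one over \<open>V\<close>; the factor 2^(kn) cancels the window size, and the sum
  over \<open>k\<close> is geometric.\<close>

lemma carleson_sum:
  fixes Y :: "nat \<Rightarrow> int ^ 'n \<Rightarrow> real" and m :: "'a \<Rightarrow> real" and q :: "'a \<Rightarrow> int ^ 'n"
  assumes N: "1 \<le> N" and fin: "\<And>k. finite (F k)" and "finite V"
    and m: "\<And>Q. 0 \<le> m Q"
    and sub: "\<And>k Q. k \<le> K \<Longrightarrow> Q \<in> F k \<Longrightarrow> window (q Q) (int N * 2 ^ k) \<subseteq> V"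
    and mult: "\<And>k x. k \<le> K \<Longrightarrow>
      (\<Sum>Q\<in>{Q \<in> F k. x \<in> window (q Q) (int N * 2 ^ k)}. m Q) \<le> D * 2 ^ (k * CARD('n))"
  shows "(\<Sum>k\<le>K. \<Sum>Q\<in>F k.
      ((\<Sum>j\<le>k. 2 ^ j * (\<Sum>x\<in>window (q Q) (int N * 2 ^ k). Y j x)) / 2 ^ (k * (CARD('n) + 1)))\<^sup>2 * m Q)
    \<le> 4 * (3 * real N) ^ CARD('n) * D * (\<Sum>j\<le>K. \<Sum>x\<in>V. (Y j x)\<^sup>2)"
proof -
  let ?W = "\<lambda>k Q. window (q Q) (int N * 2 ^ k)" and ?n = "CARD('n)"
  let ?c = "2 * (3 * real N) ^ ?n"
  define S where "S j = (\<Sum>x\<in>V. (Y j x)\<^sup>2)" for j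
  have S: "0 \<le> S j" for j by (simp add: S_def sum_nonneg)
  have scale: "(\<Sum>Q\<in>F k. ((\<Sum>j\<le>k. 2 ^ j * (\<Sum>x\<in>?W k Q. Y j x)) / 2 ^ (k * (?n + 1)))\<^sup>2 * m Q)
      \<le> ?c * D * (\<Sum>j\<le>k. 2 ^ j / 2 ^ k * S j)" if k: "k \<le> K" for k
  proof -
    have x: "(\<Sum>Q\<in>F k. (\<Sum>x\<in>?W k Q. (Y j x)\<^sup>2) * m Q) \<le> D * 2 ^ (k * ?n) * S j" for j
    proof -
      have "(\<Sum>Q\<in>F k. (\<Sum>x\<in>?W k Q. (Y j x)\<^sup>2) * m Q)
          = (\<Sum>Q\<in>F k. \<Sum>x\<in>V. if x \<in> ?W k Q then (Y j x)\<^sup>2 * m Q else 0)"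
        unfolding sum_distrib_right using sub[OF k] \<open>finite V\<close>
        by (intro sum.cong[OF refl] sum.mono_neutral_cong_left) auto
      also have "\<dots> = (\<Sum>x\<in>V. \<Sum>Q\<in>F k. if x \<in> ?W k Q then (Y j x)\<^sup>2 * m Q else 0)"
        by (rule sum.swap)
      also have "\<dots> = (\<Sum>x\<in>V. (Y j x)\<^sup>2 * (\<Sum>Q\<in>{Q \<in> F k. x \<in> ?W k Q}. m Q))"
        unfolding sum.inter_filter[OF fin] sum_distrib_left by (intro sum.cong refl) auto
      also have "\<dots> \<le> (\<Sum>x\<in>V. (Y j x)\<^sup>2 * (D * 2 ^ (k * ?n)))"
        by (intro sum_mono mult_left_mono mult[OF k]) auto
      also have "\<dots> = D * 2 ^ (k * ?n) * S j" by (simp add: S_def sum_distrib_left mult_ac)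
      finally show ?thesis .
    qed
    have "(\<Sum>Q\<in>F k. ((\<Sum>j\<le>k. 2 ^ j * (\<Sum>x\<in>?W k Q. Y j x)) / 2 ^ (k * (?n + 1)))\<^sup>2 * m Q)
        \<le> (\<Sum>Q\<in>F k. (?c / 2 ^ (k * ?n) * (\<Sum>j\<le>k. 2 ^ j / 2 ^ k * (\<Sum>x\<in>?W k Q. (Y j x)\<^sup>2))) * m Q)"
      by (intro sum_mono mult_right_mono scale_sum_square_le N m)
    also have "\<dots> = ?c / 2 ^ (k * ?n) * (\<Sum>Q\<in>F k. \<Sum>j\<le>k. 2 ^ j / 2 ^ k * ((\<Sum>x\<in>?W k Q. (Y j x)\<^sup>2) * m Q))"
      by (simp only: sum_distrib_left sum_distrib_right mult.assoc)
    also have "(\<Sum>Q\<in>F k. \<Sum>j\<le>k. 2 ^ j / 2 ^ k * ((\<Sum>x\<in>?W k Q. (Y j x)\<^sup>2) * m Q))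
        = (\<Sum>j\<le>k. 2 ^ j / 2 ^ k * (\<Sum>Q\<in>F k. (\<Sum>x\<in>?W k Q. (Y j x)\<^sup>2) * m Q))"
      unfolding sum_distrib_left by (rule sum.swap)
    also have "?c / 2 ^ (k * ?n) * \<dots> \<le> ?c / 2 ^ (k * ?n) * (\<Sum>j\<le>k. 2 ^ j / 2 ^ k * (D * 2 ^ (k * ?n) * S j))"
      by (intro mult_left_mono sum_mono x) auto
    also have "\<dots> = ?c * D * (\<Sum>j\<le>k. 2 ^ j / 2 ^ k * S j)"
      by (simp add: sum_distrib_left mult_ac)
    finally show ?thesis .
  qed
  \<comment> \<open>The sign of \<open>D\<close> comes from the packing condition at scale 0, where
    the left side is a sum of masses.\<close>
  have D: "0 \<le> D"
  proof -
    have "0 \<le> (\<Sum>Q\<in>{Q \<in> F 0. 0 \<in> ?W 0 Q}. m Q)" by (intro sum_nonneg m)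
    then show ?thesis using mult[of 0 0] by simp
  qed
  have "(\<Sum>k\<le>K. \<Sum>Q\<in>F k. ((\<Sum>j\<le>k. 2 ^ j * (\<Sum>x\<in>?W k Q. Y j x)) / 2 ^ (k * (?n + 1)))\<^sup>2 * m Q)
      \<le> (\<Sum>k\<le>K. ?c * D * (\<Sum>j\<le>k. 2 ^ j / 2 ^ k * S j))"
    by (intro sum_mono scale) simp
  also have "\<dots> = ?c * D * (\<Sum>k\<le>K. \<Sum>j\<le>k. 2 ^ j / 2 ^ k * S j)" by (simp add: sum_distrib_left)
  also have "\<dots> \<le> ?c * D * (2 * (\<Sum>j\<le>K. S j))"
    by (intro mult_left_mono sum_scales_le S) (simp add: D)
  finally show ?thesis by (simp add: S_def mult_ac)
qed

text \<open>Collects the Haar coefficients of the density and of all slopes, in all directions, so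
  that both are summed over cubes at once.\<close>

definition haar_total :: "(int ^ 'n \<Rightarrow> real) \<Rightarrow> (int ^ 'n \<Rightarrow> 'b::real_normed_vector) \<Rightarrow> nat \<Rightarrow> int ^ 'n \<Rightarrow> real" where
  "haar_total g A j x = (\<Sum>i\<in>UNIV. \<bar>haar i j g x\<bar> + (\<Sum>i'\<in>UNIV. norm (haar i j (unit_diff i' A) x)))"

lemma haar_mass_eq_haar_total:
  "haar_mass k q s g + (\<Sum>i\<in>UNIV. haar_mass k q s (unit_diff i A))
    = (\<Sum>j\<le>k. 2 ^ j * (\<Sum>x\<in>window q s. haar_total g A j x))"
proof -
  have 1: "haar_mass k q s f = (\<Sum>j\<le>k. 2 ^ j * (\<Sum>x\<in>window q s. \<Sum>i\<in>UNIV. norm (haar i j f x)))"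
    for f :: "int ^ 'a \<Rightarrow> 'c::real_normed_vector"
  proof -
    have "haar_mass k q s f = (\<Sum>j\<le>k. \<Sum>i\<in>UNIV. 2 ^ j * (\<Sum>x\<in>window q s. norm (haar i j f x)))"
      unfolding haar_mass_def by (rule sum.swap)
    also have "\<dots> = (\<Sum>j\<le>k. 2 ^ j * (\<Sum>i\<in>UNIV. \<Sum>x\<in>window q s. norm (haar i j f x)))"
      by (simp add: sum_distrib_left)
    also have "\<dots> = (\<Sum>j\<le>k. 2 ^ j * (\<Sum>x\<in>window q s. \<Sum>i\<in>UNIV. norm (haar i j f x)))"
      by (intro sum.cong refl arg_cong2[of _ _ _ _ "(*)"] sum.swap)
    finally show ?thesis .
  qed
  have "(\<Sum>i\<in>UNIV. haar_mass k q s (unit_diff i A))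
      = (\<Sum>j\<le>k. \<Sum>i\<in>UNIV. 2 ^ j * (\<Sum>x\<in>window q s. \<Sum>i'\<in>UNIV. norm (haar i' j (unit_diff i A) x)))"
    unfolding 1 by (rule sum.swap)
  also have "\<dots> = (\<Sum>j\<le>k. 2 ^ j * (\<Sum>i\<in>UNIV. \<Sum>x\<in>window q s. \<Sum>i'\<in>UNIV. norm (haar i' j (unit_diff i A) x)))"
    by (simp add: sum_distrib_left)
  also have "\<dots> = (\<Sum>j\<le>k. 2 ^ j * (\<Sum>x\<in>window q s. \<Sum>i'\<in>UNIV. \<Sum>i\<in>UNIV. norm (haar i' j (unit_diff i A) x)))"
    by (intro sum.cong refl arg_cong2[of _ _ _ _ "(*)"], subst sum.swap, rule sum.cong[OF refl], rule sum.swap)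
  finally show ?thesis
    unfolding 1[of g] haar_total_def
    by (simp add: sum.distrib distrib_left)
qed

section \<open>Total Haar energy of bounded functions\<close>

lemma sum_haar_square_le_card:
  fixes f :: "int ^ 'n \<Rightarrow> 'b::real_inner"
  assumes "\<And>x. norm (f x) \<le> B"
  shows "(\<Sum>j\<le>K. \<Sum>x\<in>window q r. (norm (haar i j f x))\<^sup>2) \<le> B\<^sup>2 * real (card (window q (r + 2 ^ Suc K)))"
proof -
  have "(\<Sum>j\<le>K. \<Sum>x\<in>window q r. (norm (haar i j f x))\<^sup>2) \<le> (\<Sum>x\<in>window q (r + 2 ^ Suc K). (norm (f x))\<^sup>2)"
    using haar_square_function[of i "Suc K" f q r] sum_nonneg[of "window q r" "\<lambda>x. (norm (box i (Suc K) f x))\<^sup>2"]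
    unfolding lessThan_Suc_atMost by simp
  also have "\<dots> \<le> (\<Sum>x\<in>window q (r + 2 ^ Suc K). B\<^sup>2)"
    by (intro sum_mono power_mono assms) simp
  finally show ?thesis by (simp add: mult.commute)
qed

text \<open>Cauchy-Schwarz over the directions reduces everything to the square function of each
  component. The powers of n in the constant count these applications and the components.\<close>

lemma sum_haar_total_square_le:
  fixes g :: "int ^ 'n \<Rightarrow> real" and A :: "int ^ 'n \<Rightarrow> 'b::real_inner"
  assumes g: "\<And>x. \<bar>g x\<bar> \<le> B" and A: "\<And>i x. norm (unit_diff i A x) \<le> B"
  shows "(\<Sum>j\<le>K. \<Sum>x\<in>window q r. (haar_total g A j x)\<^sup>2)
    \<le> 2 * real CARD('n) ^ 2 * (1 + real CARD('n) ^ 2) * (B\<^sup>2 * real (card (window q (r + 2 ^ Suc K))))"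
proof -
  let ?g = "\<lambda>i j x. (norm (haar i j g x))\<^sup>2" and ?A = "\<lambda>i i' j x. (norm (haar i j (unit_diff i' A) x))\<^sup>2"
  let ?n = "real CARD('n)" and ?E = "B\<^sup>2 * real (card (window q (r + 2 ^ Suc K)))"
  have pt: "(haar_total g A j x)\<^sup>2
      \<le> 2 * ?n * (\<Sum>i\<in>UNIV. ?g i j x + ?n * (\<Sum>i'\<in>UNIV. ?A i i' j x))" for j x
  proof -
    have "(haar_total g A j x)\<^sup>2 \<le> ?n * (\<Sum>i\<in>UNIV. (\<bar>haar i j g x\<bar> + (\<Sum>i'\<in>UNIV. norm (haar i j (unit_diff i' A) x)))\<^sup>2)"
      unfolding haar_total_def by (rule sum_square_le_card)
    also have "\<dots> \<le> ?n * (\<Sum>i\<in>UNIV. 2 * (?g i j x + ?n * (\<Sum>i'\<in>UNIV. ?A i i' j x)))"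
    proof (intro mult_left_mono sum_mono)
      fix i
      let ?a = "\<bar>haar i j g x\<bar>" and ?b = "\<Sum>i'\<in>UNIV. norm (haar i j (unit_diff i' A) x)"
      have "?b\<^sup>2 \<le> ?n * (\<Sum>i'\<in>UNIV. ?A i i' j x)"
        by (rule sum_square_le_card)
      moreover have "(?a + ?b)\<^sup>2 \<le> 2 * (?a\<^sup>2 + ?b\<^sup>2)" by (rule sum_power2_le)
      ultimately show "(?a + ?b)\<^sup>2 \<le> 2 * (?g i j x + ?n * (\<Sum>i'\<in>UNIV. ?A i i' j x))"
        by simp
    qed simp
    finally show ?thesis by (simp add: sum_distrib_left mult_ac)
  qed
  have "(\<Sum>j\<le>K. \<Sum>x\<in>window q r. (haar_total g A j x)\<^sup>2)
      \<le> (\<Sum>j\<le>K. \<Sum>x\<in>window q r. 2 * ?n * (\<Sum>i\<in>UNIV. ?g i j x + ?n * (\<Sum>i'\<in>UNIV. ?A i i' j x)))"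
    by (intro sum_mono pt)
  also have "\<dots> = 2 * ?n * (\<Sum>j\<le>K. \<Sum>i\<in>UNIV. \<Sum>x\<in>window q r. ?g i j x + ?n * (\<Sum>i'\<in>UNIV. ?A i i' j x))"
    unfolding sum_distrib_left[symmetric]
    by (intro arg_cong2[of _ _ _ _ "(*)"] sum.cong refl sum.swap)
  also have "(\<Sum>j\<le>K. \<Sum>i\<in>UNIV. \<Sum>x\<in>window q r. ?g i j x + ?n * (\<Sum>i'\<in>UNIV. ?A i i' j x))
      = (\<Sum>i\<in>UNIV. \<Sum>j\<le>K. \<Sum>x\<in>window q r. ?g i j x + ?n * (\<Sum>i'\<in>UNIV. ?A i i' j x))"
    by (rule sum.swap)
  also have "\<dots> = (\<Sum>i\<in>UNIV. (\<Sum>j\<le>K. \<Sum>x\<in>window q r. ?g i j x)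
        + ?n * (\<Sum>i'\<in>UNIV. \<Sum>j\<le>K. \<Sum>x\<in>window q r. ?A i i' j x))"
  proof -
    have "(\<Sum>j\<le>K. \<Sum>x\<in>window q r. \<Sum>i'\<in>UNIV. ?A i i' j x)
        = (\<Sum>i'\<in>UNIV. \<Sum>j\<le>K. \<Sum>x\<in>window q r. ?A i i' j x)" for i
    proof -
      have "(\<Sum>j\<le>K. \<Sum>x\<in>window q r. \<Sum>i'\<in>UNIV. ?A i i' j x)
          = (\<Sum>j\<le>K. \<Sum>i'\<in>UNIV. \<Sum>x\<in>window q r. ?A i i' j x)"
        by (intro sum.cong[OF refl] sum.swap)
      also have "\<dots> = (\<Sum>i'\<in>UNIV. \<Sum>j\<le>K. \<Sum>x\<in>window q r. ?A i i' j x)"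
        by (rule sum.swap)
      finally show ?thesis .
    qed
    then show ?thesis by (simp add: sum.distrib flip: sum_distrib_left)
  qed
  also have "\<dots> \<le> (\<Sum>i::'n\<in>UNIV. ?E + ?n * (\<Sum>i'::'n\<in>UNIV. ?E))"
    by (intro sum_mono add_mono mult_left_mono sum_haar_square_le_card A) (use g in auto)
  also have "\<dots> = ?n * (1 + ?n ^ 2) * ?E" by (simp add: power2_eq_square algebra_simps)
  finally show ?thesis by (simp add: power2_eq_square algebra_simps)
qed

section \<open>Gradient bounds and Lipschitz constants\<close>

lemma nn_integral_lborel_translate:
  fixes f :: "'a::euclidean_space \<Rightarrow> ennreal"
  assumes [measurable]: "f \<in> borel_measurable borel"
  shows "(\<integral>\<^sup>+z. f (c + z) \<partial>lborel) = (\<integral>\<^sup>+z. f z \<partial>lborel)"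
proof -
  have "(\<integral>\<^sup>+z. f z \<partial>lborel) = (\<integral>\<^sup>+z. f z \<partial>(distr lborel borel ((+) c)))"
    by (simp add: lborel_distr_plus)
  also have "\<dots> = (\<integral>\<^sup>+z. f (c + z) \<partial>lborel)" by (rule nn_integral_distr) auto
  finally show ?thesis by simp
qed

lemma norm_add_diff_telescope:
  fixes A :: "'a::real_vector \<Rightarrow> 'b::real_normed_vector"
  shows "norm (A (z + real N *\<^sub>R u) - A z) \<le> (\<Sum>m<N. norm (A (z + real m *\<^sub>R u + u) - A (z + real m *\<^sub>R u)))"
proof (induction N)
  case (Suc N)
  have eq: "z + real (Suc N) *\<^sub>R u = z + real N *\<^sub>R u + u" by (simp add: scaleR_left_distrib)
  show ?case
    unfolding eq sum.lessThan_Suc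
    using norm_triangle_ineq[of "A (z + real N *\<^sub>R u + u) - A (z + real N *\<^sub>R u)" "A (z + real N *\<^sub>R u) - A z"] Suc
    by simp
qed simp

text \<open>The segment from \<open>x\<close> to \<open>x + v\<close> may lie in the null set where \<open>A\<close> is not differentiable, so it is
  averaged over a small ball of starting points: the excess \<open>m N\<close> of the difference quotients over
  the gradient bound then tends to \<open>0\<close> in mean, uniformly along the segment.\<close>

lemma grad_bound_lipschitz:
  fixes A :: "'a::euclidean_space \<Rightarrow> 'b::euclidean_space"
  assumes lip: "K-lipschitz_on UNIV A" and grad: "grad_bound A C" and C: "0 \<le> C"
  shows "norm (A (x + v) - A x) \<le> C * norm v"
proof (rule field_le_epsilon)
  fix \<epsilon> :: real assume "0 < \<epsilon>"
  have K0: "0 \<le> K" using lip by (rule lipschitz_on_nonneg)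
  have lipK: "norm (A y - A z) \<le> K * norm (y - z)" for y z
    using lipschitz_onD[OF lip, of y z] by (simp add: dist_norm)
  have contA: "continuous_on UNIV A" by (rule lipschitz_on_continuous_on[OF lip])
  have [measurable]: "A \<in> borel_measurable borel" by (rule borel_measurable_continuous_onI[OF contA])
  \<comment> \<open>Moving both ends of the segment by at most r changes the increment by at most 2
    K r, to be absorbed in \<epsilon>. The added 1 covers K = 0.\<close>
  define r where "r = \<epsilon> / (2 * K + 1)"
  have r: "0 < r" "2 * K * r \<le> \<epsilon>"
    using \<open>0 < \<epsilon>\<close> K0 by (auto simp: r_def field_simps)
  \<comment> \<open>How much the difference quotient with step v/N exceeds the gradient bound: it
    tends to 0 where \<open>A\<close> is differentiable with the bounded derivative, and the
    Lipschitz constant dominates it everywhere.\<close>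
  define m where "m N w = max 0 (real N * norm (A (w + v /\<^sub>R real N) - A w) - C * norm v)" for N w
  have [measurable]: "m N \<in> borel_measurable borel" for N unfolding m_def[abs_def] by measurable
  have m0: "0 \<le> m N w" for N w by (simp add: m_def)
  have mK: "m N w \<le> K * norm v" for N w
  proof (cases "N = 0")
    case False
    have "real N * norm (A (w + v /\<^sub>R real N) - A w) \<le> real N * (K * norm (v /\<^sub>R real N))"
      using lipK[of "w + v /\<^sub>R real N" w] by (intro mult_left_mono) auto
    also have "\<dots> = K * norm v" using False by simp
    finally show ?thesis unfolding m_def using C K0 by (smt (verit) mult_nonneg_nonneg norm_ge_zero)
  qed (use K0 C in \<open>simp add: m_def\<close>)
  have mlim: "AE w in lborel. (\<lambda>N. m N w) \<longlonglongrightarrow> 0"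
    using grad unfolding grad_bound_def
  proof eventually_elim
    case (elim w)
    define D where "D = frechet_derivative A (at w)"
    have D: "(A has_derivative D) (at w)" unfolding D_def using elim by (simp add: frechet_derivative_works)
    have "((\<lambda>t. A (w + t *\<^sub>R v)) has_vector_derivative D v) (at 0)"
    proof -
      have "((\<lambda>t. w + t *\<^sub>R v) has_derivative (\<lambda>t. t *\<^sub>R v)) (at 0)"
        by (auto intro!: derivative_eq_intros)
      moreover have "(A has_derivative D) (at (w + 0 *\<^sub>R v))" using D by simp
      ultimately have "((\<lambda>t. A (w + t *\<^sub>R v)) has_derivative (\<lambda>t. D (t *\<^sub>R v))) (at 0)"
        by (rule has_derivative_compose)
      then show ?thesis
        using linear_scale[OF has_derivative_linear[OF D]] by (simp add: has_vector_derivative_def)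
    qed
    then have "(\<lambda>h. norm (A (w + h *\<^sub>R v) - A w - h *\<^sub>R D v) / norm h) \<midarrow>0\<rightarrow> 0"
      by (simp add: has_vector_derivative_def has_derivative_at)
    moreover have "\<forall>\<^sub>F h in at 0. norm (A (w + h *\<^sub>R v) - A w - h *\<^sub>R D v) / norm h
        = norm ((A (w + h *\<^sub>R v) - A w) /\<^sub>R h - D v)"
    proof (rule eventually_at_filter[THEN iffD2], intro always_eventually allI impI)
      fix h :: real assume "h \<noteq> 0"
      then have "(A (w + h *\<^sub>R v) - A w) /\<^sub>R h - D v = (A (w + h *\<^sub>R v) - A w - h *\<^sub>R D v) /\<^sub>R h"
        by (simp add: scaleR_right_diff_distrib)
      then show "norm (A (w + h *\<^sub>R v) - A w - h *\<^sub>R D v) / norm h = norm ((A (w + h *\<^sub>R v) - A w) /\<^sub>R h - D v)"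
        by (simp add: divide_inverse mult.commute)
    qed
    ultimately have "((\<lambda>h. norm ((A (w + h *\<^sub>R v) - A w) /\<^sub>R h - D v)) \<longlongrightarrow> 0) (at 0)"
      by (rule Lim_transform_eventually)
    then have "((\<lambda>t. (A (w + t *\<^sub>R v) - A w) /\<^sub>R t) \<longlongrightarrow> D v) (at 0)"
      using tendsto_norm_zero_iff LIM_zero_cancel by blast
    moreover have "filterlim (\<lambda>N. inverse (real N)) (at 0) sequentially"
      by (intro filterlim_atI tendsto_inverse_0_at_top filterlim_real_sequentially)
         (auto intro!: eventually_sequentiallyI[of 1])
    ultimately have "(\<lambda>N. (A (w + inverse (real N) *\<^sub>R v) - A w) /\<^sub>R inverse (real N)) \<longlonglongrightarrow> D v"
      by (rule filterlim_compose)
    then have "(\<lambda>N. max 0 (norm ((A (w + inverse (real N) *\<^sub>R v) - A w) /\<^sub>R inverse (real N)) - C * norm v))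
        \<longlonglongrightarrow> max 0 (norm (D v) - C * norm v)"
      by (intro tendsto_intros)
    moreover have "norm (D v) \<le> C * norm v"
    proof -
      have "norm (D v) \<le> onorm D * norm v" by (rule onorm[OF has_derivative_bounded_linear[OF D]])
      also have "\<dots> \<le> C * norm v" using elim by (intro mult_right_mono) (auto simp: D_def)
      finally show ?thesis .
    qed
    ultimately show ?case by (simp add: m_def[abs_def] mult.commute)
  qed
  define B where "B = cball x r"
  \<comment> \<open>Large enough to contain all translates of \<open>B\<close> along the segment, so
    that one integral \<open>I N\<close> serves every step.\<close>
  define B' where "B' = cball x (r + norm v)"
  have [measurable]: "B \<in> sets borel" "B' \<in> sets borel" by (auto simp: B_def B'_def)
  define \<beta> where "\<beta> = measure lborel B"
  have B: "emeasure lborel B = ennreal \<beta>"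
    unfolding \<beta>_def B_def by (intro emeasure_eq_ennreal_measure) (metis emeasure_lborel_cball_finite infinity_ennreal_def less_irrefl)
  have \<beta>: "0 < \<beta>" unfolding \<beta>_def B_def using r by (simp add: content_cball_pos)
  have fin': "emeasure lborel B' < \<infinity>" unfolding B'_def by (rule emeasure_lborel_cball_finite)
  define I where "I N = (\<integral>\<^sup>+w. ennreal (m N w) * indicator B' w \<partial>lborel)" for N
  have Ilim: "I \<longlonglongrightarrow> 0"
  proof -
    have "(\<lambda>N. \<integral>\<^sup>+w. ennreal (m N w) * indicator B' w \<partial>lborel) \<longlonglongrightarrow> (\<integral>\<^sup>+w. 0 \<partial>(lborel :: 'a measure))"
    proof (rule nn_integral_dominated_convergence[where w = "\<lambda>w. ennreal (K * norm v) * indicator B' w"])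
      show "(\<integral>\<^sup>+w. ennreal (K * norm v) * indicator B' w \<partial>lborel) < \<infinity>"
        using fin' by (simp add: nn_integral_cmult_indicator ennreal_mult_less_top)
      show "AE w in lborel. (\<lambda>N. ennreal (m N w) * indicator B' w) \<longlonglongrightarrow> 0"
        using mlim
      proof eventually_elim
        case (elim w)
        then have "(\<lambda>N. ennreal (m N w)) \<longlonglongrightarrow> ennreal 0" by (rule tendsto_ennrealI)
        then show ?case by (cases "w \<in> B'") auto
      qed
    qed (auto intro!: AE_I2 mult_right_mono ennreal_leI mK)
    then show ?thesis by (simp add: I_def[abs_def])
  qed
  let ?d = "norm (A (x + v) - A x)"
  \<comment> \<open>The increment from z to z + v is cut into N steps and integrated over z in
    \<open>B\<close>. Each step costs the gradient bound plus a translated copy of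
    \<open>m N\<close>, both divided by N, and translation invariance bounds the copies by
    \<open>I N\<close>.\<close>
  have main: "ennreal ((?d - 2 * K * r) * \<beta>) \<le> ennreal (C * norm v * \<beta>) + I N" if N: "0 < N" for N
  proof -
    define u where "u = v /\<^sub>R real N"
    have Nu: "real N *\<^sub>R u = v" using N by (simp add: u_def)
    have le_m: "norm (A (w + u) - A w) \<le> (C * norm v + m N w) / real N" for w
      using N by (simp add: m_def u_def field_simps)
    have "ennreal ((?d - 2 * K * r) * \<beta>) = (\<integral>\<^sup>+z. ennreal (?d - 2 * K * r) * indicator B z \<partial>lborel)"
      using \<beta> by (simp add: nn_integral_cmult_indicator B ennreal_mult'')
    also have "\<dots> \<le> (\<integral>\<^sup>+z. (\<Sum>j<N. ennreal ((C * norm v + m N (z + real j *\<^sub>R u)) / real N)) * indicator B z \<partial>lborel)"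
    proof (intro nn_integral_mono)
      fix z :: 'a
      show "ennreal (?d - 2 * K * r) * indicator B z
          \<le> (\<Sum>j<N. ennreal ((C * norm v + m N (z + real j *\<^sub>R u)) / real N)) * indicator B z"
      proof (cases "z \<in> B")
        case True
        then have zx: "norm (z - x) \<le> r" by (simp add: B_def dist_norm norm_minus_commute)
        have "norm (A (x + v) - A (z + v)) \<le> K * r" "norm (A z - A x) \<le> K * r"
          using lipK[of "x + v" "z + v"] lipK[of z x] zx K0
          by (auto simp: norm_minus_commute intro: order_trans mult_left_mono)
        moreover have "?d \<le> norm (A (x + v) - A (z + v)) + norm (A (z + v) - A z) + norm (A z - A x)"
          by (rule norm_diff_triangle_le[OF norm_diff_triangle_le[OF order_refl order_refl] order_refl])
        ultimately have "?d - 2 * K * r \<le> norm (A (z + real N *\<^sub>R u) - A z)" unfolding Nu by simp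
        also have "\<dots> \<le> (\<Sum>j<N. norm (A (z + real j *\<^sub>R u + u) - A (z + real j *\<^sub>R u)))"
          by (rule norm_add_diff_telescope)
        also have "\<dots> \<le> (\<Sum>j<N. (C * norm v + m N (z + real j *\<^sub>R u)) / real N)"
          by (intro sum_mono le_m)
        finally have "ennreal (?d - 2 * K * r) \<le> ennreal (\<Sum>j<N. (C * norm v + m N (z + real j *\<^sub>R u)) / real N)"
          by (rule ennreal_leI)
        also have "\<dots> = (\<Sum>j<N. ennreal ((C * norm v + m N (z + real j *\<^sub>R u)) / real N))"
          using C m0 by (intro sum_ennreal[symmetric]) auto
        finally show ?thesis using True by simp
      qed simp
    qed
    also have "\<dots> = (\<Sum>j<N. \<integral>\<^sup>+z. ennreal ((C * norm v + m N (z + real j *\<^sub>R u)) / real N) * indicator B z \<partial>lborel)"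
      unfolding sum_distrib_right by (rule nn_integral_sum) measurable
    also have "\<dots> \<le> (\<Sum>j<N. (ennreal (C * norm v * \<beta>) + I N) / ennreal (real N))"
    proof (rule sum_mono)
      fix j assume "j \<in> {..<N}"
      then have "norm (real j *\<^sub>R u) \<le> norm v"
        using N by (simp add: u_def field_simps mult_right_mono)
      have "(\<integral>\<^sup>+z. ennreal ((C * norm v + m N (z + real j *\<^sub>R u)) / real N) * indicator B z \<partial>lborel)
          = (\<integral>\<^sup>+z. (ennreal (C * norm v) * indicator B z + ennreal (m N (real j *\<^sub>R u + z)) * indicator B z) / ennreal (real N) \<partial>lborel)"
        using C m0 N
        by (intro nn_integral_cong) (auto simp: divide_ennreal[symmetric] add.commute split: split_indicator)
      also have "\<dots> = ((\<integral>\<^sup>+z. ennreal (C * norm v) * indicator B z \<partial>lborel)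
          + (\<integral>\<^sup>+z. ennreal (m N (real j *\<^sub>R u + z)) * indicator B z \<partial>lborel)) / ennreal (real N)"
        by (simp add: nn_integral_divide nn_integral_add)
      also have "\<dots> \<le> (ennreal (C * norm v * \<beta>) + I N) / ennreal (real N)"
      proof (intro divide_right_mono_ennreal add_mono)
        show "(\<integral>\<^sup>+z. ennreal (C * norm v) * indicator B z \<partial>lborel) \<le> ennreal (C * norm v * \<beta>)"
          using C \<beta> by (simp add: nn_integral_cmult_indicator B ennreal_mult)
        have "(\<integral>\<^sup>+z. ennreal (m N (real j *\<^sub>R u + z)) * indicator B z \<partial>lborel)
            \<le> (\<integral>\<^sup>+z. ennreal (m N (real j *\<^sub>R u + z)) * indicator B' (real j *\<^sub>R u + z) \<partial>lborel)"
        proof (intro nn_integral_mono mult_left_mono)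
          fix z
          have "dist x (real j *\<^sub>R u + z) \<le> r + norm v" if "dist x z \<le> r"
            using that \<open>norm (real j *\<^sub>R u) \<le> norm v\<close> norm_triangle_ineq4[of "x - z" "real j *\<^sub>R u"]
            by (simp add: dist_norm algebra_simps)
          then show "indicator B z \<le> (indicator B' (real j *\<^sub>R u + z) :: ennreal)"
            by (auto simp: B_def B'_def split: split_indicator)
        qed simp
        also have "\<dots> = I N" unfolding I_def by (rule nn_integral_lborel_translate) measurable
        finally show "(\<integral>\<^sup>+z. ennreal (m N (real j *\<^sub>R u + z)) * indicator B z \<partial>lborel) \<le> I N" .
      qed
      finally show "(\<integral>\<^sup>+z. ennreal ((C * norm v + m N (z + real j *\<^sub>R u)) / real N) * indicator B z \<partial>lborel)
          \<le> (ennreal (C * norm v * \<beta>) + I N) / ennreal (real N)" .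
    qed
    also have "\<dots> = ennreal (C * norm v * \<beta>) + I N"
      using N mult_divide_eq_ennreal[of "of_nat N" "ennreal (C * norm v * \<beta>) + I N"]
      by (simp add: ennreal_of_nat_eq_real_of_nat[symmetric] ennreal_times_divide mult.commute)
    finally show ?thesis .
  qed
  have "(\<lambda>N. ennreal (C * norm v * \<beta>) + I N) \<longlonglongrightarrow> ennreal (C * norm v * \<beta>) + 0"
    by (intro tendsto_add tendsto_const Ilim)
  then have "ennreal ((?d - 2 * K * r) * \<beta>) \<le> ennreal (C * norm v * \<beta>)"
    by (intro LIMSEQ_le_const[where X = "\<lambda>N. ennreal (C * norm v * \<beta>) + I N"]) (auto intro!: exI[of _ 1] main)
  then have "(?d - 2 * K * r) * \<beta> \<le> C * norm v * \<beta>"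
    using C \<beta> by (simp add: ennreal_le_iff)
  then have "?d - 2 * K * r \<le> C * norm v" using \<beta> by simp
  then show "?d \<le> C * norm v + \<epsilon>" using r(2) by linarith
qed

section \<open>Hausdorff measure of graphs over cells\<close>

definition lift :: "('n \<Rightarrow> 'd) \<Rightarrow> real ^ 'n \<Rightarrow> real ^ 'd" where
  "lift e x = (\<chi> j. if j \<in> range e then x $ inv e j else 0)"

definition graph_map :: "('n \<Rightarrow> 'd) \<Rightarrow> (real ^ 'n \<Rightarrow> real ^ 'd) \<Rightarrow> real ^ 'n \<Rightarrow> real ^ 'd" where
  "graph_map e A x = lift e x + A x"

text \<open>The floor makes cells half open, so the cylinders over them partition the whole space
  and each point is counted once.\<close>

definition cell :: "('n \<Rightarrow> 'd) \<Rightarrow> real \<Rightarrow> real ^ 'd \<Rightarrow> int ^ 'n" where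
  "cell e \<delta> z = (\<chi> i. \<lfloor>z $ e i / \<delta>\<rfloor>)"

definition cylinder :: "('n \<Rightarrow> 'd) \<Rightarrow> real \<Rightarrow> int ^ 'n \<Rightarrow> (real ^ 'd) set" where
  "cylinder e \<delta> p = {z. cell e \<delta> z = p}"

definition grid :: "real \<Rightarrow> int ^ 'n \<Rightarrow> real ^ 'n" where
  "grid \<delta> p = (\<chi> i. \<delta> * of_int (p $ i))"

lemma lift_nth [simp]: "inj e \<Longrightarrow> lift e x $ e i = x $ i"
  by (simp add: lift_def)

lemma linear_lift: "linear (lift e)"
  by (rule linearI) (auto simp: lift_def vec_eq_iff)

lemma graph_map_nth: "inj e \<Longrightarrow> A x \<in> vertical_space e \<Longrightarrow> graph_map e A x $ e i = x $ i"
  by (simp add: graph_map_def vertical_space_def)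

lemma horizontal_part_graph_map [simp]:
  "inj e \<Longrightarrow> A x \<in> vertical_space e \<Longrightarrow> horizontal_part e (graph_map e A x) = x"
  by (simp add: horizontal_part_def graph_map_nth)

lemma lift_plus_vertical: "inj e \<Longrightarrow> lift e (horizontal_part e z) + vertical_part e z = z"
  by (auto simp: vec_eq_iff lift_def horizontal_part_def vertical_part_def)

lemma vertical_part_graph_map:
  assumes "inj e" "A x \<in> vertical_space e"
  shows "vertical_part e (graph_map e A x) = A x"
proof -
  have "lift e x + vertical_part e (graph_map e A x) = graph_map e A x"
    using lift_plus_vertical[OF assms(1), of "graph_map e A x"]
    unfolding horizontal_part_graph_map[OF assms(1), of A x, OF assms(2)] .
  then show ?thesis by (simp add: graph_map_def)
qed

lemma graph_of_eq_range:
  assumes "inj e" "range A \<subseteq> vertical_space e"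
  shows "graph_of e A = range (graph_map e A)"
proof -
  have A: "A x \<in> vertical_space e" for x using assms(2) by blast
  have "z = graph_map e A (horizontal_part e z)" if "z \<in> graph_of e A" for z
    using that lift_plus_vertical[OF assms(1), of z] by (simp add: graph_of_def graph_map_def)
  moreover have "graph_map e A x \<in> graph_of e A" for x
    using A assms(1) by (simp add: graph_of_def vertical_part_graph_map)
  ultimately show ?thesis by (metis (no_types, lifting) image_iff rangeI subsetI subset_antisym)
qed

lemma norm_le_of_components:
  fixes x :: "real ^ 'n"
  assumes "\<And>i. \<bar>x $ i\<bar> \<le> t"
  shows "norm x \<le> real CARD('n) * t"
proof -
  have "(\<Sum>i\<in>UNIV. \<bar>x $ i\<bar>) \<le> (\<Sum>i::'n\<in>UNIV. t)" by (intro sum_mono assms)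
  then show ?thesis using norm_le_l1_cart[of x] by simp
qed

lemma norm_lift_le:
  fixes e :: "'n::finite \<Rightarrow> 'd::finite"
  assumes "inj e" "\<And>i. \<bar>x $ i\<bar> \<le> t"
  shows "norm (lift e x) \<le> real CARD('n) * t"
proof -
  have "norm (lift e x) \<le> (\<Sum>j\<in>UNIV. \<bar>lift e x $ j\<bar>)" by (rule norm_le_l1_cart)
  also have "\<dots> = (\<Sum>j\<in>range e. \<bar>lift e x $ j\<bar>)"
    by (rule sum.mono_neutral_right) (auto simp: lift_def)
  also have "\<dots> = (\<Sum>i\<in>UNIV. \<bar>x $ i\<bar>)" using assms(1) by (simp add: sum.reindex)
  also have "\<dots> \<le> (\<Sum>i::'n\<in>UNIV. t)" by (intro sum_mono assms)
  finally show ?thesis by simp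
qed

lemma dist_graph_map_le:
  fixes e :: "'n::finite \<Rightarrow> 'd::finite"
  assumes "inj e" and lip: "\<And>x y. norm (A x - A y) \<le> C * norm (x - y)" "0 \<le> C"
    and t: "\<And>i. \<bar>x $ i - y $ i\<bar> \<le> t"
  shows "norm (graph_map e A x - graph_map e A y) \<le> (1 + C) * real CARD('n) * t"
proof -
  have "norm (lift e (x - y)) \<le> real CARD('n) * t" by (rule norm_lift_le[OF assms(1)]) (simp add: t)
  moreover have "norm (x - y) \<le> real CARD('n) * t" by (rule norm_le_of_components) (simp add: t)
  then have "norm (A x - A y) \<le> C * (real CARD('n) * t)"
    using lip(1)[of x y] mult_left_mono[OF _ lip(2)] order_trans by blast
  moreover have "graph_map e A x - graph_map e A y = lift e (x - y) + (A x - A y)"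
    by (simp add: graph_map_def linear_diff[OF linear_lift])
  ultimately show ?thesis
    using norm_triangle_ineq[of "lift e (x - y)" "A x - A y"] by (simp add: distrib_right mult.assoc)
qed

lemma cylinder_iff:
  assumes "0 < \<delta>"
  shows "z \<in> cylinder e \<delta> p \<longleftrightarrow> (\<forall>i. \<delta> * of_int (p $ i) \<le> z $ e i \<and> z $ e i < \<delta> * of_int (p $ i) + \<delta>)"
proof -
  have "\<lfloor>z $ e i / \<delta>\<rfloor> = p $ i \<longleftrightarrow> \<delta> * of_int (p $ i) \<le> z $ e i \<and> z $ e i < \<delta> * of_int (p $ i) + \<delta>" for i
    using assms by (simp add: floor_eq_iff pos_le_divide_eq pos_divide_less_eq algebra_simps)
  then show ?thesis by (auto simp: cylinder_def cell_def vec_eq_iff)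
qed

lemma cylinder_borel [measurable]:
  fixes e :: "'n::finite \<Rightarrow> 'd::finite"
  shows "cylinder e \<delta> p \<in> sets borel"
proof -
  have "cylinder e \<delta> p = (\<Inter>i. {z \<in> space borel. \<lfloor>z $ e i / \<delta>\<rfloor> = p $ i})"
    by (auto simp: cylinder_def cell_def vec_eq_iff)
  also have "\<dots> \<in> sets borel" by (intro sets.finite_INT) auto
  finally show ?thesis .
qed

lemma hausdorff_pre_finite_cover:
  assumes "finite I" "X \<subseteq> (\<Union>i\<in>I. U i)" "\<And>i. i \<in> I \<Longrightarrow> bounded (U i) \<and> diameter (U i) \<le> \<epsilon>" "0 \<le> \<epsilon>"
  shows "hausdorff_pre n \<epsilon> X \<le> (\<Sum>i\<in>I. hausdorff_gauge n (U i))"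
proof -
  obtain h where h: "bij_betw h {..<card I} I"
    using ex_bij_betw_nat_finite[OF assms(1)] by (auto simp: atLeast0LessThan)
  define V where "V k = (if k < card I then U (h k) else {})" for k
  have hI: "h k \<in> I" if "k < card I" for k using h that by (auto simp: bij_betw_def)
  have "X \<subseteq> (\<Union>k. V k)"
  proof
    fix x assume "x \<in> X"
    then obtain i where i: "i \<in> I" "x \<in> U i" using assms(2) by blast
    then have "i \<in> h ` {..<card I}" using h by (simp add: bij_betw_def)
    then obtain k where "k < card I" "h k = i" by blast
    then have "x \<in> V k" using i by (simp add: V_def)
    then show "x \<in> (\<Union>k. V k)" by blast
  qed
  then have "hausdorff_pre n \<epsilon> X \<le> (\<Sum>k. hausdorff_gauge n (V k))"
    unfolding hausdorff_pre_def using assms(3,4) hI by (intro INF_lower) (auto simp: V_def)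
  also have "\<dots> = (\<Sum>k<card I. hausdorff_gauge n (V k))"
    by (rule suminf_finite) (auto simp: V_def)
  also have "\<dots> = (\<Sum>k<card I. hausdorff_gauge n (U (h k)))" by (simp add: V_def)
  also have "\<dots> = (\<Sum>i\<in>I. hausdorff_gauge n (U i))" by (rule sum.reindex_bij_betw[OF h])
  finally show ?thesis .
qed

lemma hausdorff_gauge_le:
  assumes "bounded U" "diameter U \<le> D"
  shows "hausdorff_gauge n U \<le> ennreal (unit_ball_vol (real n) * (D / 2) ^ n)"
  using assms diameter_ge_0[OF assms(1)]
  by (auto simp: hausdorff_gauge_def intro!: ennreal_leI mult_left_mono power_mono)

text \<open>Subdivision of the cell at mesh \<delta>/N covers the graph by O(N^n) pieces of diameter
  O(\<delta>/N), and the powers of N cancel.\<close>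

lemma hausdorff_outer_graph_le:
  fixes e :: "'n::finite \<Rightarrow> 'd::finite"
  assumes inj: "inj e" and A: "range A \<subseteq> vertical_space e"
    and lip: "\<And>x y. norm (A x - A y) \<le> C * norm (x - y)" "0 \<le> C" and \<delta>: "0 < \<delta>"
  shows "hausdorff_outer CARD('n) (graph_of e A \<inter> cylinder e \<delta> p)
    \<le> ennreal (unit_ball_vol (real CARD('n)) * (3 * (1 + C) * real CARD('n) / 2) ^ CARD('n) * \<delta> ^ CARD('n))"
proof -
  let ?n = "CARD('n)" and ?X = "graph_of e A \<inter> cylinder e \<delta> p"
  define D where "D = (1 + C) * real ?n * \<delta>"
  have D: "0 < D" using lip(2) \<delta> by (simp add: D_def)
  have Av: "A x \<in> vertical_space e" for x using A by blast
  have sub: "hausdorff_pre ?n (D / real N) ?X \<le> ennreal (unit_ball_vol (real ?n) * (3 * D / 2) ^ ?n)" if N: "0 < N" for N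
  proof -
    \<comment> \<open>Base index of the subcells. The window around it is symmetric and thus larger
      than the actual range of indices; (2N+1)^n \<le> (3N)^n is where the 3 comes from.\<close>
    define q where "q = (\<chi> i. int N * p $ i)"
    let ?I = "window q (int N)"
    define U where "U p' = graph_of e A \<inter> cylinder e (\<delta> / real N) p'" for p'
    have \<delta>N: "0 < \<delta> / real N" using \<delta> N by simp
    have diam: "norm (z - z') \<le> D / real N" if "z \<in> U p'" "z' \<in> U p'" for z z' p'
    proof -
      obtain x x' where x: "z = graph_map e A x" "z' = graph_map e A x'"
        using \<open>z \<in> U p'\<close> \<open>z' \<in> U p'\<close> unfolding U_def graph_of_eq_range[OF inj A] by blast
      have "\<bar>x $ i - x' $ i\<bar> \<le> \<delta> / real N" for i
        using \<open>z \<in> U p'\<close> \<open>z' \<in> U p'\<close>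
        unfolding U_def Int_iff cylinder_iff[OF \<delta>N] x graph_map_nth[OF inj Av]
        by (smt (verit))
      from dist_graph_map_le[OF inj lip this] show ?thesis by (simp add: x D_def)
    qed
    have U: "bounded (U p') \<and> diameter (U p') \<le> D / real N" for p'
    proof
      show "bounded (U p')"
      proof (cases "U p' = {}")
        case False
        then obtain z where "z \<in> U p'" by blast
        then have "U p' \<subseteq> cball z (D / real N)" using diam by (auto simp: dist_norm)
        then show ?thesis using bounded_subset bounded_cball by blast
      qed simp
      show "diameter (U p') \<le> D / real N" using diam D by (intro diameter_le) auto
    qed
    have "?X \<subseteq> (\<Union>p'\<in>?I. U p')"
    proof
      fix z assume z: "z \<in> ?X"
      define p' where "p' = cell e (\<delta> / real N) z"
      have "\<bar>p' $ i - q $ i\<bar> \<le> int N" for i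
      proof -
        define y where "y = z $ e i / \<delta>"
        have fl: "\<lfloor>y\<rfloor> = p $ i" using z by (auto simp: cylinder_def cell_def y_def)
        have p': "p' $ i = \<lfloor>real N * y\<rfloor>" by (simp add: p'_def cell_def y_def mult.commute)
        have "real N * of_int (p $ i) \<le> real N * y" using fl by (intro mult_left_mono) (auto simp: floor_eq_iff)
        then have 1: "int N * p $ i \<le> \<lfloor>real N * y\<rfloor>" by (simp add: le_floor_iff)
        have "real N * y \<le> real N * (of_int (p $ i) + 1)" using fl by (intro mult_left_mono) (auto simp: floor_eq_iff)
        then have "\<lfloor>real N * y\<rfloor> \<le> \<lfloor>real_of_int (int N * (p $ i + 1))\<rfloor>" by (intro floor_mono) simp
        then have "\<lfloor>real N * y\<rfloor> \<le> int N * p $ i + int N" unfolding floor_of_int by (simp add: distrib_left)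
        then show ?thesis using 1 by (simp add: p' q_def)
      qed
      then have "p' \<in> ?I" by (simp add: window_def)
      moreover have "z \<in> U p'" using z by (simp add: U_def cylinder_def p'_def)
      ultimately show "z \<in> (\<Union>p'\<in>?I. U p')" by blast
    qed
    then have "hausdorff_pre ?n (D / real N) ?X \<le> (\<Sum>p'\<in>?I. hausdorff_gauge ?n (U p'))"
      using U D N by (intro hausdorff_pre_finite_cover) auto
    also have "\<dots> \<le> (\<Sum>p'\<in>?I. ennreal (unit_ball_vol (real ?n) * (D / real N / 2) ^ ?n))"
      using U by (intro sum_mono hausdorff_gauge_le) auto
    also have "\<dots> = ennreal (real (card ?I) * (unit_ball_vol (real ?n) * (D / real N / 2) ^ ?n))"
      using D by (simp add: ennreal_mult ennreal_of_nat_eq_real_of_nat)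
    also have "\<dots> \<le> ennreal ((3 * real N) ^ ?n * (unit_ball_vol (real ?n) * (D / real N / 2) ^ ?n))"
    proof (intro ennreal_leI mult_right_mono)
      have "real (card ?I) = (2 * real N + 1) ^ ?n" by (subst real_card_window) auto
      also have "\<dots> \<le> (3 * real N) ^ ?n" using N by (intro power_mono) auto
      finally show "real (card ?I) \<le> (3 * real N) ^ ?n" .
    qed (use D in simp)
    also have "(3 * real N) ^ ?n * (unit_ball_vol (real ?n) * (D / real N / 2) ^ ?n)
        = unit_ball_vol (real ?n) * (3 * real N * (D / real N / 2)) ^ ?n"
      by (simp only: power_mult_distrib mult_ac)
    also have "3 * real N * (D / real N / 2) = 3 * D / 2" using N by simp
    finally show ?thesis .
  qed
  have "hausdorff_outer ?n ?X \<le> ennreal (unit_ball_vol (real ?n) * (3 * D / 2) ^ ?n)"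
    unfolding hausdorff_outer_def
  proof (rule SUP_least)
    fix \<epsilon> :: real assume "\<epsilon> \<in> {0<..}"
    then have \<epsilon>: "0 < \<epsilon>" by simp
    obtain N where N: "D / \<epsilon> < real N" using reals_Archimedean2 by blast
    then have N0: "0 < N" using D \<epsilon> by (metis divide_pos_pos of_nat_0_less_iff order_less_trans)
    have "D / real N \<le> \<epsilon>" using N N0 \<epsilon> by (simp add: field_simps)
    then show "hausdorff_pre ?n \<epsilon> ?X \<le> ennreal (unit_ball_vol (real ?n) * (3 * D / 2) ^ ?n)"
      using hausdorff_pre_antimono sub[OF N0] order_trans by blast
  qed
  also have "3 * D / 2 = (3 * (1 + C) * real ?n / 2) * \<delta>" by (simp add: D_def)
  also have "\<dots> ^ ?n = (3 * (1 + C) * real ?n / 2) ^ ?n * \<delta> ^ ?n" by (rule power_mult_distrib)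
  finally show ?thesis by (simp add: mult.assoc)
qed

lemma dist_horizontal_part_le:
  fixes e :: "'n::finite \<Rightarrow> 'd::finite"
  assumes "inj e"
  shows "dist (horizontal_part e z) (horizontal_part e w) \<le> dist z w"
proof -
  have "(norm (horizontal_part e z - horizontal_part e w))\<^sup>2 = (\<Sum>i\<in>UNIV. ((z - w) $ e i)\<^sup>2)"
    unfolding power2_norm_eq_inner inner_vec_def by (simp add: horizontal_part_def power2_eq_square)
  also have "\<dots> = (\<Sum>j\<in>range e. ((z - w) $ j)\<^sup>2)" using assms by (simp add: sum.reindex)
  also have "\<dots> \<le> (\<Sum>j\<in>UNIV. ((z - w) $ j)\<^sup>2)" by (rule sum_mono2) auto
  also have "\<dots> = (norm (z - w))\<^sup>2"
    unfolding power2_norm_eq_inner inner_vec_def by (simp add: power2_eq_square)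
  finally show ?thesis unfolding dist_norm by (rule power2_le_imp_le) simp
qed

text \<open>The projection does not increase distances, so a cover of \<open>S\<close> projects into
  balls whose radii are the diameters of its members. Using the diameter as radius avoids an
  isodiametric inequality; the loss 2^n is harmless for a positivity statement.\<close>

lemma lborel_le_hausdorff_outer:
  fixes e :: "'n::finite \<Rightarrow> 'd::finite"
  assumes inj: "inj e" and B: "B \<subseteq> horizontal_part e ` S"
  shows "emeasure lborel B \<le> 2 ^ CARD('n) * hausdorff_outer CARD('n) S"
proof -
  let ?n = "CARD('n)"
  have "emeasure lborel B \<le> (\<Sum>i. 2 ^ ?n * hausdorff_gauge ?n (U i))"
    if U: "S \<subseteq> (\<Union>i. U i)" "\<And>i. bounded (U i)" for U :: "nat \<Rightarrow> (real ^ 'd) set"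
  proof -
    define W where "W i = (if U i = {} then {} else cball (horizontal_part e (SOME u. u \<in> U i)) (diameter (U i)))" for i
    have "horizontal_part e ` U i \<subseteq> W i" for i
    proof (cases "U i = {}")
      case False
      then have "(SOME u. u \<in> U i) \<in> U i" by (simp add: some_in_eq)
      then have "dist (horizontal_part e (SOME u. u \<in> U i)) (horizontal_part e z) \<le> diameter (U i)" if "z \<in> U i" for z
        using order_trans[OF dist_horizontal_part_le[OF inj] diameter_bounded_bound[OF U(2)]] that by blast
      then show ?thesis using False by (auto simp: W_def)
    qed simp
    then have "horizontal_part e ` (\<Union>i. U i) \<subseteq> (\<Union>i. W i)" by (auto simp: subset_iff)
    then have "B \<subseteq> (\<Union>i. W i)"
      using order_trans[OF B image_mono[OF U(1)]] by (rule order_trans[rotated])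
    moreover have W: "W i \<in> sets lborel" for i by (simp add: W_def)
    ultimately have "emeasure lborel B \<le> emeasure lborel (\<Union>i. W i)"
      by (intro emeasure_mono) auto
    also have "\<dots> \<le> (\<Sum>i. emeasure lborel (W i))" using W by (intro emeasure_subadditive_countably) auto
    also have "\<dots> = (\<Sum>i. 2 ^ ?n * hausdorff_gauge ?n (U i))"
    proof (intro suminf_cong)
      fix i
      have "2 ^ ?n * ennreal (unit_ball_vol (real ?n) * (diameter (U i) / 2) ^ ?n)
          = ennreal (2 ^ ?n * (unit_ball_vol (real ?n) * (diameter (U i) / 2) ^ ?n))"
        using diameter_ge_0[OF U(2)] by (simp add: ennreal_mult flip: ennreal_power)
      also have "2 ^ ?n * (unit_ball_vol (real ?n) * (diameter (U i) / 2) ^ ?n) = unit_ball_vol (real ?n) * diameter (U i) ^ ?n"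
        by (simp add: power_divide)
      finally show "emeasure lborel (W i) = 2 ^ ?n * hausdorff_gauge ?n (U i)"
        using diameter_ge_0[OF U(2)] by (simp add: W_def hausdorff_gauge_def emeasure_cball)
    qed
    finally show ?thesis .
  qed
  then have "emeasure lborel B / 2 ^ ?n \<le> hausdorff_pre ?n 1 S"
    unfolding hausdorff_pre_def
    by (intro INF_greatest divide_le_posI_ennreal) (auto simp: zero_less_iff_neq_zero)
  also have "\<dots> \<le> hausdorff_outer ?n S" by (rule hausdorff_pre_le_outer) simp
  finally have "2 ^ ?n * (emeasure lborel B / 2 ^ ?n) \<le> 2 ^ ?n * hausdorff_outer ?n S"
    by (rule mult_left_mono) simp
  then show ?thesis by (simp add: ennreal_times_divide mult_divide_eq_ennreal mult.commute power_eq_top_ennreal)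
qed

lemma hausdorff_outer_translate_le:
  fixes X :: "'a::real_normed_vector set"
  shows "hausdorff_outer n ((+) v ` X) \<le> hausdorff_outer n X"
proof -
  have diam: "diameter ((+) v ` U) = diameter U" for U :: "'a set"
  proof -
    have "(+) v ` U \<times> (+) v ` U = (\<lambda>(x, y). (v + x, v + y)) ` (U \<times> U)" by force
    then show ?thesis by (simp add: diameter_def image_image case_prod_unfold)
  qed
  have gauge: "hausdorff_gauge n ((+) v ` U) = hausdorff_gauge n U" for U :: "'a set"
    by (cases "U = {}") (simp_all add: hausdorff_gauge_def diam)
  have "hausdorff_pre n \<epsilon> ((+) v ` X) \<le> hausdorff_pre n \<epsilon> X" for \<epsilon>
    unfolding hausdorff_pre_def[of n \<epsilon> X]
  proof (rule INF_greatest)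
    fix U :: "nat \<Rightarrow> 'a set"
    assume "U \<in> {U. X \<subseteq> (\<Union>i. U i) \<and> (\<forall>i. bounded (U i) \<and> diameter (U i) \<le> \<epsilon>)}"
    then have U: "X \<subseteq> (\<Union>i. U i)" "\<And>i. bounded (U i)" "\<And>i. diameter (U i) \<le> \<epsilon>" by auto
    then have "(+) v ` X \<subseteq> (\<Union>i. (+) v ` U i)" using image_mono[OF U(1), of "(+) v"] by (simp add: image_UN)
    then have "hausdorff_pre n \<epsilon> ((+) v ` X) \<le> (\<Sum>i. hausdorff_gauge n ((+) v ` U i))"
      unfolding hausdorff_pre_def
      by (intro INF_lower) (simp add: diam bounded_translation U)
    then show "hausdorff_pre n \<epsilon> ((+) v ` X) \<le> (\<Sum>i. hausdorff_gauge n (U i))"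
      unfolding gauge .
  qed
  then show ?thesis unfolding hausdorff_outer_def by (intro SUP_mono') auto
qed

section \<open>Planes and discretised integrals\<close>

definition affine_height :: "real ^ 'd \<Rightarrow> ('n::finite \<Rightarrow> real ^ 'd) \<Rightarrow> real ^ 'n \<Rightarrow> real ^ 'd" where
  "affine_height a v x = a + (\<Sum>i\<in>UNIV. (x $ i) *\<^sub>R v i)"

lemma subspace_vertical_space: "subspace (vertical_space e)"
  by (auto simp: subspace_def vertical_space_def)

lemma affine_height_vertical:
  assumes "a \<in> vertical_space e" "\<And>i. v i \<in> vertical_space e"
  shows "range (affine_height a v) \<subseteq> vertical_space e"
  using assms subspace_vertical_space[of e]
  by (auto simp: affine_height_def intro!: subspace_add subspace_sum subspace_scale)

lemma affine_height_add:
  "affine_height a v (x + y) = affine_height a v x + (\<Sum>i\<in>UNIV. (y $ i) *\<^sub>R v i)"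
  by (simp add: affine_height_def scaleR_left_distrib sum.distrib)

lemma affine_height_lipschitz:
  fixes v :: "'n::finite \<Rightarrow> real ^ 'd::finite"
  assumes "\<And>i. norm (v i) \<le> C"
  shows "norm (affine_height a v x - affine_height a v y) \<le> real CARD('n) * C * norm (x - y)"
proof -
  have C: "0 \<le> C" using assms norm_ge_zero order_trans by blast
  have "affine_height a v x - affine_height a v y = (\<Sum>i\<in>UNIV. ((x - y) $ i) *\<^sub>R v i)"
    by (simp add: affine_height_def scaleR_left_diff_distrib sum_subtractf)
  also have "norm \<dots> \<le> (\<Sum>i::'n\<in>UNIV. norm (x - y) * C)"
    using C component_le_norm_cart[of "x - y"] assms
    by (intro order_trans[OF norm_sum] sum_mono) (auto intro!: mult_mono)
  finally show ?thesis by (simp add: mult_ac)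
qed

text \<open>The graph is a translate of the range of an injective linear map: the entries at
  positions \<open>e i\<close> recover the argument.\<close>

lemma
  fixes e :: "'n::finite \<Rightarrow> 'd::finite"
  assumes inj: "inj e" and a: "a \<in> vertical_space e" "\<And>i. v i \<in> vertical_space e"
  shows affine_graph_affine_height: "affine (graph_of e (affine_height a v))"
    and aff_dim_graph_affine_height: "aff_dim (graph_of e (affine_height a v)) = int CARD('n)"
proof -
  define l where "l x = lift e x + (\<Sum>i\<in>UNIV. (x $ i) *\<^sub>R v i)" for x
  have lin: "linear l"
    by (rule linearI)
      (simp_all add: l_def linear_add[OF linear_lift] linear_scale[OF linear_lift] scaleR_left_distrib
        scaleR_right_distrib sum.distrib scaleR_sum_right)
  have "l x $ e i = x $ i" for x i
    using inj a(2) by (simp add: l_def vertical_space_def)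
  then have injl: "inj l" by (auto simp: inj_def vec_eq_iff) metis
  have eq: "graph_of e (affine_height a v) = (+) a ` range l"
    unfolding graph_of_eq_range[OF inj affine_height_vertical[OF a]]
    by (auto simp: graph_map_def affine_height_def l_def image_image add_ac)
  have sub: "subspace (range l)" using linear_subspace_image[OF lin subspace_UNIV] .
  show "affine (graph_of e (affine_height a v))"
    unfolding eq by (simp add: affine_translation[symmetric] subspace_imp_affine sub)
  have "dim (range l) = CARD('n)" using dim_image_eq[OF lin, of UNIV] injl by (simp add: inj_on_def)
  then show "aff_dim (graph_of e (affine_height a v)) = int CARD('n)"
    unfolding eq by (simp add: aff_dim_translation_eq aff_dim_subspace sub)
qed

text \<open>Dividing heights by the mesh makes the lattice function have slopes bounded
  independently of \<delta>.\<close>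

lemma norm_unit_diff_grid_le:
  fixes A :: "real ^ 'n \<Rightarrow> 'b::real_normed_vector"
  assumes lip: "\<And>x y. norm (A x - A y) \<le> C * norm (x - y)" and \<delta>: "0 < \<delta>"
  shows "norm (unit_diff i (\<lambda>p. A (grid \<delta> p) /\<^sub>R \<delta>) p) \<le> C"
proof -
  have "grid \<delta> (p + axis i 1) - grid \<delta> p = axis i \<delta>"
    by (simp add: grid_def vec_eq_iff axis_def algebra_simps)
  then have "norm (A (grid \<delta> (p + axis i 1)) - A (grid \<delta> p)) \<le> C * \<delta>"
    using lip[of "grid \<delta> (p + axis i 1)" "grid \<delta> p"] \<delta>
    by (simp add: norm_eq_sqrt_inner[of "axis i \<delta>"] inner_axis_axis)
  moreover have "unit_diff i (\<lambda>p. A (grid \<delta> p) /\<^sub>R \<delta>) p = (A (grid \<delta> (p + axis i 1)) - A (grid \<delta> p)) /\<^sub>R \<delta>"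
    by (simp add: unit_diff_def scaleR_right_diff_distrib)
  ultimately show ?thesis
    using \<delta> by (simp add: divide_inverse_commute[symmetric] pos_divide_le_eq)
qed

lemma cell_graph_map_grid:
  assumes "inj e" "A (grid \<delta> p) \<in> vertical_space e" "0 < \<delta>"
  shows "cell e \<delta> (graph_map e A (grid \<delta> p)) = p"
  using assms by (simp add: cell_def graph_map_nth vec_eq_iff) (simp add: grid_def)

text \<open>Translation by a vector of the plane lying over a grid vector preserves the plane and
  carries one cylinder onto the other. Since p and q are arbitrary, equality follows.\<close>

lemma hausdorff_outer_affine_graph_le:
  fixes e :: "'n::finite \<Rightarrow> 'd::finite"
  assumes inj: "inj e" and a: "a \<in> vertical_space e" "\<And>i. v i \<in> vertical_space e" and \<delta>: "0 < \<delta>"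
  shows "hausdorff_outer m (graph_of e (affine_height a v) \<inter> cylinder e \<delta> q)
    \<le> hausdorff_outer m (graph_of e (affine_height a v) \<inter> cylinder e \<delta> p)"
proof -
  let ?L = "graph_of e (affine_height a v)"
  note L = graph_of_eq_range[OF inj affine_height_vertical[OF a]]
  define y where "y = grid \<delta> (p - q)"
  define w where "w = lift e y + (\<Sum>i\<in>UNIV. (y $ i) *\<^sub>R v i)"
  have "(+) w ` (?L \<inter> cylinder e \<delta> q) \<subseteq> ?L \<inter> cylinder e \<delta> p"
  proof
    fix z assume "z \<in> (+) w ` (?L \<inter> cylinder e \<delta> q)"
    then obtain x where x: "z = w + graph_map e (affine_height a v) x"
      "graph_map e (affine_height a v) x \<in> cylinder e \<delta> q"
      unfolding L by blast
    have av: "affine_height a v u \<in> vertical_space e" for u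
      by (rule subsetD[OF affine_height_vertical[OF a] rangeI])
    have z: "z = graph_map e (affine_height a v) (x + y)"
      by (simp add: x(1) graph_map_def affine_height_add w_def linear_add[OF linear_lift])
    then have "z \<in> ?L" unfolding L by blast
    moreover have "z \<in> cylinder e \<delta> p"
      using x(2) \<delta> unfolding z cylinder_iff[OF \<delta>] graph_map_nth[OF inj av]
      by (simp add: y_def grid_def algebra_simps)
    ultimately show "z \<in> ?L \<inter> cylinder e \<delta> p" by blast
  qed
  then have "hausdorff_outer m ((+) w ` (?L \<inter> cylinder e \<delta> q)) \<le> hausdorff_outer m (?L \<inter> cylinder e \<delta> p)"
    by (rule hausdorff_outer_mono)
  moreover have "?L \<inter> cylinder e \<delta> q = (+) (- w) ` ((+) w ` (?L \<inter> cylinder e \<delta> q))"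
    by (simp add: image_image)
  then have "hausdorff_outer m (?L \<inter> cylinder e \<delta> q) \<le> hausdorff_outer m ((+) w ` (?L \<inter> cylinder e \<delta> q))"
    using hausdorff_outer_translate_le[of m "- w" "(+) w ` (?L \<inter> cylinder e \<delta> q)"] by simp
  ultimately show ?thesis by (rule order_trans[rotated])
qed

text \<open>The projection of this piece contains the ball inscribed in the cell. Positivity is
  needed to normalise the mass of a plane.\<close>

lemma hausdorff_outer_graph_pos:
  fixes e :: "'n::finite \<Rightarrow> 'd::finite"
  assumes inj: "inj e" and A: "range A \<subseteq> vertical_space e" and \<delta>: "0 < \<delta>"
  shows "0 < hausdorff_outer CARD('n) (graph_of e A \<inter> cylinder e \<delta> p)"
proof -
  let ?S = "graph_of e A \<inter> cylinder e \<delta> p"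
  define c where "c = grid \<delta> p + (\<chi> i. \<delta> / 2)"
  have Av: "A x \<in> vertical_space e" for x using A by blast
  have "ball c (\<delta> / 2) \<subseteq> horizontal_part e ` ?S"
  proof
    fix x assume x: "x \<in> ball c (\<delta> / 2)"
    have "\<delta> * of_int (p $ i) \<le> x $ i \<and> x $ i < \<delta> * of_int (p $ i) + \<delta>" for i
    proof -
      have "\<bar>(c - x) $ i\<bar> < \<delta> / 2"
        using component_le_norm_cart[of "c - x" i] x by (simp add: dist_norm)
      moreover have "(c - x) $ i = \<delta> * of_int (p $ i) + \<delta> / 2 - x $ i" by (simp add: c_def grid_def)
      ultimately show ?thesis by linarith
    qed
    then have "graph_map e A x \<in> cylinder e \<delta> p"
      unfolding cylinder_iff[OF \<delta>] graph_map_nth[OF inj Av] by blast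
    then have "graph_map e A x \<in> ?S" unfolding graph_of_eq_range[OF inj A] by blast
    then show "x \<in> horizontal_part e ` ?S"
      by (rule rev_image_eqI) (simp add: inj Av)
  qed
  from lborel_le_hausdorff_outer[OF inj this]
  have "emeasure lborel (ball c (\<delta> / 2)) \<le> 2 ^ CARD('n) * hausdorff_outer CARD('n) ?S" .
  moreover have "emeasure lborel (ball c (\<delta> / 2)) \<noteq> 0"
    using content_ball_pos[of "\<delta> / 2" c] \<delta> by (auto simp: measure_def)
  ultimately have "hausdorff_outer CARD('n) ?S \<noteq> 0" by auto
  then show ?thesis by (simp add: zero_less_iff_neq_zero)
qed

text \<open>Over one cell the graph has diameter O(\<delta>), so replacing \<open>f\<close> by its
  value above the corner of the cell costs O(\<delta>) times the mass of the cylinder.\<close>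

lemma integral_graph_discretise:
  fixes e :: "'n::finite \<Rightarrow> 'd::finite" and f :: "real ^ 'd \<Rightarrow> real"
  assumes inj: "inj e" and A: "range A \<subseteq> vertical_space e"
    and lip: "\<And>x y. norm (A x - A y) \<le> C * norm (x - y)" "0 \<le> C" and \<delta>: "0 < \<delta>"
    and \<nu>: "sets \<nu> = sets borel" "AE z in \<nu>. z \<in> graph_of e A"
    and fin: "\<And>p. emeasure \<nu> (cylinder e \<delta> p) = ennreal (m p)" and m: "\<And>p. 0 \<le> m p"
    and f: "1-lipschitz_on UNIV f" and V: "finite V" "\<And>z. cell e \<delta> z \<notin> V \<Longrightarrow> f z = 0"
  shows "\<bar>(\<integral>z. f z \<partial>\<nu>) - (\<Sum>p\<in>V. f (graph_map e A (grid \<delta> p)) * m p)\<bar>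
    \<le> (1 + C) * real CARD('n) * \<delta> * (\<Sum>p\<in>V. m p)"
proof -
  let ?\<epsilon> = "(1 + C) * real CARD('n) * \<delta>"
  define y where "y p = f (graph_map e A (grid \<delta> p))" for p
  have Av: "A x \<in> vertical_space e" for x using A by blast
  have "continuous_on UNIV f" by (rule lipschitz_on_continuous_on[OF f])
  then have fm: "f \<in> borel_measurable \<nu>"
    using borel_measurable_continuous_onI measurable_cong_sets[OF \<nu>(1) refl] by blast
  have cyl: "cylinder e \<delta> p \<in> sets \<nu>" for p by (simp add: \<nu>(1) cylinder_borel)
  have close: "AE z in \<nu>. z \<in> cylinder e \<delta> p \<longrightarrow> \<bar>f z - y p\<bar> \<le> ?\<epsilon>" for p
    using \<nu>(2)
  proof eventually_elim
    case (elim z)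
    show ?case
    proof
      assume z: "z \<in> cylinder e \<delta> p"
      obtain x where x: "z = graph_map e A x" using elim unfolding graph_of_eq_range[OF inj A] by blast
      have "\<bar>x $ i - grid \<delta> p $ i\<bar> \<le> \<delta>" for i
        using z unfolding cylinder_iff[OF \<delta>] x graph_map_nth[OF inj Av] by (simp add: grid_def abs_le_iff) (smt (verit))
      from dist_graph_map_le[OF inj lip this]
      have "dist z (graph_map e A (grid \<delta> p)) \<le> ?\<epsilon>" by (simp add: x dist_norm)
      then show "\<bar>f z - y p\<bar> \<le> ?\<epsilon>"
        using lipschitz_onD[OF f, of z "graph_map e A (grid \<delta> p)"] by (simp add: y_def dist_real_def)
    qed
  qed
  have int_ind: "integrable \<nu> (\<lambda>z. indicator (cylinder e \<delta> p) z * c :: real)" for p c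
    using cyl fin by (intro integrable_mult_left integrable_real_indicator) auto
  \<comment> \<open>Only cylinders are known to have finite mass, so integrability is obtained for
    each piece and not for \<nu> as a whole.\<close>
  have int_f: "integrable \<nu> (\<lambda>z. indicator (cylinder e \<delta> p) z * f z)" for p
  proof -
    have "AE z in \<nu>. z \<in> cylinder e \<delta> p \<longrightarrow> norm (f z) \<le> \<bar>y p\<bar> + ?\<epsilon>"
      using close[of p] by eventually_elim auto
    then have "integrable \<nu> (\<lambda>z. indicator (cylinder e \<delta> p) z *\<^sub>R f z)"
      using cyl fin fm by (intro integrableI_bounded_set_indicator) auto
    then show ?thesis by simp
  qed
  have piece: "\<bar>(\<integral>z. indicator (cylinder e \<delta> p) z * f z \<partial>\<nu>) - y p * m p\<bar> \<le> ?\<epsilon> * m p" for p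
  proof -
    have mp: "measure \<nu> (cylinder e \<delta> p) = m p" using fin m by (simp add: measure_def)
    have c: "(\<integral>z. indicator (cylinder e \<delta> p) z * c \<partial>\<nu>) = c * m p" for c :: real
      using mp sets.sets_into_space[OF cyl, of p] by (simp add: Int_absorb2 mult.commute)
    have "(\<integral>z. indicator (cylinder e \<delta> p) z * f z \<partial>\<nu>) - y p * m p
        = (\<integral>z. indicator (cylinder e \<delta> p) z * f z - indicator (cylinder e \<delta> p) z * y p \<partial>\<nu>)"
      unfolding Bochner_Integration.integral_diff[OF int_f int_ind] c ..
    also have "\<bar>\<dots>\<bar> \<le> (\<integral>z. indicator (cylinder e \<delta> p) z * ?\<epsilon> \<partial>\<nu>)"
    proof -
      have "AE z in \<nu>. norm (indicator (cylinder e \<delta> p) z * f z - indicator (cylinder e \<delta> p) z * y p)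
          \<le> indicator (cylinder e \<delta> p) z * ?\<epsilon>"
        using close[of p] by eventually_elim (auto split: split_indicator)
      then show ?thesis
        unfolding real_norm_def[symmetric]
        by (intro Bochner_Integration.integral_norm_bound[THEN order_trans] integral_mono_AE integrable_norm
            Bochner_Integration.integrable_diff int_f int_ind)
    qed
    also have "\<dots> = ?\<epsilon> * m p" by (rule c)
    finally show ?thesis .
  qed
  have "f z = (\<Sum>p\<in>V. indicator (cylinder e \<delta> p) z * f z)" for z
  proof -
    have "(\<Sum>p\<in>V. indicator (cylinder e \<delta> p) z * f z) = (\<Sum>p\<in>V. if p = cell e \<delta> z then f z else 0)"
      by (intro sum.cong refl) (auto simp: cylinder_def split: split_indicator)
    then show ?thesis using V by (simp add: sum.delta)
  qed
  then have "(\<integral>z. f z \<partial>\<nu>) = (\<integral>z. (\<Sum>p\<in>V. indicator (cylinder e \<delta> p) z * f z) \<partial>\<nu>)"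
    by (intro Bochner_Integration.integral_cong refl)
  also have "\<dots> = (\<Sum>p\<in>V. \<integral>z. indicator (cylinder e \<delta> p) z * f z \<partial>\<nu>)"
    by (rule Bochner_Integration.integral_sum) (rule int_f)
  finally have "(\<integral>z. f z \<partial>\<nu>) - (\<Sum>p\<in>V. y p * m p)
      = (\<Sum>p\<in>V. (\<integral>z. indicator (cylinder e \<delta> p) z * f z \<partial>\<nu>) - y p * m p)"
    by (simp add: sum_subtractf)
  also have "\<bar>\<dots>\<bar> \<le> (\<Sum>p\<in>V. ?\<epsilon> * m p)"
    by (intro order_trans[OF sum_abs] sum_mono piece)
  finally show ?thesis by (simp add: y_def sum_distrib_left)
qed

section \<open>Closed graphs, restricted Hausdorff measure and vertical projection\<close>

lemma linear_vertical_part: "linear (vertical_part e)"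
  by (rule linearI) (auto simp: vertical_part_def vec_eq_iff)

lemma closed_graph_of:
  fixes e :: "'n::finite \<Rightarrow> 'd::finite"
  assumes "continuous_on UNIV A"
  shows "closed (graph_of e A)"
proof -
  have "linear (horizontal_part e)"
    by (rule linearI) (auto simp: horizontal_part_def vec_eq_iff)
  then have h: "continuous_on UNIV (horizontal_part e)"
    using linear_continuous_on linear_conv_bounded_linear by blast
  have v: "continuous_on UNIV (vertical_part e)"
    using linear_vertical_part linear_continuous_on linear_conv_bounded_linear by blast
  have "continuous_on UNIV (\<lambda>z. A (horizontal_part e z))"
    by (rule continuous_on_compose2[OF assms h]) auto
  then show ?thesis unfolding graph_of_def using v by (intro closed_Collect_eq)
qed

lemma vertical_part_vertical: "vertical_part e z \<in> vertical_space e"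
  by (simp add: vertical_part_def vertical_space_def)

lemma vertical_part_eq: "y \<in> vertical_space e \<Longrightarrow> vertical_part e y = y"
  by (auto simp: vertical_part_def vertical_space_def vec_eq_iff)

lemma norm_vertical_part_le: "norm (vertical_part e z) \<le> norm (z :: real ^ 'd::finite)"
  by (rule norm_le_componentwise_cart) (simp add: vertical_part_def)

lemma sets_hausdorff_on [simp]: "sets (hausdorff_on n F) = sets borel"
  by (simp add: hausdorff_on_def)

lemma emeasure_hausdorff_on:
  assumes "F \<in> sets borel" "X \<in> sets borel"
  shows "emeasure (hausdorff_on n F) X = hausdorff_outer n (F \<inter> X)"
proof -
  have "emeasure (hausdorff_on n F) X = (\<integral>\<^sup>+z. indicator F z * indicator X z \<partial>hausdorff_measure n)"
    using assms unfolding hausdorff_on_def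
    by (subst emeasure_density) (auto intro!: borel_measurable_indicator)
  also have "\<dots> = (\<integral>\<^sup>+z. indicator (F \<inter> X) z \<partial>hausdorff_measure n)" by (simp add: indicator_inter_arith)
  also have "\<dots> = hausdorff_outer n (F \<inter> X)"
    using assms by (simp add: emeasure_hausdorff_measure)
  finally show ?thesis .
qed

lemma diameter_cube_le:
  fixes w :: "real ^ 'd::finite"
  assumes "0 \<le> s"
  shows "diameter (cube w s) \<le> real CARD('d) * s"
proof (rule diameter_le)
  fix x y assume "x \<in> cube w s" "y \<in> cube w s"
  then have "\<bar>(x - y) $ i\<bar> \<le> s" for i
  proof -
    have "\<bar>x $ i - w $ i\<bar> \<le> s / 2" "\<bar>y $ i - w $ i\<bar> \<le> s / 2"
      using \<open>x \<in> cube w s\<close> \<open>y \<in> cube w s\<close> unfolding cube_def by blast+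
    then show ?thesis unfolding vector_minus_component by linarith
  qed
  then show "norm (x - y) \<le> real CARD('d) * s" by (rule norm_le_of_components)
qed (use assms in simp)

text \<open>All cylinders cut the same mass out of the plane, and this mass is finite and positive,
  so one factor gives each of them the prescribed mass exactly. The discretised plane measure is
  therefore a constant density.\<close>

lemma exists_plane_measure:
  fixes e :: "'n::finite \<Rightarrow> 'd::finite"
  assumes inj: "inj e" and a: "a \<in> vertical_space e" "\<And>i. v i \<in> vertical_space e"
    and \<delta>: "0 < \<delta>" and m: "0 \<le> m"
  shows "\<exists>c\<ge>0. \<forall>p. emeasure (scale_measure (ennreal c)
    (hausdorff_on CARD('n) (graph_of e (affine_height a v)))) (cylinder e \<delta> p) = ennreal m"
proof -
  let ?L = "graph_of e (affine_height a v)" and ?n = "CARD('n)"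
  have Av: "range (affine_height a v) \<subseteq> vertical_space e" by (rule affine_height_vertical[OF a])
  define B where "B = Max (range (\<lambda>i. norm (v i)))"
  have "norm (v i) \<le> B" for i unfolding B_def by (rule Max_ge) auto
  then have vB: "norm (affine_height a v x - affine_height a v y) \<le> real ?n * B * norm (x - y)" for x y
    by (rule affine_height_lipschitz)
  have B0: "0 \<le> real ?n * B"
    using order_trans[OF norm_ge_zero \<open>\<And>i. norm (v i) \<le> B\<close>] by simp
  have "continuous_on UNIV (affine_height a v)"
    unfolding affine_height_def[abs_def] by (intro continuous_intros)
  then have L: "?L \<in> sets borel" by (intro borel_closed closed_graph_of)
  have "hausdorff_outer ?n (?L \<inter> cylinder e \<delta> 0) < top"
    using hausdorff_outer_graph_le[OF inj Av vB B0 \<delta>] by (rule order_le_less_trans) simp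
  then obtain \<kappa> where \<kappa>: "0 \<le> \<kappa>" "hausdorff_outer ?n (?L \<inter> cylinder e \<delta> 0) = ennreal \<kappa>"
    by (auto simp: less_top_ennreal)
  have "0 < \<kappa>" using hausdorff_outer_graph_pos[OF inj Av \<delta>, where p = 0] \<kappa> by simp
  have eq: "hausdorff_outer ?n (?L \<inter> cylinder e \<delta> p) = ennreal \<kappa>" for p
    unfolding \<kappa>(2)[symmetric]
    by (rule antisym; rule hausdorff_outer_affine_graph_le[where v = v, OF inj a \<delta>])
  have pos: "0 \<le> m / \<kappa>" using \<open>0 < \<kappa>\<close> m by simp
  have mult: "ennreal (m / \<kappa>) * ennreal \<kappa> = ennreal m"
    using ennreal_mult[OF pos \<kappa>(1)] \<open>0 < \<kappa>\<close> by simp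
  show ?thesis
  proof (intro exI[of _ "m / \<kappa>"] conjI allI pos)
    fix p
    show "emeasure (scale_measure (ennreal (m / \<kappa>)) (hausdorff_on ?n ?L)) (cylinder e \<delta> p) = ennreal m"
      unfolding emeasure_scale_measure emeasure_hausdorff_on[OF L cylinder_borel] eq by (rule mult)
  qed
qed

lemma floor_diff_le:
  fixes x y :: real
  assumes "\<bar>x - y\<bar> \<le> of_int m"
  shows "\<bar>\<lfloor>x\<rfloor> - \<lfloor>y\<rfloor>\<bar> \<le> m + 1"
proof -
  have "of_int \<lfloor>x\<rfloor> \<le> x" "x < of_int \<lfloor>x\<rfloor> + 1" "of_int \<lfloor>y\<rfloor> \<le> y" "y < of_int \<lfloor>y\<rfloor> + 1" by linarith+
  then have "real_of_int \<bar>\<lfloor>x\<rfloor> - \<lfloor>y\<rfloor>\<bar> < of_int (m + 2)" using assms by simp linarith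
  then show ?thesis by (simp only: of_int_less_iff)
qed

section \<open>The coefficient of a single cube\<close>

text \<open>The test functions for a cube of side \<open>\<delta> * 2 ^ k\<close> live in a ball of radius at most
  \<open>3 * CARD('d) * \<delta> * 2 ^ k\<close>, hence in a window of radius \<open>window_radius * 2 ^ k\<close>; the second radius
  leaves room for the averages and the Poincare inequalities.\<close>

definition window_radius :: "'d itself \<Rightarrow> nat" where
  "window_radius _ = 3 * CARD('d) + 1"

definition haar_radius :: "'n itself \<Rightarrow> 'd itself \<Rightarrow> nat" where
  "haar_radius _ _ = 9 * window_radius TYPE('d) + 2 * CARD('n) + 3"

text \<open>The competing plane is the graph of the affine map from \<open>discrete_beta\<close>, projected to the vertical
  space because its coefficients are only known as vectors of the ambient space.\<close>

lemma alpha_le: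
  fixes C D :: real
  assumes C: "0 \<le> C" and D: "0 \<le> D"
  shows "\<exists>E\<ge>0. \<forall>(e :: 'n::finite \<Rightarrow> 'd::finite) A \<mu> \<delta> m k w.
    inj e \<longrightarrow> range A \<subseteq> vertical_space e \<longrightarrow> (\<forall>x y. norm (A x - A y) \<le> C * norm (x - y)) \<longrightarrow>
    0 < \<delta> \<longrightarrow> sets \<mu> = sets borel \<longrightarrow> (AE z in \<mu>. z \<in> graph_of e A) \<longrightarrow>
    (\<forall>p. emeasure \<mu> (cylinder e \<delta> p) = ennreal (\<delta> ^ CARD('n) * m p) \<and> 0 \<le> m p \<and> m p \<le> D) \<longrightarrow>
    alpha CARD('n) \<mu> w (\<delta> * 2 ^ k) \<le> ennreal (E *
      ((\<Sum>j\<le>k. 2 ^ j * (\<Sum>x\<in>window (cell e \<delta> w) (int (haar_radius TYPE('n) TYPE('d)) * 2 ^ k).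
          haar_total m (\<lambda>p. A (grid \<delta> p) /\<^sub>R \<delta>) j x)) / 2 ^ (k * (CARD('n) + 1)) + 1 / 2 ^ k))"
proof -
  let ?n = "CARD('n)" and ?M = "window_radius TYPE('d)" and ?N = "haar_radius TYPE('n) TYPE('d)"
  define c\<^sub>a where "c\<^sub>a = 1 + real (2 * ?M + 1) * 2 ^ ?n * (4 * ?M * ?n)"
  define c\<^sub>b where "c\<^sub>b = 1 + 2 ^ ?n * (2 * ?M * ?n) * (2 ^ ?n * (12 * ?M * ?n))"
  define c\<^sub>d where "c\<^sub>d = ((1 + C) * ?n + (1 + ?n * C) * ?n) * D * (3 * real ?M) ^ ?n"
  \<comment> \<open>The three terms come from the distance of \<open>A\<close> to the plane, from
    the distance of the density to a constant, and from the discretisation of both integrals. Their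
    Lipschitz constants enter \<open>c\<^sub>d\<close> as C for \<open>A\<close> and n C for the
    plane.\<close>
  define E where "E = D * c\<^sub>b + (?n + C) * c\<^sub>a + c\<^sub>d"
  have pos: "0 \<le> c\<^sub>a" "0 \<le> c\<^sub>d" using C D by (auto simp: c\<^sub>a_def c\<^sub>d_def)
  have E: "0 \<le> E" using C D pos by (simp add: E_def)
  show ?thesis
  proof (intro exI[of _ E] conjI E allI impI)
    fix e :: "'n \<Rightarrow> 'd" and A \<mu> \<delta> m k w
    assume inj: "inj e" and A: "range A \<subseteq> vertical_space e"
      and lip: "\<forall>x y. norm (A x - A y) \<le> C * norm (x - y)" and \<delta>: "0 < \<delta>"
      and \<mu>: "sets \<mu> = sets borel" "AE z in \<mu>. z \<in> graph_of e A"
      and m: "\<forall>p. emeasure \<mu> (cylinder e \<delta> p) = ennreal (\<delta> ^ ?n * m p) \<and> 0 \<le> m p \<and> m p \<le> D"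
    let ?s = "\<delta> * 2 ^ k"
    define q where "q = cell e \<delta> w"
    define r where "r = int ?M * 2 ^ k"
    define A' where "A' = (\<lambda>p. A (grid \<delta> p) /\<^sub>R \<delta>)"
    define R where "R = int ?N * 2 ^ k"
    define W where "W = window q r"
    define X where "X = (\<Sum>j\<le>k. 2 ^ j * (\<Sum>x\<in>window q R. haar_total m A' j x))"
    have X: "X = haar_mass k q R m + (\<Sum>i\<in>UNIV. haar_mass k q R (unit_diff i A'))"
      by (simp add: X_def haar_mass_eq_haar_total)
    define H\<^sub>g where "H\<^sub>g = haar_mass k q R m"
    define H\<^sub>A where "H\<^sub>A = (\<Sum>i\<in>UNIV. haar_mass k q R (unit_diff i A'))"
    have H0: "0 \<le> H\<^sub>g" "0 \<le> H\<^sub>A" by (auto simp: H\<^sub>g_def H\<^sub>A_def haar_mass_nonneg sum_nonneg)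
    have Av: "A x \<in> vertical_space e" for x using A by blast
    have m0: "0 \<le> m p" "m p \<le> D" for p using m by auto
    have lipA': "norm (unit_diff i A' p) \<le> C" for i p
      unfolding A'_def by (rule norm_unit_diff_grid_le[OF lip[rule_format] \<delta>])
    have "(3 * int ?M + 2 * int ?n + 3) * 2 ^ k \<le> R"
      unfolding R_def by (intro mult_right_mono) (auto simp: haar_radius_def)
    from discrete_alpha[where g = m, OF m0 r_def this, of q]
    obtain c where c: "0 \<le> c" "c \<le> D"
      and alpha: "\<forall>h \<kappa>. (\<forall>x. x \<notin> W \<longrightarrow> h x = 0) \<longrightarrow> (\<forall>i x. \<bar>h (x + axis i 1) - h x\<bar> \<le> \<kappa>) \<longrightarrow>
        \<bar>\<Sum>x\<in>W. h x * (m x - c)\<bar> \<le> \<kappa> * (c\<^sub>a * H\<^sub>g)"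
      unfolding c\<^sub>a_def[symmetric] H\<^sub>g_def[symmetric] W_def[symmetric] by (elim exE conjE) (rule that)
    have "(9 * int ?M + 2 * int ?n + 3) * 2 ^ k \<le> R"
      unfolding R_def by (intro mult_right_mono) (auto simp: haar_radius_def)
    from discrete_beta[where A = A', OF lipA' r_def this, of q]
    obtain a' v' where v': "\<forall>i. norm (v' i) \<le> C"
      and beta: "(\<Sum>x\<in>W. norm (A' x - (a' + (\<Sum>i\<in>UNIV. of_int (x $ i) *\<^sub>R v' i)))) \<le> c\<^sub>b * H\<^sub>A"
      unfolding c\<^sub>b_def[symmetric] H\<^sub>A_def[symmetric] W_def[symmetric] by (elim exE conjE) (rule that)
    let ?u = "\<lambda>p. A' p - (a' + (\<Sum>i\<in>UNIV. of_int (p $ i) *\<^sub>R v' i))"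
    \<comment> \<open>\<open>discrete_beta\<close> was applied to heights divided by \<delta>.
      Scaling back multiplies the base height by \<delta> and leaves the slopes unchanged.\<close>
    define a where "a = \<delta> *\<^sub>R vertical_part e a'"
    define v where "v i = vertical_part e (v' i)" for i
    have av: "a \<in> vertical_space e" "\<And>i. v i \<in> vertical_space e"
      by (auto simp: a_def v_def vertical_part_vertical subspace_scale[OF subspace_vertical_space])
    define P where "P = affine_height a v"
    have Pv: "range P \<subseteq> vertical_space e" unfolding P_def by (rule affine_height_vertical[OF av])
    have Pvx: "P x \<in> vertical_space e" for x using Pv by blast
    have vC: "norm (v i) \<le> C" for i
      using order_trans[OF norm_vertical_part_le[of e "v' i"] v'[rule_format]] by (simp add: v_def)
    have lipP: "norm (P x - P y) \<le> real ?n * C * norm (x - y)" for x y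
      unfolding P_def by (rule affine_height_lipschitz[OF vC])
    have P_grid: "norm (A (grid \<delta> p) - P (grid \<delta> p)) \<le> \<delta> * norm (?u p)" for p
    proof -
      note lin = linear_vertical_part[of e]
      have "A (grid \<delta> p) = vertical_part e (\<delta> *\<^sub>R A' p)"
        using vertical_part_eq[OF Av] \<delta> by (simp add: A'_def)
      moreover have "P (grid \<delta> p) = vertical_part e (\<delta> *\<^sub>R (a' + (\<Sum>i\<in>UNIV. of_int (p $ i) *\<^sub>R v' i)))"
        by (simp add: P_def affine_height_def a_def v_def grid_def linear_add[OF lin] linear_scale[OF lin]
            linear_sum[OF lin] scaleR_right_distrib scaleR_sum_right)
      ultimately have "A (grid \<delta> p) - P (grid \<delta> p) = vertical_part e (\<delta> *\<^sub>R ?u p)"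
        by (simp only: linear_diff[OF lin, symmetric] scaleR_right_diff_distrib)
      then show ?thesis using norm_vertical_part_le[of e "\<delta> *\<^sub>R ?u p"] \<delta> by simp
    qed
    define L where "L = graph_of e P"
    have Lplane: "affine L" "aff_dim L = int ?n"
      unfolding L_def P_def by (auto intro: affine_graph_affine_height aff_dim_graph_affine_height inj av)
    have "0 \<le> \<delta> ^ ?n * c" using c(1) \<delta> by simp
    from exists_plane_measure[where v = v, OF inj av \<delta> this]
    obtain c' where c': "0 \<le> c'"
      "\<forall>p. emeasure (scale_measure (ennreal c') (hausdorff_on ?n L)) (cylinder e \<delta> p) = ennreal (\<delta> ^ ?n * c)"
      unfolding P_def[symmetric] L_def[symmetric] by (elim exE conjE) (rule that)
    define \<nu> where "\<nu> = scale_measure (ennreal c') (hausdorff_on ?n L)"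
    have \<nu>sets: "sets \<nu> = sets borel" by (simp add: \<nu>_def)
    have "continuous_on UNIV P" unfolding P_def affine_height_def[abs_def] by (intro continuous_intros)
    then have Lb: "L \<in> sets borel" unfolding L_def by (intro borel_closed closed_graph_of)
    have \<nu>L: "AE z in \<nu>. z \<in> L"
    proof (subst AE_iff_measurable[of "- L"])
      show "- L \<in> sets \<nu>" using Lb by (simp add: \<nu>sets)
      show "{x \<in> space \<nu>. x \<notin> L} = - L" using sets_eq_imp_space_eq[OF \<nu>sets] by auto
      show "emeasure \<nu> (- L) = 0" using Lb by (simp add: \<nu>_def emeasure_hausdorff_on)
    qed
    \<comment> \<open>The factor \<open>\<delta> ^ ?n\<close> converts normalised densities to
      masses and the further \<delta> lattice distances to lengths; both cancel against the power of
      the side length in \<open>alpha\<close>.\<close>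
    let ?E = "\<delta> ^ ?n * \<delta> * (D * (c\<^sub>b * H\<^sub>A) + (?n + C) * (c\<^sub>a * H\<^sub>g) + c\<^sub>d * 2 ^ (k * ?n))"
    have f_est: "\<bar>(\<integral>z. f z \<partial>\<mu>) - (\<integral>z. f z \<partial>\<nu>)\<bar> \<le> ?E"
      if f: "1-lipschitz_on UNIV f" and supp: "closure {z. f z \<noteq> 0} \<subseteq> cball w (3 * diameter (cube w ?s))" for f
    proof -
      \<comment> \<open>The ball has radius at most 3 d \<delta> 2^k, and rounding to cells can add
        one more unit. This unit is the 1 in \<open>window_radius\<close>.\<close>
      have f0: "f z = 0" if "cell e \<delta> z \<notin> W" for z
      proof (rule ccontr)
        assume "f z \<noteq> 0"
        then have "z \<in> cball w (3 * diameter (cube w ?s))"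
          by (intro subsetD[OF supp] subsetD[OF closure_subset]) simp
        then have "norm (z - w) \<le> 3 * (real CARD('d) * ?s)"
          using diameter_cube_le[of ?s w] \<delta> by (simp add: dist_norm norm_minus_commute)
        then have "\<bar>z $ j - w $ j\<bar> \<le> 3 * (real CARD('d) * ?s)" for j
          using component_le_norm_cart[of "z - w" j] by simp
        then have "\<bar>z $ j / \<delta> - w $ j / \<delta>\<bar> \<le> of_int (3 * int CARD('d) * 2 ^ k)" for j
          using \<delta> by (simp add: diff_divide_distrib[symmetric] divide_le_eq mult_ac)
        then have "\<bar>cell e \<delta> z $ i - q $ i\<bar> \<le> 3 * int CARD('d) * 2 ^ k + 1" for i
          unfolding q_def cell_def by (simp add: floor_diff_le)
        moreover have "3 * int CARD('d) * 2 ^ k + 1 \<le> r"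
          by (simp add: r_def window_radius_def distrib_right)
        ultimately have "\<bar>cell e \<delta> z $ i - q $ i\<bar> \<le> r" for i by (rule order_trans)
        then have "cell e \<delta> z \<in> W" by (simp add: W_def window_def)
        then show False using that by blast
      qed
      define y where "y p = f (graph_map e A (grid \<delta> p))" for p
      define h where "h p = f (graph_map e P (grid \<delta> p))" for p
      have fin: "finite W" by (simp add: W_def)
      have 1: "\<bar>(\<integral>z. f z \<partial>\<mu>) - (\<Sum>p\<in>W. y p * (\<delta> ^ ?n * m p))\<bar>
          \<le> (1 + C) * real ?n * \<delta> * (\<Sum>p\<in>W. \<delta> ^ ?n * m p)"
        unfolding y_def using lip C m \<delta>
        by (intro integral_graph_discretise[OF inj A _ _ \<delta> \<mu> _ _ f fin f0]) auto
      have 2: "\<bar>(\<integral>z. f z \<partial>\<nu>) - (\<Sum>p\<in>W. h p * (\<delta> ^ ?n * c))\<bar>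
          \<le> (1 + real ?n * C) * real ?n * \<delta> * (\<Sum>p\<in>W. \<delta> ^ ?n * c)"
        unfolding h_def
        by (rule integral_graph_discretise[OF inj Pv lipP _ \<delta> \<nu>sets \<nu>L[unfolded L_def] _ _ f fin f0])
          (use C c(1) \<delta> c'(2) in \<open>auto simp: \<nu>_def\<close>)
      have hsupp: "h p = 0" if "p \<notin> W" for p
        unfolding h_def by (rule f0) (simp add: cell_graph_map_grid[where A = P, OF inj Pvx \<delta>] that)
      \<comment> \<open>A grid step in direction i moves the point of the plane by at most n
        \<delta> horizontally, by the crude \<open>norm_lift_le\<close>, and by C \<delta>
        vertically.\<close>
      have hlip: "\<bar>h (p + axis i 1) - h p\<bar> \<le> (?n + C) * \<delta>" for i p
      proof -
        have g: "grid \<delta> (p + axis i 1) = grid \<delta> p + axis i \<delta>"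
          by (simp add: grid_def vec_eq_iff axis_def algebra_simps)
        have "graph_map e P (grid \<delta> (p + axis i 1)) - graph_map e P (grid \<delta> p)
            = lift e (axis i \<delta>) + (\<Sum>j\<in>UNIV. (axis i \<delta> $ j) *\<^sub>R v j)"
          unfolding graph_map_def P_def g affine_height_add linear_add[OF linear_lift] by simp
        also have "(\<Sum>j\<in>UNIV. (axis i \<delta> $ j) *\<^sub>R v j) = \<delta> *\<^sub>R v i"
        proof -
          have "(\<Sum>j\<in>UNIV. (axis i \<delta> $ j) *\<^sub>R v j) = (\<Sum>j\<in>UNIV. if j = i then \<delta> *\<^sub>R v j else 0)"
            by (intro sum.cong refl) (simp add: axis_def)
          then show ?thesis by simp
        qed
        finally have "norm (graph_map e P (grid \<delta> (p + axis i 1)) - graph_map e P (grid \<delta> p))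
            \<le> norm (lift e (axis i \<delta>)) + norm (\<delta> *\<^sub>R v i)"
          by (simp only: norm_triangle_ineq)
        also have "\<dots> \<le> ?n * \<delta> + C * \<delta>"
          using norm_lift_le[OF inj, of "axis i \<delta>" \<delta>] vC[of i] \<delta> by (intro add_mono) (auto simp: axis_def)
        finally show ?thesis
          using lipschitz_onD[OF f, of "graph_map e P (grid \<delta> (p + axis i 1))" "graph_map e P (grid \<delta> p)"]
          by (simp add: h_def dist_norm algebra_simps)
      qed
      have 3: "\<bar>\<Sum>p\<in>W. h p * (m p - c)\<bar> \<le> (?n + C) * \<delta> * (c\<^sub>a * H\<^sub>g)"
        by (rule alpha[rule_format, OF hsupp hlip])
      \<comment> \<open>Both graphs are evaluated over the same grid point, so \<open>y\<close> and
        \<open>h\<close> differ by at most the vertical distance, which \<open>discrete_beta\<close>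
        bounds in L1.\<close>
      have 4: "\<bar>\<Sum>p\<in>W. (y p - h p) * m p\<bar> \<le> D * (\<delta> * (c\<^sub>b * H\<^sub>A))"
      proof -
        have "\<bar>(y p - h p) * m p\<bar> \<le> D * (\<delta> * norm (?u p))" for p
        proof -
          have "\<bar>y p - h p\<bar> \<le> norm (A (grid \<delta> p) - P (grid \<delta> p))"
            using lipschitz_onD[OF f, of "graph_map e A (grid \<delta> p)" "graph_map e P (grid \<delta> p)"]
            by (simp add: y_def h_def dist_norm graph_map_def)
          then have "\<bar>y p - h p\<bar> * m p \<le> (\<delta> * norm (?u p)) * D"
            using P_grid[of p] m0[of p] \<delta> by (intro mult_mono) auto
          then show ?thesis using m0[of p] by (simp add: abs_mult mult.commute)
        qed
        then have "\<bar>\<Sum>p\<in>W. (y p - h p) * m p\<bar>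
            \<le> (\<Sum>p\<in>W. D * (\<delta> * norm (?u p)))"
          by (intro order_trans[OF sum_abs] sum_mono)
        also have "\<dots> = D * (\<delta> * (\<Sum>p\<in>W. norm (?u p)))"
          by (simp add: sum_distrib_left)
        also have "\<dots> \<le> D * (\<delta> * (c\<^sub>b * H\<^sub>A))" using beta D \<delta> by (intro mult_left_mono) auto
        finally show ?thesis .
      qed
      have card: "real (card W) \<le> (3 * real ?M) ^ ?n * 2 ^ (k * ?n)"
        unfolding W_def r_def by (rule card_window_scale_le) (simp add: window_radius_def)
      have mass: "(\<Sum>p\<in>W. \<delta> ^ ?n * b p) \<le> \<delta> ^ ?n * (D * ((3 * real ?M) ^ ?n * 2 ^ (k * ?n)))"
        if "\<And>p. b p \<le> D" for b
      proof -
        have "(\<Sum>p\<in>W. b p) \<le> real (card W) * D" using sum_bounded_above[of W b D] that by simp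
        also have "\<dots> \<le> ((3 * real ?M) ^ ?n * 2 ^ (k * ?n)) * D" by (rule mult_right_mono[OF card D])
        finally have "(\<Sum>p\<in>W. b p) \<le> D * ((3 * real ?M) ^ ?n * 2 ^ (k * ?n))" by (simp only: mult_ac)
        then show ?thesis
          unfolding sum_distrib_left[symmetric] by (rule mult_left_mono) (use \<delta> in simp)
      qed
      let ?K = "\<delta> ^ ?n * (D * ((3 * real ?M) ^ ?n * 2 ^ (k * ?n)))"
      have 5: "(1 + C) * real ?n * \<delta> * (\<Sum>p\<in>W. \<delta> ^ ?n * m p) \<le> (1 + C) * real ?n * \<delta> * ?K"
        using C \<delta> by (intro mult_left_mono mass m0) auto
      have 6: "(1 + real ?n * C) * real ?n * \<delta> * (\<Sum>p\<in>W. \<delta> ^ ?n * c) \<le> (1 + real ?n * C) * real ?n * \<delta> * ?K"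
        using C \<delta> by (intro mult_left_mono mass c(2)) auto
      \<comment> \<open>The discrete integrals differ through y m - h c = (y - h) m + h (m - c):
        first the graph is moved to the plane, then the density is replaced by the constant.\<close>
      have 7: "\<bar>(\<Sum>p\<in>W. y p * (\<delta> ^ ?n * m p)) - (\<Sum>p\<in>W. h p * (\<delta> ^ ?n * c))\<bar>
          \<le> \<delta> ^ ?n * (D * (\<delta> * (c\<^sub>b * H\<^sub>A)) + (?n + C) * \<delta> * (c\<^sub>a * H\<^sub>g))"
      proof -
        have "(\<Sum>p\<in>W. y p * (\<delta> ^ ?n * m p)) - (\<Sum>p\<in>W. h p * (\<delta> ^ ?n * c))
            = \<delta> ^ ?n * ((\<Sum>p\<in>W. (y p - h p) * m p) + (\<Sum>p\<in>W. h p * (m p - c)))"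
          unfolding sum.distrib[symmetric] sum_subtractf[symmetric] sum_distrib_left
          by (intro sum.cong refl) (simp add: algebra_simps)
        also have "\<bar>\<dots>\<bar> = \<delta> ^ ?n * \<bar>(\<Sum>p\<in>W. (y p - h p) * m p) + (\<Sum>p\<in>W. h p * (m p - c))\<bar>"
          using \<delta> by (simp add: abs_mult)
        also have "\<dots> \<le> \<delta> ^ ?n * (D * (\<delta> * (c\<^sub>b * H\<^sub>A)) + (?n + C) * \<delta> * (c\<^sub>a * H\<^sub>g))"
          using 3 4 \<delta> by (intro mult_left_mono) auto
        finally show ?thesis .
      qed
      have "?E = \<delta> ^ ?n * (D * (\<delta> * (c\<^sub>b * H\<^sub>A)) + (?n + C) * \<delta> * (c\<^sub>a * H\<^sub>g))
          + ((1 + C) * real ?n * \<delta> * ?K + (1 + real ?n * C) * real ?n * \<delta> * ?K)"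
        by (simp add: c\<^sub>d_def algebra_simps)
      then show ?thesis using 1 2 5 6 7 by linarith
    qed
    have "lip_dist (cball w (3 * diameter (cube w ?s))) \<mu> \<nu> \<le> ennreal ?E"
      unfolding lip_dist_def by (intro SUP_least ennreal_leI f_est) auto
    then have inf: "(INF (c, L) \<in> {(c :: real, L). 0 \<le> c \<and> affine L \<and> aff_dim L = int ?n}.
              lip_dist (cball w (3 * diameter (cube w ?s))) \<mu>
                (scale_measure (ennreal c) (hausdorff_on ?n L))) \<le> ennreal ?E"
      using c'(1) Lplane by (intro INF_lower2[of "(c', L)"]) (auto simp: \<nu>_def)
    have E0: "0 \<le> ?E" using C D H0 pos \<delta> by simp
    have "alpha ?n \<mu> w ?s \<le> ennreal ?E / ennreal (?s ^ (?n + 1))"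
      unfolding alpha_def using inf by (auto intro: divide_right_mono_ennreal)
    also have "\<dots> = ennreal (?E / ?s ^ (?n + 1))"
      using \<delta> E0 by (intro divide_ennreal) auto
    also have "\<dots> \<le> ennreal (E * (X / 2 ^ (k * (?n + 1)) + 1 / 2 ^ k))"
    proof (rule ennreal_leI)
      have s: "?s ^ (?n + 1) = \<delta> ^ ?n * \<delta> * 2 ^ (k * (?n + 1))"
        by (simp add: power_mult_distrib power_add power_mult)
      have "?E / ?s ^ (?n + 1)
          = (D * (c\<^sub>b * H\<^sub>A) + (?n + C) * (c\<^sub>a * H\<^sub>g) + c\<^sub>d * 2 ^ (k * ?n)) / 2 ^ (k * (?n + 1))"
        unfolding s using \<delta> by simp
      also have "\<dots> \<le> (E * (H\<^sub>g + H\<^sub>A) + E * 2 ^ (k * ?n)) / 2 ^ (k * (?n + 1))"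
      proof (intro divide_right_mono add_mono)
        have "D * c\<^sub>b \<le> E" "(?n + C) * c\<^sub>a \<le> E" "c\<^sub>d \<le> E"
          using C D pos by (auto simp: E_def)
        then have "(D * c\<^sub>b) * H\<^sub>A \<le> E * H\<^sub>A" "((?n + C) * c\<^sub>a) * H\<^sub>g \<le> E * H\<^sub>g"
          using H0 by (auto intro: mult_right_mono)
        then show "D * (c\<^sub>b * H\<^sub>A) + (?n + C) * (c\<^sub>a * H\<^sub>g) \<le> E * (H\<^sub>g + H\<^sub>A)"
          by (simp add: algebra_simps)
        show "c\<^sub>d * 2 ^ (k * ?n) \<le> E * 2 ^ (k * ?n)"
          using \<open>c\<^sub>d \<le> E\<close> by (intro mult_right_mono) auto
      qed simp
      also have "\<dots> = E * (X / 2 ^ (k * (?n + 1)) + 1 / 2 ^ k)"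
        unfolding X H\<^sub>g_def[symmetric] H\<^sub>A_def[symmetric] by (simp add: power_add field_simps)
      finally show "?E / ?s ^ (?n + 1) \<le> E * (X / 2 ^ (k * (?n + 1)) + 1 / 2 ^ k)" .
    qed
    finally show "alpha ?n \<mu> w ?s \<le> ennreal (E *
      ((\<Sum>j\<le>k. 2 ^ j * (\<Sum>x\<in>window (cell e \<delta> w) (int ?N * 2 ^ k). haar_total m (\<lambda>p. A (grid \<delta> p) /\<^sub>R \<delta>) j x))
          / 2 ^ (k * (?n + 1)) + 1 / 2 ^ k))"
      unfolding X_def q_def R_def A'_def .
  qed
qed

section \<open>Summation over dyadic cubes\<close>

text \<open>Gives a dyadic side, a lattice of centers with spacing equal to that side, and
  containment in the initial cube. Halving maps the lattice index t to 2t or 2t+1.\<close>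

lemma dyadic_cubes_cases:
  assumes "(w, s) \<in> dyadic_cubes z l"
  shows "\<exists>m. s = l / 2 ^ m \<and> (\<forall>i. \<exists>t::int. w $ i = z $ i - l / 2 + s / 2 + s * of_int t)
    \<and> (\<forall>i. \<bar>w $ i - z $ i\<bar> \<le> l / 2 - s / 2)"
  using assms
proof induction
  case 1
  show ?case by (intro exI[of _ 0] conjI allI exI[of _ "0::int"]) auto
next
  case (2 w s w')
  then obtain m where m: "s = l / 2 ^ m" by blast
  have "\<exists>t::int. w' $ i = z $ i - l / 2 + s / 2 / 2 + s / 2 * of_int t" for i
  proof -
    obtain t :: int where t: "w $ i = z $ i - l / 2 + s / 2 + s * of_int t" using 2 by blast
    have "w' $ i - w $ i = s / 4 \<or> w' $ i - w $ i = - (s / 4)" using 2(2)[of i] by (auto simp: abs_if split: if_splits)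
    then show ?thesis
    proof
      assume "w' $ i - w $ i = s / 4"
      then show ?thesis using t by (intro exI[of _ "2 * t + 1"]) (simp add: algebra_simps)
    next
      assume "w' $ i - w $ i = - (s / 4)"
      then show ?thesis using t by (intro exI[of _ "2 * t"]) (simp add: algebra_simps)
    qed
  qed
  moreover have "\<bar>w' $ i - z $ i\<bar> \<le> l / 2 - s / 2 / 2" for i
  proof -
    have "\<bar>w $ i - z $ i\<bar> \<le> l / 2 - s / 2" using 2 by blast
    then show ?thesis using 2(2)[of i] by linarith
  qed
  ultimately show ?case using m by (intro exI[of _ "Suc m"]) auto
qed

lemma cube_borel [measurable]: "cube w s \<in> sets borel"
proof -
  have "cube w s = (\<Inter>i. {x. \<bar>x $ i - w $ i\<bar> \<le> s / 2})" by (auto simp: cube_def)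
  moreover have "closed {x. \<bar>x $ i - w $ i\<bar> \<le> s / 2}" for i
    by (intro closed_Collect_le continuous_intros)
  ultimately show ?thesis by (auto intro!: borel_closed)
qed

text \<open>Closed cubes share faces, so they overlap boundedly rather than being disjoint.
  Comparing rounded lattice coordinates leaves at most 5 values per coordinate, which is crude but
  sufficient.\<close>

lemma card_lattice_cubes_le:
  fixes b z :: "real ^ 'd::finite"
  assumes s: "0 < s" and lat: "\<And>w. w \<in> F \<Longrightarrow> \<forall>i. \<exists>t::int. w $ i = b $ i + s * of_int t"
  shows "card {w \<in> F. z \<in> cube w s} \<le> 5 ^ CARD('d)"
proof -
  define \<tau> :: "real ^ 'd \<Rightarrow> int ^ 'd" where "\<tau> w = (\<chi> i. \<lfloor>(w $ i - b $ i) / s\<rfloor>)" for w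
  have \<tau>: "w $ i = b $ i + s * of_int (\<tau> w $ i)" if w: "w \<in> F" for w i
  proof -
    obtain t :: int where "w $ i = b $ i + s * of_int t" using lat[OF w] by blast
    then show ?thesis using s by (simp add: \<tau>_def)
  qed
  define y :: "int ^ 'd" where "y = (\<chi> i. \<lfloor>(z $ i - b $ i) / s\<rfloor>)"
  have "card {w \<in> F. z \<in> cube w s} \<le> card (window y 2)"
  proof (rule card_inj_on_le[where f = \<tau>])
    show "inj_on \<tau> {w \<in> F. z \<in> cube w s}"
      using \<tau> by (auto simp: inj_on_def vec_eq_iff)
    show "\<tau> ` {w \<in> F. z \<in> cube w s} \<subseteq> window y 2"
    proof clarify
      fix w assume "w \<in> F" "z \<in> cube w s"
      then have "\<bar>(w $ i - b $ i) / s - (z $ i - b $ i) / s\<bar> \<le> of_int 1" for i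
      proof -
        have "\<bar>z $ i - w $ i\<bar> \<le> s / 2" using \<open>z \<in> cube w s\<close> by (simp add: cube_def)
        then have "\<bar>w $ i - z $ i\<bar> \<le> s" using s by linarith
        then show ?thesis using s by (simp add: diff_divide_distrib[symmetric])
      qed
      then have "\<bar>\<tau> w $ i - y $ i\<bar> \<le> 1 + 1" for i
        unfolding \<tau>_def y_def vec_lambda_beta by (rule floor_diff_le)
      then show "\<tau> w \<in> window y 2" by (simp add: window_def)
    qed
  qed simp
  then show ?thesis by (simp add: card_window)
qed

lemma cylinder_union_le:
  fixes e :: "'n::finite \<Rightarrow> 'd::finite"
  assumes "sets \<mu> = sets borel" "\<And>p. emeasure \<mu> (cylinder e \<delta> p) \<le> ennreal M" "finite V" "0 \<le> M"
  shows "emeasure \<mu> (\<Union>p\<in>V. cylinder e \<delta> p) \<le> ennreal (real (card V) * M)"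
proof -
  have "emeasure \<mu> (\<Union>p\<in>V. cylinder e \<delta> p) \<le> (\<Sum>p\<in>V. emeasure \<mu> (cylinder e \<delta> p))"
    using assms by (intro emeasure_subadditive_finite) (auto simp: cylinder_borel)
  also have "\<dots> \<le> (\<Sum>p\<in>V. ennreal M)" by (intro sum_mono assms)
  finally show ?thesis using assms(4) by (simp add: ennreal_mult ennreal_of_nat_eq_real_of_nat)
qed

text \<open>The sum of the masses is the integral of the number of cubes containing a point. This
  count is bounded and vanishes off the cylinders over \<open>V\<close>.\<close>

lemma sum_lattice_cubes_le:
  fixes e :: "'n::finite \<Rightarrow> 'd::finite"
  assumes s: "0 < s" and fin: "finite F"
    and lat: "\<And>w. w \<in> F \<Longrightarrow> \<forall>i. \<exists>t::int. w $ i = b $ i + s * of_int t"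
    and \<mu>: "sets \<mu> = sets borel" "\<And>p. emeasure \<mu> (cylinder e \<delta> p) \<le> ennreal M" "0 \<le> M"
    and V: "finite V" "\<And>w z. w \<in> F \<Longrightarrow> z \<in> cube w s \<Longrightarrow> cell e \<delta> z \<in> V"
  shows "(\<Sum>w\<in>F. emeasure \<mu> (cube w s)) \<le> ennreal (5 ^ CARD('d) * (real (card V) * M))"
proof -
  let ?U = "\<Union>p\<in>V. cylinder e \<delta> p"
  have U: "?U \<in> sets \<mu>" using V(1) by (auto simp: \<mu>(1) cylinder_borel)
  have c: "cube w s \<in> sets \<mu>" for w :: "real ^ 'd" by (simp add: \<mu>(1) cube_borel)
  have "(\<Sum>w\<in>F. emeasure \<mu> (cube w s)) = (\<Sum>w\<in>F. \<integral>\<^sup>+z. indicator (cube w s) z \<partial>\<mu>)"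
    using c by simp
  also have "\<dots> = (\<integral>\<^sup>+z. (\<Sum>w\<in>F. indicator (cube w s) z) \<partial>\<mu>)"
    by (rule nn_integral_sum[symmetric]) (intro borel_measurable_indicator c)
  also have "\<dots> \<le> (\<integral>\<^sup>+z. 5 ^ CARD('d) * indicator ?U z \<partial>\<mu>)"
  proof (rule nn_integral_mono)
    fix z
    have eq: "(\<Sum>w\<in>F. indicator (cube w s) z) = (of_nat (card {w \<in> F. z \<in> cube w s}) :: ennreal)"
      using fin by (simp add: indicator_def sum.If_cases Int_def)
    show "(\<Sum>w\<in>F. indicator (cube w s) z) \<le> (5 ^ CARD('d) * indicator ?U z :: ennreal)"
    proof (cases "z \<in> ?U")
      case True
      have "(of_nat (card {w \<in> F. z \<in> cube w s}) :: ennreal) \<le> of_nat (5 ^ CARD('d))"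
        using card_lattice_cubes_le[OF s lat] by (intro of_nat_mono) auto
      then show ?thesis using True by (simp add: eq)
    next
      case False
      then have "{w \<in> F. z \<in> cube w s} = {}" using V(2) by (auto simp: cylinder_def)
      then show ?thesis unfolding eq by (simp only:) simp
    qed
  qed
  also have "\<dots> = 5 ^ CARD('d) * emeasure \<mu> ?U" using U by (rule nn_integral_cmult_indicator)
  also have "\<dots> \<le> 5 ^ CARD('d) * ennreal (real (card V) * M)"
    by (intro mult_left_mono cylinder_union_le \<mu> V) auto
  also have "\<dots> = ennreal (5 ^ CARD('d) * (real (card V) * M))"
    using \<mu>(3) by (simp add: ennreal_mult flip: ennreal_power)
  finally show ?thesis .
qed

lemma cell_diff_le:
  fixes x y :: "real ^ 'd::finite"
  assumes "0 < \<delta>" "\<And>j. \<bar>x $ j - y $ j\<bar> \<le> \<delta> * 2 ^ k"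
  shows "\<bar>cell e \<delta> x $ i - cell e \<delta> y $ i\<bar> \<le> 2 ^ k + 1"
proof -
  have "\<bar>x $ e i / \<delta> - y $ e i / \<delta>\<bar> \<le> of_int (2 ^ k)"
    using assms by (simp add: diff_divide_distrib[symmetric] divide_le_eq mult.commute)
  then show ?thesis unfolding cell_def vec_lambda_beta by (rule floor_diff_le)
qed

section \<open>Upper bounds for the weighted measure on the graph\<close>

lemma
  fixes A :: "real ^ 'n::finite \<Rightarrow> real ^ 'd::finite" and \<rho> :: "real ^ 'd \<Rightarrow> real"
  assumes A: "continuous_on UNIV A"
    and \<rho>: "\<rho> \<in> borel_measurable (restrict_space borel (graph_of e A))"
    and bound: "\<forall>z\<in>graph_of e A. 0 \<le> \<rho> z \<and> \<rho> z \<le> C"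
  shows sets_weighted_hausdorff: "sets (weighted_hausdorff m (graph_of e A) \<rho>) = sets borel"
    and AE_weighted_hausdorff: "AE z in weighted_hausdorff m (graph_of e A) \<rho>. z \<in> graph_of e A"
    and emeasure_weighted_hausdorff_le: "X \<in> sets borel \<Longrightarrow>
      emeasure (weighted_hausdorff m (graph_of e A) \<rho>) X \<le> ennreal C * hausdorff_outer m (graph_of e A \<inter> X)"
proof -
  let ?G = "graph_of e A" and ?f = "\<lambda>z. ennreal (\<rho> z) * indicator (graph_of e A) z"
  have G: "?G \<in> sets borel" by (intro borel_closed closed_graph_of A)
  have "(\<lambda>z. ennreal (\<rho> z)) \<in> borel_measurable (restrict_space borel ?G)" using \<rho> by measurable
  then have "?f \<in> borel_measurable borel"
    \<comment> \<open>\<open>\<rho>\<close> is measurable on the graph alone. Since the graph is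
      closed, extension by 0 is Borel, so the density is a genuine one.\<close>
    using G by (subst (asm) borel_measurable_restrict_space_iff_ennreal) auto
  then have f: "?f \<in> borel_measurable (hausdorff_measure m)"
    by (simp add: measurable_cong_sets[OF sets_hausdorff_measure refl])
  show sets: "sets (weighted_hausdorff m ?G \<rho>) = sets borel" by (simp add: weighted_hausdorff_def)
  show "AE z in weighted_hausdorff m ?G \<rho>. z \<in> ?G"
    unfolding weighted_hausdorff_def AE_density[OF f] by (auto split: split_indicator)
  assume X: "X \<in> sets borel"
  have "emeasure (weighted_hausdorff m ?G \<rho>) X = (\<integral>\<^sup>+z. ?f z * indicator X z \<partial>hausdorff_measure m)"
    unfolding weighted_hausdorff_def using f X by (intro emeasure_density) auto
  also have "\<dots> \<le> (\<integral>\<^sup>+z. ennreal C * indicator (?G \<inter> X) z \<partial>hausdorff_measure m)"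
    using bound by (intro nn_integral_mono) (auto split: split_indicator intro: ennreal_leI)
  also have "\<dots> = ennreal C * hausdorff_outer m (?G \<inter> X)"
    using G X by (simp add: nn_integral_cmult_indicator emeasure_hausdorff_measure)
  finally show "emeasure (weighted_hausdorff m ?G \<rho>) X \<le> ennreal C * hausdorff_outer m (?G \<inter> X)" .
qed


lemma sum_quarter_powers_le: "(\<Sum>k\<le>K. (1 / 2 ^ k)\<^sup>2) \<le> (2::real)"
proof -
  \<comment> \<open>Adding the last term once more makes the claim inductive, because two quarters
    of it do not exceed it.\<close>
  have "(\<Sum>k\<le>K. (1 / 2 ^ k)\<^sup>2) + (1 / 2 ^ K)\<^sup>2 \<le> (2::real)"
  proof (induction K)
    case (Suc K)
    have "(1 / 2 ^ Suc K)\<^sup>2 = (1 / 2 ^ K)\<^sup>2 / (4::real)" by (simp add: power_divide)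
    then show ?case unfolding sum.atMost_Suc using Suc zero_le_power2[of "1 / 2 ^ K :: real"] by linarith
  qed simp
  then show ?thesis by (smt (verit) zero_le_power2)
qed

theorem theorem1p1:
  fixes C\<^sub>1 :: real
  assumes "CARD('n::finite) \<le> CARD('d::finite)" and "0 < C\<^sub>1"
  shows "\<exists>C\<^sub>2\<ge>0. \<forall>(e :: 'n \<Rightarrow> 'd) (A :: real ^ 'n \<Rightarrow> real ^ 'd) (\<rho> :: real ^ 'd \<Rightarrow> real) \<mu>.
    inj e \<longrightarrow>
    range A \<subseteq> vertical_space e \<longrightarrow>
    (\<exists>K. K-lipschitz_on UNIV A) \<longrightarrow>
    grad_bound A C\<^sub>1 \<longrightarrow>
    \<rho> \<in> borel_measurable (restrict_space borel (graph_of e A)) \<longrightarrow>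
    (\<forall>z\<in>graph_of e A. 0 \<le> \<rho> z \<and> \<rho> z \<le> C\<^sub>1) \<longrightarrow>
    \<mu> = weighted_hausdorff CARD('n) (graph_of e A) \<rho> \<longrightarrow>
    (\<forall>z l. 0 < l \<longrightarrow> cube z l \<inter> msupport \<mu> \<noteq> {} \<longrightarrow>
      (\<Sum>\<^sub>\<infinity>(w, s)\<in>dyadic_cubes z l. (alpha CARD('n) \<mu> w s)\<^sup>2 * emeasure \<mu> (cube w s))
        \<le> ennreal (C\<^sub>2 * l ^ CARD('n)))"
proof -
  let ?n = "CARD('n)" and ?d = "CARD('d)" and ?N = "haar_radius TYPE('n) TYPE('d)"
  have C1: "0 \<le> C\<^sub>1" using assms(2) by simp
  \<comment> \<open>The mass of a cylinder divided by \<open>\<delta> ^ ?n\<close> is at most this,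
    uniformly in the mesh: the bound of the density times that of
    \<open>hausdorff_outer_graph_le\<close>.\<close>
  define D where "D = C\<^sub>1 * (unit_ball_vol (real ?n) * (3 * (1 + C\<^sub>1) * real ?n / 2) ^ ?n)"
  have D: "0 \<le> D" using C1 by (simp add: D_def)
  obtain E where E: "0 \<le> E" and alpha: "\<forall>(e :: 'n \<Rightarrow> 'd) A \<mu> \<delta> m k w.
    inj e \<longrightarrow> range A \<subseteq> vertical_space e \<longrightarrow> (\<forall>x y. norm (A x - A y) \<le> C\<^sub>1 * norm (x - y)) \<longrightarrow>
    0 < \<delta> \<longrightarrow> sets \<mu> = sets borel \<longrightarrow> (AE z in \<mu>. z \<in> graph_of e A) \<longrightarrow>
    (\<forall>p. emeasure \<mu> (cylinder e \<delta> p) = ennreal (\<delta> ^ ?n * m p) \<and> 0 \<le> m p \<and> m p \<le> D) \<longrightarrow>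
    alpha ?n \<mu> w (\<delta> * 2 ^ k) \<le> ennreal (E *
      ((\<Sum>j\<le>k. 2 ^ j * (\<Sum>x\<in>window (cell e \<delta> w) (int ?N * 2 ^ k).
          haar_total m (\<lambda>p. A (grid \<delta> p) /\<^sub>R \<delta>) j x)) / 2 ^ (k * (?n + 1)) + 1 / 2 ^ k))"
    using alpha_le[OF C1 D, where 'n = 'n and 'd = 'd] by (elim exE conjE) (rule that)
  have N: "1 \<le> ?N" by (simp add: haar_radius_def)
  \<comment> \<open>A common bound for the discrete density and the discrete slopes. Below,
    \<open>D\<^sub>1\<close> is the packing constant (overlap times window size times
    \<open>D\<close>) and \<open>H\<close> the normalised Haar energy.\<close>
  define B where "B = max D C\<^sub>1"
  define D\<^sub>1 where "D\<^sub>1 = 5 ^ ?d * ((3 * real (?N + 2)) ^ ?n * D)"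
  define H where "H = 2 * real ?n ^ 2 * (1 + real ?n ^ 2) * (B\<^sup>2 * (3 * real (?N + 4)) ^ ?n)"
  define C\<^sub>2 where "C\<^sub>2 = 2 * E\<^sup>2 * (4 * (3 * real ?N) ^ ?n * D\<^sub>1 * H + 2 * D\<^sub>1)"
  have D1: "0 \<le> D\<^sub>1" using D by (simp add: D\<^sub>1_def)
  have H: "0 \<le> H" by (simp add: H_def)
  have C2: "0 \<le> C\<^sub>2" using D1 H by (simp add: C\<^sub>2_def)
  show ?thesis
  proof (intro exI[of _ C\<^sub>2] conjI C2 allI impI)
    fix e :: "'n \<Rightarrow> 'd" and A :: "real ^ 'n \<Rightarrow> real ^ 'd" and \<rho> \<mu> z l
    assume inj: "inj e" and A: "range A \<subseteq> vertical_space e" and K: "\<exists>K. K-lipschitz_on UNIV A"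
      and grad: "grad_bound A C\<^sub>1" and \<rho>: "\<rho> \<in> borel_measurable (restrict_space borel (graph_of e A))"
      and bound: "\<forall>z\<in>graph_of e A. 0 \<le> \<rho> z \<and> \<rho> z \<le> C\<^sub>1"
      and \<mu>_def: "\<mu> = weighted_hausdorff ?n (graph_of e A) \<rho>" and l: "0 < (l::real)"
    obtain K0 where K0: "K0-lipschitz_on UNIV A" using K by blast
    have lip: "norm (A x - A y) \<le> C\<^sub>1 * norm (x - y)" for x y
      using grad_bound_lipschitz[OF K0 grad C1, of y "x - y"] by simp
    note cont = lipschitz_on_continuous_on[OF K0]
    have \<mu>: "sets \<mu> = sets borel" "AE z in \<mu>. z \<in> graph_of e A"
      unfolding \<mu>_def by (rule sets_weighted_hausdorff[OF cont \<rho> bound], rule AE_weighted_hausdorff[OF cont \<rho> bound])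
    have cyl: "emeasure \<mu> (cylinder e \<delta> p) \<le> ennreal (\<delta> ^ ?n * D)" if \<delta>: "0 < \<delta>" for \<delta> p
    proof -
      have "emeasure \<mu> (cylinder e \<delta> p) \<le> ennreal C\<^sub>1 * hausdorff_outer ?n (graph_of e A \<inter> cylinder e \<delta> p)"
        unfolding \<mu>_def by (rule emeasure_weighted_hausdorff_le[OF cont \<rho> bound cylinder_borel])
      also have "\<dots> \<le> ennreal C\<^sub>1 * ennreal (unit_ball_vol (real ?n) * (3 * (1 + C\<^sub>1) * real ?n / 2) ^ ?n * \<delta> ^ ?n)"
        by (intro mult_left_mono hausdorff_outer_graph_le[OF inj A lip C1 \<delta>]) simp
      also have "\<dots> = ennreal (\<delta> ^ ?n * D)"
        using C1 \<delta> by (subst ennreal_mult[symmetric]) (auto simp: D_def mult_ac)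
      finally show ?thesis .
    qed
    show "(\<Sum>\<^sub>\<infinity>(w, s)\<in>dyadic_cubes z l. (alpha ?n \<mu> w s)\<^sup>2 * emeasure \<mu> (cube w s)) \<le> ennreal (C\<^sub>2 * l ^ ?n)"
    proof (rule infsum_le_finite_sums)
      show "(\<lambda>(w, s). (alpha ?n \<mu> w s)\<^sup>2 * emeasure \<mu> (cube w s)) summable_on dyadic_cubes z l"
        by (rule nonneg_summable_on_complete) auto
    next
      fix \<F> assume fin: "finite \<F>" and "\<F> \<subseteq> dyadic_cubes z l"
      then have "\<forall>Q\<in>\<F>. \<exists>m. snd Q = l / 2 ^ m \<and>
          (\<forall>i. \<exists>t::int. fst Q $ i = z $ i - l / 2 + snd Q / 2 + snd Q * of_int t)
          \<and> (\<forall>i. \<bar>fst Q $ i - z $ i\<bar> \<le> l / 2 - snd Q / 2)"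
        using dyadic_cubes_cases by fastforce
      from bchoice[OF this] obtain gen where gen: "\<And>Q. Q \<in> \<F> \<Longrightarrow> snd Q = l / 2 ^ gen Q"
        and lat: "\<And>Q i. Q \<in> \<F> \<Longrightarrow> \<exists>t::int. fst Q $ i = z $ i - l / 2 + snd Q / 2 + snd Q * of_int t"
        and near: "\<And>Q i. Q \<in> \<F> \<Longrightarrow> \<bar>fst Q $ i - z $ i\<bar> \<le> l / 2 - snd Q / 2"
        by blast
      define K where "K = Max (insert 0 (gen ` \<F>))"
      have K: "gen Q \<le> K" if "Q \<in> \<F>" for Q unfolding K_def using fin that by (intro Max_ge) auto
      \<comment> \<open>The mesh is the side of the last generation that occurs. From here
        \<open>k\<close> counts scales upward from the mesh, so generation m corresponds to k = K -
        m.\<close>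
      define \<delta> where "\<delta> = l / 2 ^ K"
      have \<delta>: "0 < \<delta>" using l by (simp add: \<delta>_def)
      have l\<delta>: "l = \<delta> * 2 ^ K" by (simp add: \<delta>_def)
      define F where "F k = {Q \<in> \<F>. snd Q = \<delta> * 2 ^ k}" for k
      have Fsub: "Q \<in> \<F>" "snd Q = \<delta> * 2 ^ k" if "Q \<in> F k" for Q k using that by (auto simp: F_def)
      have finF: "finite (F k)" for k using fin by (simp add: F_def)
      have \<F>_eq: "\<F> = (\<Union>k\<in>{..K}. F k)"
      proof -
        have "Q \<in> F (K - gen Q)" if "Q \<in> \<F>" for Q
          using that K[OF that] by (simp add: F_def gen[OF that] \<delta>_def power_diff)
        then have "\<F> \<subseteq> (\<Union>k\<in>{..K}. F k)" by (intro subsetI UN_I[of "K - gen _"]) auto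
        moreover have "(\<Union>k\<in>{..K}. F k) \<subseteq> \<F>" by (auto simp: F_def)
        ultimately show ?thesis by (rule antisym)
      qed
      define mass where "mass Q = measure \<mu> (cube (fst Q) (snd Q))" for Q
      define q where "q Q = cell e \<delta> (fst Q)" for Q :: "(real ^ 'd) \<times> real"
      \<comment> \<open>The discrete density. It is a mean over a cylinder, so no differentiation of
        measures is involved.\<close>
      define m where "m p = measure \<mu> (cylinder e \<delta> p) / \<delta> ^ ?n" for p
      define A' where "A' = (\<lambda>p. A (grid \<delta> p) /\<^sub>R \<delta>)"
      define Y where "Y = haar_total m A'"
      have mcyl: "emeasure \<mu> (cylinder e \<delta> p) = ennreal (\<delta> ^ ?n * m p)" "0 \<le> m p" "m p \<le> D" for p
      proof -
        have "emeasure \<mu> (cylinder e \<delta> p) < top" using cyl[OF \<delta>, of p] by (rule order_le_less_trans) simp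
        then have eq: "emeasure \<mu> (cylinder e \<delta> p) = ennreal (measure \<mu> (cylinder e \<delta> p))"
          by (intro emeasure_eq_ennreal_measure) simp
        then show "emeasure \<mu> (cylinder e \<delta> p) = ennreal (\<delta> ^ ?n * m p)" using \<delta> by (simp add: m_def)
        show "0 \<le> m p" using \<delta> by (simp add: m_def)
        have "measure \<mu> (cylinder e \<delta> p) \<le> \<delta> ^ ?n * D"
          using cyl[OF \<delta>, of p] \<delta> D unfolding eq by (simp add: ennreal_le_iff)
        then show "m p \<le> D" using \<delta> by (simp add: m_def pos_divide_le_eq mult.commute)
      qed
      have cubes: "(\<Sum>Q\<in>\<Q>. emeasure \<mu> (cube (fst Q) (snd Q))) \<le> ennreal (5 ^ ?d * (real (card V) * (\<delta> ^ ?n * D)))"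
        if Q: "\<Q> \<subseteq> F k" and V: "finite V" "\<And>Q y. Q \<in> \<Q> \<Longrightarrow> y \<in> cube (fst Q) (snd Q) \<Longrightarrow> cell e \<delta> y \<in> V" for \<Q> k V
      proof -
        let ?s = "\<delta> * 2 ^ k"
        have snd: "snd Q = ?s" if "Q \<in> \<Q>" for Q using Q that by (auto simp: F_def)
        \<comment> \<open>Within one scale a cube is determined by its center, so pairs can be
          replaced by centers.\<close>
        have "inj_on fst \<Q>" using snd by (auto simp: inj_on_def prod_eq_iff)
        then have "(\<Sum>Q\<in>\<Q>. emeasure \<mu> (cube (fst Q) (snd Q))) = (\<Sum>w\<in>fst ` \<Q>. emeasure \<mu> (cube w ?s))"
          by (simp add: sum.reindex snd)
        also have "\<dots> \<le> ennreal (5 ^ ?d * (real (card V) * (\<delta> ^ ?n * D)))"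
        proof (rule sum_lattice_cubes_le[where b = "z - (\<chi> i. l / 2 - ?s / 2)"])
          show "finite (fst ` \<Q>)" using finite_subset[OF Q finF] by simp
          fix w assume "w \<in> fst ` \<Q>"
          then obtain Q' where Q': "Q' \<in> \<Q>" "w = fst Q'" by blast
          then have "Q' \<in> \<F>" using Q Fsub by blast
          show "\<forall>i. \<exists>t::int. w $ i = (z - (\<chi> i. l / 2 - ?s / 2)) $ i + ?s * of_int t"
          proof
            fix i
            obtain t :: int where "fst Q' $ i = z $ i - l / 2 + snd Q' / 2 + snd Q' * of_int t"
              using lat[OF \<open>Q' \<in> \<F>\<close>] by blast
            then show "\<exists>t::int. w $ i = (z - (\<chi> i. l / 2 - ?s / 2)) $ i + ?s * of_int t"
              using snd[OF Q'(1)] by (intro exI[of _ t]) (simp add: Q'(2))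
          qed
          fix y assume "y \<in> cube w ?s"
          then show "cell e \<delta> y \<in> V" using V(2)[OF Q'(1)] Q'(2) snd[OF Q'(1)] by simp
        next
          show "emeasure \<mu> (cylinder e \<delta> p) \<le> ennreal (\<delta> ^ ?n * D)" for p by (rule cyl[OF \<delta>])
        qed (use \<delta> D \<mu> V in auto)
        finally show ?thesis .
      qed
      have snd_le: "snd Q \<le> \<delta> * 2 ^ K" "0 < snd Q" if "k \<le> K" "Q \<in> F k" for Q k
        using Fsub(2)[OF that(2)] \<delta> that(1) by auto
      have loc_cube: "\<bar>cell e \<delta> y $ i - q Q $ i\<bar> \<le> 2 ^ k + 1" if "Q \<in> F k" "y \<in> cube (fst Q) (snd Q)" for Q k y i
        unfolding q_def
      proof (rule cell_diff_le[OF \<delta>])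
        fix j
        have "\<bar>y $ j - fst Q $ j\<bar> \<le> snd Q / 2" using that(2) by (simp add: cube_def)
        moreover have "0 \<le> \<delta> * 2 ^ k" using \<delta> by simp
        ultimately show "\<bar>y $ j - fst Q $ j\<bar> \<le> \<delta> * 2 ^ k" using Fsub(2)[OF that(1)] by linarith
      qed
      have loc_q: "\<bar>q Q $ i - cell e \<delta> z $ i\<bar> \<le> 2 ^ K + 1" if "k \<le> K" "Q \<in> F k" for Q k i
        unfolding q_def
      proof (rule cell_diff_le[OF \<delta>])
        fix j
        show "\<bar>fst Q $ j - z $ j\<bar> \<le> \<delta> * 2 ^ K"
          using near[OF Fsub(1)[OF that(2)], of j] snd_le[OF that] l unfolding l\<delta> by linarith
      qed
      have loc_z: "\<bar>cell e \<delta> y $ i - cell e \<delta> z $ i\<bar> \<le> 2 ^ K + 1"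
        if "k \<le> K" "Q \<in> F k" "y \<in> cube (fst Q) (snd Q)" for Q k y i
      proof (rule cell_diff_le[OF \<delta>])
        fix j
        have "\<bar>y $ j - fst Q $ j\<bar> \<le> snd Q / 2" using that(3) by (simp add: cube_def)
        then show "\<bar>y $ j - z $ j\<bar> \<le> \<delta> * 2 ^ K"
          using near[OF Fsub(1)[OF that(2)], of j] snd_le[OF that(1,2)] l unfolding l\<delta> by linarith
      qed
      \<comment> \<open>\<open>?N * 2 ^ K\<close> is room for the Haar window of a cube. The extra 2
        * 2^K covers the distance 2^K + 1 from its center to that of the initial cube, rounding
        included.\<close>
      define V where "V = window (cell e \<delta> z) (int (?N + 2) * 2 ^ K)"
      have pow1: "(1::int) \<le> 2 ^ k" for k by simp
      have l_pow: "\<delta> ^ ?n * 2 ^ (K * ?n) = l ^ ?n" by (simp add: l\<delta> power_mult_distrib power_mult)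
      have mass_V: "(\<Sum>Q\<in>\<Q>. emeasure \<mu> (cube (fst Q) (snd Q))) \<le> ennreal (D\<^sub>1 * l ^ ?n)"
        if "k \<le> K" "\<Q> \<subseteq> F k" for \<Q> k
      proof -
        have "cell e \<delta> y \<in> V" if Q: "Q \<in> \<Q>" "y \<in> cube (fst Q) (snd Q)" for Q y
        proof -
          have "\<bar>cell e \<delta> y $ i - cell e \<delta> z $ i\<bar> \<le> int (?N + 2) * 2 ^ K" for i
          proof -
            have "(0::int) \<le> int ?N * 2 ^ K" by simp
            then show ?thesis
              using loc_z[OF \<open>k \<le> K\<close> subsetD[OF \<open>\<Q> \<subseteq> F k\<close> Q(1)] Q(2), of i] pow1[of K]
              unfolding of_nat_add of_nat_numeral distrib_right by linarith
          qed
          then show ?thesis by (simp add: V_def window_def)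
        qed
        then have "(\<Sum>Q\<in>\<Q>. emeasure \<mu> (cube (fst Q) (snd Q))) \<le> ennreal (5 ^ ?d * (real (card V) * (\<delta> ^ ?n * D)))"
          by (intro cubes[OF that(2)]) (auto simp: V_def)
        also have "\<dots> \<le> ennreal (5 ^ ?d * (((3 * real (?N + 2)) ^ ?n * 2 ^ (K * ?n)) * (\<delta> ^ ?n * D)))"
          unfolding V_def using \<delta> D
          by (intro ennreal_leI mult_left_mono mult_right_mono card_window_scale_le) auto
        also have "5 ^ ?d * (((3 * real (?N + 2)) ^ ?n * 2 ^ (K * ?n)) * (\<delta> ^ ?n * D)) = D\<^sub>1 * l ^ ?n"
          unfolding D\<^sub>1_def l_pow[symmetric] by (simp only: mult_ac)
        finally show ?thesis .
      qed
      have emass: "emeasure \<mu> (cube (fst Q) (snd Q)) = ennreal (mass Q)" if "k \<le> K" "Q \<in> F k" for Q k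
      proof -
        have "{Q} \<subseteq> F k" using that(2) by simp
        from mass_V[OF that(1) this] have "emeasure \<mu> (cube (fst Q) (snd Q)) \<le> ennreal (D\<^sub>1 * l ^ ?n)" by simp
        then have "emeasure \<mu> (cube (fst Q) (snd Q)) < top" by (rule order_le_less_trans) simp
        then show ?thesis unfolding mass_def by (intro emeasure_eq_ennreal_measure) simp
      qed
      have sum_mass: "(\<Sum>Q\<in>\<Q>. mass Q) \<le> M"
        if "k \<le> K" "\<Q> \<subseteq> F k" "(\<Sum>Q\<in>\<Q>. emeasure \<mu> (cube (fst Q) (snd Q))) \<le> ennreal M" "0 \<le> M" for \<Q> k M
      proof -
        have "(\<Sum>Q\<in>\<Q>. emeasure \<mu> (cube (fst Q) (snd Q))) = (\<Sum>Q\<in>\<Q>. ennreal (mass Q))"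
          using emass[OF that(1)] that(2) by (intro sum.cong refl) auto
        also have "\<dots> = ennreal (\<Sum>Q\<in>\<Q>. mass Q)" by (rule sum_ennreal) (simp add: mass_def)
        finally show ?thesis using that(3,4) by (simp add: ennreal_le_iff)
      qed
      define X where "X k Q = (\<Sum>j\<le>k. 2 ^ j * (\<Sum>x\<in>window (q Q) (int ?N * 2 ^ k). Y j x)) / 2 ^ (k * (?n + 1))" for k Q
      have X0: "0 \<le> X k Q" for k Q
        unfolding X_def Y_def haar_total_def
        by (intro divide_nonneg_nonneg sum_nonneg mult_nonneg_nonneg add_nonneg_nonneg) auto
      \<comment> \<open>The packing constant is of order \<open>\<delta> ^ ?n\<close>: the cubes of
        one scale that see a lattice point lie over a window of O(2^(kn)) cells of mass
        O(\<delta>^n) each.\<close>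
      have carleson: "(\<Sum>k\<le>K. \<Sum>Q\<in>F k. (X k Q)\<^sup>2 * mass Q)
          \<le> 4 * (3 * real ?N) ^ ?n * (D\<^sub>1 * \<delta> ^ ?n) * (\<Sum>j\<le>K. \<Sum>x\<in>V. (Y j x)\<^sup>2)"
        unfolding X_def
      proof (rule carleson_sum[OF N finF])
        show "finite V" by (simp add: V_def)
        show "0 \<le> mass Q" for Q by (simp add: mass_def)
        fix k assume k: "k \<le> K"
        have kK: "(2::int) ^ k \<le> 2 ^ K" using k by simp
        show "window (q Q) (int ?N * 2 ^ k) \<subseteq> V" if "Q \<in> F k" for Q
        proof
          fix x assume "x \<in> window (q Q) (int ?N * 2 ^ k)"
          then have x: "\<bar>x $ i - q Q $ i\<bar> \<le> int ?N * 2 ^ k" for i by (simp add: window_def)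
          have "\<bar>x $ i - cell e \<delta> z $ i\<bar> \<le> int (?N + 2) * 2 ^ K" for i
            using x[of i] loc_q[OF k that, of i] pow1[of K] mult_left_mono[OF kK, of "int ?N"]
            unfolding of_nat_add of_nat_numeral distrib_right by linarith
          then show "x \<in> V" by (simp add: V_def window_def)
        qed
        fix x
        let ?\<Q> = "{Q \<in> F k. x \<in> window (q Q) (int ?N * 2 ^ k)}"
        show "(\<Sum>Q\<in>?\<Q>. mass Q) \<le> D\<^sub>1 * \<delta> ^ ?n * 2 ^ (k * ?n)"
        proof (rule sum_mass[OF k])
          let ?W = "window x (int (?N + 2) * 2 ^ k)"
          have "cell e \<delta> y \<in> ?W" if Q: "Q \<in> ?\<Q>" "y \<in> cube (fst Q) (snd Q)" for Q y
          proof -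
            have "\<bar>cell e \<delta> y $ i - x $ i\<bar> \<le> int (?N + 2) * 2 ^ k" for i
            proof -
              have "\<bar>x $ i - q Q $ i\<bar> \<le> int ?N * 2 ^ k" using Q(1) by (simp add: window_def)
              moreover have "Q \<in> F k" using Q(1) by simp
              ultimately show ?thesis
                using loc_cube[OF \<open>Q \<in> F k\<close> Q(2), of i] pow1[of k] unfolding of_nat_add of_nat_numeral distrib_right by linarith
            qed
            then show ?thesis by (simp add: window_def)
          qed
          then have "(\<Sum>Q\<in>?\<Q>. emeasure \<mu> (cube (fst Q) (snd Q))) \<le> ennreal (5 ^ ?d * (real (card ?W) * (\<delta> ^ ?n * D)))"
            by (intro cubes) auto
          also have "\<dots> \<le> ennreal (5 ^ ?d * (((3 * real (?N + 2)) ^ ?n * 2 ^ (k * ?n)) * (\<delta> ^ ?n * D)))"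
            using \<delta> D by (intro ennreal_leI mult_left_mono mult_right_mono card_window_scale_le) auto
          also have "5 ^ ?d * (((3 * real (?N + 2)) ^ ?n * 2 ^ (k * ?n)) * (\<delta> ^ ?n * D)) = D\<^sub>1 * \<delta> ^ ?n * 2 ^ (k * ?n)"
            unfolding D\<^sub>1_def by (simp only: mult_ac)
          finally show "(\<Sum>Q\<in>?\<Q>. emeasure \<mu> (cube (fst Q) (snd Q))) \<le> ennreal (D\<^sub>1 * \<delta> ^ ?n * 2 ^ (k * ?n))" .
        qed (use D1 \<delta> in auto)
      qed
      have lipA': "norm (unit_diff i A' p) \<le> B" for i p
        using norm_unit_diff_grid_le[OF lip \<delta>, of i p] by (simp add: A'_def B_def)
      have "\<bar>m p\<bar> \<le> B" for p using mcyl[of p] by (simp add: B_def)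
      from sum_haar_total_square_le[OF this lipA']
      have "(\<Sum>j\<le>K. \<Sum>x\<in>V. (Y j x)\<^sup>2) \<le> 2 * real ?n ^ 2 * (1 + real ?n ^ 2) *
          (B\<^sup>2 * real (card (window (cell e \<delta> z) (int (?N + 2) * 2 ^ K + 2 ^ Suc K))))"
        unfolding Y_def V_def .
      \<comment> \<open>The square function enlarges the window by 2^(K+1), which explains the N + 4
        in \<open>H\<close>.\<close>
      also have "int (?N + 2) * 2 ^ K + 2 ^ Suc K = int (?N + 4) * 2 ^ K" by (simp add: algebra_simps)
      also have "2 * real ?n ^ 2 * (1 + real ?n ^ 2) * (B\<^sup>2 * real (card (window (cell e \<delta> z) (int (?N + 4) * 2 ^ K))))
          \<le> 2 * real ?n ^ 2 * (1 + real ?n ^ 2) * (B\<^sup>2 * ((3 * real (?N + 4)) ^ ?n * 2 ^ (K * ?n)))"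
        by (intro mult_left_mono card_window_scale_le) auto
      also have "\<dots> = H * 2 ^ (K * ?n)" by (simp add: H_def)
      finally have Ybound: "(\<Sum>j\<le>K. \<Sum>x\<in>V. (Y j x)\<^sup>2) \<le> H * 2 ^ (K * ?n)" .
      have first: "(\<Sum>k\<le>K. \<Sum>Q\<in>F k. (X k Q)\<^sup>2 * mass Q) \<le> 4 * (3 * real ?N) ^ ?n * D\<^sub>1 * H * l ^ ?n"
      proof -
        have "4 * (3 * real ?N) ^ ?n * (D\<^sub>1 * \<delta> ^ ?n) * (\<Sum>j\<le>K. \<Sum>x\<in>V. (Y j x)\<^sup>2)
            \<le> 4 * (3 * real ?N) ^ ?n * (D\<^sub>1 * \<delta> ^ ?n) * (H * 2 ^ (K * ?n))"
          using D1 \<delta> by (intro mult_left_mono Ybound) auto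
        also have "\<dots> = 4 * (3 * real ?N) ^ ?n * D\<^sub>1 * H * l ^ ?n"
          unfolding l_pow[symmetric] by (simp only: mult_ac)
        finally show ?thesis using carleson by linarith
      qed
      \<comment> \<open>The discretisation errors: each scale has total mass O(l^n), and the squared
        errors are summable over the scales.\<close>
      have second: "(\<Sum>k\<le>K. \<Sum>Q\<in>F k. (1 / 2 ^ k)\<^sup>2 * mass Q) \<le> 2 * D\<^sub>1 * l ^ ?n"
      proof -
        have "(\<Sum>k\<le>K. \<Sum>Q\<in>F k. (1 / 2 ^ k)\<^sup>2 * mass Q) = (\<Sum>k\<le>K. (1 / 2 ^ k)\<^sup>2 * (\<Sum>Q\<in>F k. mass Q))"
          by (simp only: sum_distrib_left)
        also have "\<dots> \<le> (\<Sum>k\<le>K. (1 / 2 ^ k)\<^sup>2 * (D\<^sub>1 * l ^ ?n))"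
        proof (intro sum_mono mult_left_mono)
          fix k assume "k \<in> {..K}"
          then have k: "k \<le> K" by simp
          show "(\<Sum>Q\<in>F k. mass Q) \<le> D\<^sub>1 * l ^ ?n"
            by (rule sum_mass[OF k order_refl mass_V[OF k order_refl]]) (use D1 l in simp)
        qed simp
        also have "\<dots> = (\<Sum>k\<le>K. (1 / 2 ^ k)\<^sup>2) * (D\<^sub>1 * l ^ ?n)" by (rule sum_distrib_right[symmetric])
        also have "\<dots> \<le> 2 * (D\<^sub>1 * l ^ ?n)"
          by (intro mult_right_mono sum_quarter_powers_le) (use D1 l in simp)
        finally show ?thesis by simp
      qed
      have single: "(alpha ?n \<mu> (fst Q) (snd Q))\<^sup>2 * emeasure \<mu> (cube (fst Q) (snd Q))
          \<le> ennreal (2 * E\<^sup>2 * ((X k Q)\<^sup>2 * mass Q + (1 / 2 ^ k)\<^sup>2 * mass Q))" if k: "k \<le> K" and Q: "Q \<in> F k" for k Q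
      proof -
        have "alpha ?n \<mu> (fst Q) (\<delta> * 2 ^ k) \<le> ennreal (E * (X k Q + 1 / 2 ^ k))"
          unfolding X_def q_def Y_def A'_def
          by (rule alpha[rule_format, OF inj A lip \<delta> \<mu>]) (simp add: mcyl)
        then have "(alpha ?n \<mu> (fst Q) (snd Q))\<^sup>2 * emeasure \<mu> (cube (fst Q) (snd Q))
            \<le> (ennreal (E * (X k Q + 1 / 2 ^ k)))\<^sup>2 * ennreal (mass Q)"
          unfolding emass[OF k Q] unfolding Fsub(2)[OF Q] power2_eq_square
          by (intro mult_right_mono mult_mono) auto
        also have "\<dots> = ennreal ((E * (X k Q + 1 / 2 ^ k))\<^sup>2 * mass Q)"
        proof -
          have "0 \<le> E * (X k Q + 1 / 2 ^ k)" using E X0[of k Q] by simp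
          from ennreal_power[OF this, of 2] show ?thesis
            by (simp only:) (rule ennreal_mult[symmetric], auto simp: mass_def)
        qed
        also have "\<dots> \<le> ennreal (2 * E\<^sup>2 * ((X k Q)\<^sup>2 * mass Q + (1 / 2 ^ k)\<^sup>2 * mass Q))"
        proof (rule ennreal_leI)
          have "(X k Q + 1 / 2 ^ k)\<^sup>2 \<le> 2 * ((X k Q)\<^sup>2 + (1 / 2 ^ k)\<^sup>2)"
            by (rule sum_power2_le)
          then have "E\<^sup>2 * (X k Q + 1 / 2 ^ k)\<^sup>2 * mass Q \<le> E\<^sup>2 * (2 * ((X k Q)\<^sup>2 + (1 / 2 ^ k)\<^sup>2)) * mass Q"
            by (intro mult_right_mono mult_left_mono) (auto simp: mass_def)
          then show "(E * (X k Q + 1 / 2 ^ k))\<^sup>2 * mass Q \<le> 2 * E\<^sup>2 * ((X k Q)\<^sup>2 * mass Q + (1 / 2 ^ k)\<^sup>2 * mass Q)"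
            unfolding power_mult_distrib by (simp only: distrib_left distrib_right mult_ac)
        qed
        finally show ?thesis .
      qed
      \<comment> \<open>Different scales have different sides, so each cube of the finite family is
        counted exactly once.\<close>
      have disj: "F j \<inter> F k = {}" if "j \<noteq> k" for j k
        using that \<delta> by (auto simp: F_def)
      have "(\<Sum>(w, s)\<in>\<F>. (alpha ?n \<mu> w s)\<^sup>2 * emeasure \<mu> (cube w s))
          = (\<Sum>k\<le>K. \<Sum>Q\<in>F k. (alpha ?n \<mu> (fst Q) (snd Q))\<^sup>2 * emeasure \<mu> (cube (fst Q) (snd Q)))"
        unfolding \<F>_eq case_prod_unfold using finF disj by (intro sum.UNION_disjoint) auto
      also have "\<dots> \<le> (\<Sum>k\<le>K. \<Sum>Q\<in>F k. ennreal (2 * E\<^sup>2 * ((X k Q)\<^sup>2 * mass Q + (1 / 2 ^ k)\<^sup>2 * mass Q)))"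
        by (intro sum_mono single) auto
      also have "\<dots> = ennreal (\<Sum>k\<le>K. \<Sum>Q\<in>F k. 2 * E\<^sup>2 * ((X k Q)\<^sup>2 * mass Q + (1 / 2 ^ k)\<^sup>2 * mass Q))"
      proof -
        have nn: "0 \<le> 2 * E\<^sup>2 * ((X k Q)\<^sup>2 * mass Q + (1 / 2 ^ k)\<^sup>2 * mass Q)" for k Q
          by (simp add: mass_def)
        show ?thesis using nn by (simp add: sum_ennreal sum_nonneg)
      qed
      also have "(\<Sum>k\<le>K. \<Sum>Q\<in>F k. 2 * E\<^sup>2 * ((X k Q)\<^sup>2 * mass Q + (1 / 2 ^ k)\<^sup>2 * mass Q))
          = 2 * E\<^sup>2 * ((\<Sum>k\<le>K. \<Sum>Q\<in>F k. (X k Q)\<^sup>2 * mass Q) + (\<Sum>k\<le>K. \<Sum>Q\<in>F k. (1 / 2 ^ k)\<^sup>2 * mass Q))"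
        by (simp only: sum_distrib_left sum.distrib distrib_left)
      also have "ennreal \<dots> \<le> ennreal (2 * E\<^sup>2 * (4 * (3 * real ?N) ^ ?n * D\<^sub>1 * H * l ^ ?n + 2 * D\<^sub>1 * l ^ ?n))"
        by (intro ennreal_leI mult_left_mono add_mono first second) simp
      also have "2 * E\<^sup>2 * (4 * (3 * real ?N) ^ ?n * D\<^sub>1 * H * l ^ ?n + 2 * D\<^sub>1 * l ^ ?n) = C\<^sub>2 * l ^ ?n"
        by (simp add: C\<^sub>2_def algebra_simps)
      finally show "(\<Sum>(w, s)\<in>\<F>. (alpha ?n \<mu> w s)\<^sup>2 * emeasure \<mu> (cube w s)) \<le> ennreal (C\<^sub>2 * l ^ ?n)" .
    qed
  qed
qed

end
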